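(* Let $s>5/2$. The sectional curvature of $(G^s,\langle\cdot,\cdot\rangle)$ is constant and equal to $1$.
   Context: $S^1\simeq\mathbb R/\mathbb Z$; $H^s(S^1)$ is the $L_2$-based Sobolev space and $H_0^s(S^1)=\{u\in H^s(S^1):u(0)=0\}$. For $s>5/2$, $\mathrm{Diff}_0^s(S^1)$ is the Banach manifold of orientation-preserving diffeomorphisms $\varphi$ of $S^1$ of Sobolev class $H^s$ with $\varphi(0)=0$. $G^s$ is the semidirect product $\mathrm{Diff}_0^s(S^1)\circledS H^{s-1}(S^1)$ with multiplication $(\varphi,\alpha)(\psi,\beta)=(\varphi\circ\psi,\beta+\alpha\circ\psi)$. It carries the right-invariant (indefinite, nondegenerate) weak pseudo-Riemannian metric (the case $\kappa=-1$) $$\langle U,V\rangle_{(\varphi,\alpha)}=\frac14\int_{S^1}\Bigl(\frac{U_{1x}V_{1x}}{\varphi_x}-U_2V_2\varphi_x\Bigr)dx,$$ for $U=(U_1,U_2)$, $V=(V_1,V_2)$ in $T_{(\varphi,\alpha)}G^s\simeq H_0^s(S^1)\times H^{s-1}(S^1)$. The curvature tensor $R$ is that of the metric connection $(\nabla_XY)(\varphi,\alpha)=DY\cdot X-\Gamma_{(\varphi,\alpha)}(Y,X)$, where $$\Gamma_{(\mathrm{id},0)}((u,\rho),(v,\sigma))=\begin{pmatrix}-\frac12A^{-1}\partial_x(u_xv_x-\rho\sigma)\\-\frac12(u_x\sigma+v_x\rho)\end{pmatrix},\qquad \Gamma_{(\varphi,\alpha)}(U,V)=\Gamma_{(\mathrm{id},0)}(U\circ\varphi^{-1},V\circ\varphi^{-1})\circ\varphi,$$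 and $A=-\partial_x^2$ is viewed as an isomorphism from $H_0^s(S^1)$ onto the zero-mean functions in $H^{s-2}(S^1)$, with inverse $(A^{-1}f)(x)=-\int_0^x\int_0^yf(z)\,dz\,dy+x\int_{S^1}\int_0^yf(z)\,dz\,dy$. The sectional curvature of a pair $u,v$ of tangent vectors at a point with $\langle u,u\rangle\langle v,v\rangle-\langle u,v\rangle^2\ne0$ is $$\mathrm{sec}(u,v)=\frac{\langle R(u,v)v,u\rangle}{\langle u,u\rangle\langle v,v\rangle-\langle u,v\rangle^2},$$ where $R(X,Y)Z=\nabla_X\nabla_YZ-\nabla_Y\nabla_XZ-\nabla_{[X,Y]}Z$. *)

theory Defs
  imports "HOL-Analysis.Analysis" "HOL-Library.Function_Algebras"
begin

text \<open>
  The library supplies the pointwise group structure on functions; we add pointwise real scalar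
  multiplication, so that pairs of real functions form a real vector space.
\<close>

instantiation "fun" :: (type, real_vector) real_vector
begin

definition scaleR_fun :: "real \<Rightarrow> ('a \<Rightarrow> 'b) \<Rightarrow> 'a \<Rightarrow> 'b" where
  "scaleR_fun c f = (\<lambda>x. c *\<^sub>R f x)"

instance
  by standard (auto simp: scaleR_fun_def fun_eq_iff scaleR_add_right scaleR_add_left)

end

section \<open>Sobolev spaces on the circle\<close>

text \<open>
  Functions on \<open>S\<^sup>1 = \<real>/\<int>\<close> are 1-periodic functions on the line.  A class in \<open>H\<^sup>s(S\<^sup>1)\<close> with
  \<open>s > 1/2\<close> has exactly one continuous representative, and we use that representative.  The
  definition below is therefore meant for \<open>s > 1/2\<close> only; it is used with the exponents \<open>s\<close> and
  \<open>s - 1\<close>, where \<open>s > 5/2\<close>.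
\<close>

definition fourier_coeff :: "(real \<Rightarrow> real) \<Rightarrow> int \<Rightarrow> complex" where
  "fourier_coeff f n = (LBINT x=0..1. cis (- 2 * pi * real_of_int n * x) * complex_of_real (f x))"

definition sobolev_weight :: "real \<Rightarrow> (real \<Rightarrow> real) \<Rightarrow> int \<Rightarrow> real" where
  "sobolev_weight s f n = (1 + (real_of_int n)\<^sup>2) powr s * (cmod (fourier_coeff f n))\<^sup>2"

definition sobolev :: "real \<Rightarrow> (real \<Rightarrow> real) set" where
  "sobolev s = {f. continuous_on UNIV f \<and> (\<forall>x. f (x + 1) = f x) \<and>
                   sobolev_weight s f summable_on UNIV}"

definition sobolev0 :: "real \<Rightarrow> (real \<Rightarrow> real) set" where
  "sobolev0 s = {f \<in> sobolev s. f 0 = 0}"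

definition sobolev_norm :: "real \<Rightarrow> (real \<Rightarrow> real) \<Rightarrow> real" where
  "sobolev_norm s f = sqrt (\<Sum>\<^sub>\<infinity>n. sobolev_weight s f n)"

section \<open>The manifold\<close>

text \<open>
  A circle diffeomorphism fixing 0 is represented by its lift \<open>\<phi>\<close> to the line with \<open>\<phi> 0 = 0\<close>;
  if it preserves orientation, the lift satisfies \<open>\<phi> (x + 1) = \<phi> x + 1\<close>, so \<open>\<phi> - id\<close> is periodic.
  Being of class \<open>H\<^sup>s\<close>, \<open>s > 5/2\<close>, such a \<open>\<phi>\<close> is automatically \<open>C\<^sup>1\<close>; differentiability of the
  inverse is what makes the homeomorphism a diffeomorphism.
\<close>

definition Diff0 :: "real \<Rightarrow> (real \<Rightarrow> real) set" where
  "Diff0 s = {\<phi>. (\<lambda>x. \<phi> x - x) \<in> sobolev0 s \<and> bij \<phi> \<and> strict_mono \<phi> \<and>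
                 (inv \<phi>) differentiable_on UNIV}"

type_synonym fun_pair = "(real \<Rightarrow> real) \<times> (real \<Rightarrow> real)"

definition G :: "real \<Rightarrow> fun_pair set" where
  "G s = Diff0 s \<times> sobolev (s - 1)"

text \<open>
  \<open>G s\<close> is an open subset of an affine space over \<open>tangent s\<close>, which is the tangent space at every
  point.  So the manifold has a single global chart, vector fields are maps \<open>G s \<rightarrow> tangent s\<close>,
  and their derivatives are Frechet derivatives for the norm \<open>tangent_norm s\<close>.
\<close>

definition tangent :: "real \<Rightarrow> fun_pair set" where
  "tangent s = sobolev0 s \<times> sobolev (s - 1)"

definition tangent_norm :: "real \<Rightarrow> fun_pair \<Rightarrow> real" where
  "tangent_norm s U = sqrt ((sobolev_norm s (fst U))\<^sup>2 + (sobolev_norm (s - 1) (snd U))\<^sup>2)"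

definition G_metric :: "fun_pair \<Rightarrow> fun_pair \<Rightarrow> fun_pair \<Rightarrow> real" where
  "G_metric p U V = 1/4 * (LBINT x=0..1.
      deriv (fst U) x * deriv (fst V) x / deriv (fst p) x - snd U x * snd V x * deriv (fst p) x)"

section \<open>Differential calculus in the global chart\<close>

definition tangent_linear :: "real \<Rightarrow> (fun_pair \<Rightarrow> fun_pair) \<Rightarrow> bool" where
  "tangent_linear s L \<longleftrightarrow>
     (\<forall>h\<in>tangent s. L h \<in> tangent s) \<and>
     (\<forall>h\<in>tangent s. \<forall>k\<in>tangent s. L (h + k) = L h + L k) \<and>
     (\<forall>c. \<forall>h\<in>tangent s. L (c *\<^sub>R h) = c *\<^sub>R L h)"

definition tangent_bounded_linear :: "real \<Rightarrow> (fun_pair \<Rightarrow> fun_pair) \<Rightarrow> bool" where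
  "tangent_bounded_linear s L \<longleftrightarrow> tangent_linear s L \<and>
     (\<exists>C. \<forall>h\<in>tangent s. tangent_norm s (L h) \<le> C * tangent_norm s h)"

definition tangent_bounded_bilinear :: "real \<Rightarrow> (fun_pair \<Rightarrow> fun_pair \<Rightarrow> fun_pair) \<Rightarrow> bool" where
  "tangent_bounded_bilinear s B \<longleftrightarrow>
     (\<forall>h\<in>tangent s. tangent_linear s (\<lambda>k. B h k)) \<and>
     (\<forall>k\<in>tangent s. tangent_linear s (\<lambda>h. B h k)) \<and>
     (\<exists>C. \<forall>h\<in>tangent s. \<forall>k\<in>tangent s.
        tangent_norm s (B h k) \<le> C * tangent_norm s h * tangent_norm s k)"

definition has_frechet_derivative ::
    "real \<Rightarrow> (fun_pair \<Rightarrow> fun_pair) \<Rightarrow> (fun_pair \<Rightarrow> fun_pair) \<Rightarrow> fun_pair \<Rightarrow> bool" where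
  "has_frechet_derivative s F L p \<longleftrightarrow> tangent_bounded_linear s L \<and>
     (\<forall>e>0. \<exists>d>0. \<forall>q\<in>G s. tangent_norm s (q - p) < d \<longrightarrow>
        tangent_norm s (F q - F p - L (q - p)) \<le> e * tangent_norm s (q - p))"

text \<open>Where it exists, the derivative is unique on \<open>tangent s\<close>, the only place it is evaluated.\<close>

definition frechet_deriv :: "real \<Rightarrow> (fun_pair \<Rightarrow> fun_pair) \<Rightarrow> fun_pair \<Rightarrow> fun_pair \<Rightarrow> fun_pair" where
  "frechet_deriv s F p = (SOME L. has_frechet_derivative s F L p)"

text \<open>
  Vector fields of class \<open>C\<^sup>2\<close>: \<open>D\<close> is the derivative of \<open>X\<close>, \<open>D2\<close> is the derivative of \<open>D\<close> with
  respect to the operator norm, and \<open>D2\<close> is continuous.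
\<close>

definition C2_vector_field :: "real \<Rightarrow> (fun_pair \<Rightarrow> fun_pair) \<Rightarrow> bool" where
  "C2_vector_field s X \<longleftrightarrow> (\<forall>p\<in>G s. X p \<in> tangent s) \<and>
     (\<exists>D D2. \<forall>p\<in>G s.
        has_frechet_derivative s X (D p) p \<and>
        tangent_bounded_bilinear s (D2 p) \<and>
        (\<forall>e>0. \<exists>d>0. \<forall>q\<in>G s. tangent_norm s (q - p) < d \<longrightarrow>
           (\<forall>h\<in>tangent s. tangent_norm s (D q h - D p h - D2 p (q - p) h)
              \<le> e * tangent_norm s (q - p) * tangent_norm s h)) \<and>
        (\<forall>e>0. \<exists>d>0. \<forall>q\<in>G s. tangent_norm s (q - p) < d \<longrightarrow>
           (\<forall>h\<in>tangent s. \<forall>k\<in>tangent s. tangent_norm s (D2 q h k - D2 p h k)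
              \<le> e * tangent_norm s h * tangent_norm s k)))"

section \<open>The connection and its curvature\<close>

definition A_inv :: "(real \<Rightarrow> real) \<Rightarrow> real \<Rightarrow> real" where
  "A_inv f = (\<lambda>x. - (LBINT y=0..x. (LBINT z=0..y. f z)) + x * (LBINT y=0..1. (LBINT z=0..y. f z)))"

definition Christoffel_id :: "fun_pair \<Rightarrow> fun_pair \<Rightarrow> fun_pair" where
  "Christoffel_id U V =
     (\<lambda>x. - (1/2) * A_inv (deriv (\<lambda>y. deriv (fst U) y * deriv (fst V) y - snd U y * snd V y)) x,
      \<lambda>x. - (1/2) * (deriv (fst U) x * snd V x + deriv (fst V) x * snd U x))"

definition right_compose :: "fun_pair \<Rightarrow> (real \<Rightarrow> real) \<Rightarrow> fun_pair" where
  "right_compose U \<psi> = (fst U \<circ> \<psi>, snd U \<circ> \<psi>)"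

definition Christoffel :: "fun_pair \<Rightarrow> fun_pair \<Rightarrow> fun_pair \<Rightarrow> fun_pair" where
  "Christoffel p U V =
     right_compose
       (Christoffel_id (right_compose U (inv (fst p))) (right_compose V (inv (fst p)))) (fst p)"

definition covariant_deriv ::
    "real \<Rightarrow> (fun_pair \<Rightarrow> fun_pair) \<Rightarrow> (fun_pair \<Rightarrow> fun_pair) \<Rightarrow> fun_pair \<Rightarrow> fun_pair" where
  "covariant_deriv s X Y = (\<lambda>p. frechet_deriv s Y p (X p) - Christoffel p (Y p) (X p))"

definition Lie_bracket ::
    "real \<Rightarrow> (fun_pair \<Rightarrow> fun_pair) \<Rightarrow> (fun_pair \<Rightarrow> fun_pair) \<Rightarrow> fun_pair \<Rightarrow> fun_pair" where
  "Lie_bracket s X Y = (\<lambda>p. frechet_deriv s Y p (X p) - frechet_deriv s X p (Y p))"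

definition curvature ::
    "real \<Rightarrow> (fun_pair \<Rightarrow> fun_pair) \<Rightarrow> (fun_pair \<Rightarrow> fun_pair) \<Rightarrow> (fun_pair \<Rightarrow> fun_pair) \<Rightarrow>
     fun_pair \<Rightarrow> fun_pair" where
  "curvature s X Y Z = (\<lambda>p.
     covariant_deriv s X (covariant_deriv s Y Z) p - covariant_deriv s Y (covariant_deriv s X Z) p
       - covariant_deriv s (Lie_bracket s X Y) Z p)"

text \<open>
  The curvature tensor on tangent vectors \<open>u, v, w\<close> at \<open>p\<close>: the common value of \<open>R(X,Y)Z\<close> at \<open>p\<close>
  over all vector fields extending \<open>u, v, w\<close>.
\<close>

definition curvature_tensor ::
    "real \<Rightarrow> fun_pair \<Rightarrow> fun_pair \<Rightarrow> fun_pair \<Rightarrow> fun_pair \<Rightarrow> fun_pair" where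
  "curvature_tensor s p u v w = (THE r. \<forall>X Y Z.
     C2_vector_field s X \<and> C2_vector_field s Y \<and> C2_vector_field s Z \<and>
     X p = u \<and> Y p = v \<and> Z p = w \<longrightarrow> curvature s X Y Z p = r)"

definition sectional_curvature :: "real \<Rightarrow> fun_pair \<Rightarrow> fun_pair \<Rightarrow> fun_pair \<Rightarrow> real" where
  "sectional_curvature s p u v =
     G_metric p (curvature_tensor s p u v v) u / (G_metric p u u * G_metric p v v - (G_metric p u v)\<^sup>2)"

end

theory Submission
  imports Defs
begin

text \<open>
  Changing variables by \<open>\<phi>\<close> turns the Christoffel map at \<open>(\<phi>, \<alpha>)\<close> into an expression without compositions:
  with \<open>f = \<phi>'\<close> and \<open>g = u' v' / f - \<rho> \<sigma> f\<close>, the derivative of the first component of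
  \<open>\<Gamma>((u, \<rho>), (v, \<sigma>))\<close> is \<open>(g - f \<integral> g) / 2\<close> and the second component is
  \<open>- (u' \<sigma> + v' \<rho>) / (2 f)\<close>.  Since \<open>H^(s-1)\<close> is a Banach algebra closed under reciprocals of
  non-vanishing functions, \<open>\<Gamma>\<close> is differentiable in \<open>f\<close>, with a remainder quadratic in the increment, and the
  second covariant derivatives exist.  Symmetry of second derivatives removes all derivatives of the
  vector fields from \<open>R(X, Y) Z\<close>, leaving
  \<open>D\<Gamma>[v](w, u) - D\<Gamma>[u](w, v) + \<Gamma>(\<Gamma>(w, v), u) - \<Gamma>(\<Gamma>(w, u), v)\<close>, and pointwise
  algebra identifies this with \<open>\<langle>w, v\<rangle> u - \<langle>w, u\<rangle> v\<close>.
\<close>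

section \<open>Fourier coefficients of continuous functions\<close>

text \<open>The map sending \<open>\<phi>\<close> to \<open>u \<circ> inv \<phi>\<close> is
  differentiable on H^s only at the cost of a derivative of \<open>u\<close>, so the defining
  formula of \<open>\<Gamma>\<close> cannot be differentiated factor by factor; removing the
  compositions is what makes \<open>\<Gamma>\<close> smooth in the base point. The resulting
  expressions see a tangent vector U only through the pair (U1', U2): both entries lie in the same
  algebra H^(s-1), U1' has mean zero, and U1(0) = 0 makes the pair determine U. Identities of
  tangent vectors thus become pointwise identities together with conditions on means. As H^s is
  given by the decay of Fourier coefficients, pointwise facts (sup bounds, differentiability,
  products) have to come from the equality of a function with its Fourier series, hence the Fourier
  theory at the start. The integral in \<open>\<Gamma>\<close> is the only nonlocal term. In the
  curvature the integrals multiplying f combine into the mean of a linear combination of u' and v',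
  which vanishes; the multiples of u and v that survive are 1/4 of means of g, and this 1/4 is the
  normalisation of the metric.\<close>

definition circle_char :: "int \<Rightarrow> real \<Rightarrow> complex" where
  "circle_char n x = cis (2 * pi * (real_of_int n * x))"

lemma circle_char_simps [simp]:
  "circle_char 0 x = 1" "circle_char n 0 = 1" "cmod (circle_char n x) = 1"
  "circle_char n 1 = 1" "circle_char n (x + 1) = circle_char n x"
proof -
  have *: "cis (2 * pi * real_of_int n) = 1" for n
    by (metis cis_multiple_2pi Ints_of_int)
  show "circle_char n 1 = 1"
    using * by (simp add: circle_char_def)
  show "circle_char n (x + 1) = circle_char n x"
    using * by (simp add: circle_char_def distrib_left flip: cis_mult)
qed (auto simp: circle_char_def)

lemma circle_char_mult: "circle_char m x * circle_char n x = circle_char (m + n) x"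
  by (simp add: circle_char_def cis_mult algebra_simps)

lemma cnj_circle_char: "cnj (circle_char n x) = circle_char (- n) x"
  by (simp add: circle_char_def cis_cnj)

lemma continuous_on_circle_char [continuous_intros]:
  "continuous_on S f \<Longrightarrow> continuous_on S (\<lambda>x. circle_char n (f x))"
  unfolding circle_char_def by (intro continuous_intros)

lemma circle_char_vector_derivative [derivative_intros]:
  "(circle_char n has_vector_derivative 2 * pi * \<i> * of_int n * circle_char n x) (at x within S)"
proof -
  have "circle_char n = (\<lambda>x. exp (x *\<^sub>R (2 * pi * \<i> * of_int n)))"
    by (auto simp: circle_char_def cis_conv_exp scaleR_conv_of_real algebra_simps)
  then show ?thesis
    using exp_scaleR_has_vector_derivative_right[of "2 * pi * \<i> * of_int n" x S]
    by (simp add: mult.commute)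
qed

text \<open>Complex values are allowed because the series and quotients below leave the real
  functions. The gauge integral is used since the fundamental theorem and the exchange of integral
  and uniform limit are applied to it.\<close>

definition cfourier :: "(real \<Rightarrow> complex) \<Rightarrow> int \<Rightarrow> complex" where
  "cfourier f n = integral {0..1} (\<lambda>x. circle_char (- n) x * f x)"

lemma integrable_01 [simp]:
  fixes f :: "real \<Rightarrow> 'a::euclidean_space"
  shows "continuous_on UNIV f \<Longrightarrow> f integrable_on {0..1}"
  by (rule integrable_continuous_interval) (auto intro: continuous_on_subset)

lemma interval_integral_01:
  fixes f :: "real \<Rightarrow> 'a::euclidean_space"
  assumes "continuous_on UNIV f"
  shows "(LBINT x=0..1. f x) = integral {0..1} f"
  using interval_integral_eq_integral[of 0 1 f] assms
  by (metis borel_integrable_atLeastAtMost' continuous_on_subset one_ereal_def subset_UNIV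
        zero_ereal_def zero_le_one)

lemma fourier_coeff_conv_cfourier:
  assumes "continuous_on UNIV f"
  shows "fourier_coeff f n = cfourier (\<lambda>x. of_real (f x)) n"
proof -
  have "fourier_coeff f n = integral {0..1} (\<lambda>x. cis (- 2 * pi * real_of_int n * x) * of_real (f x))"
    unfolding fourier_coeff_def
    by (rule interval_integral_01) (intro continuous_intros assms)
  then show ?thesis
    by (simp add: cfourier_def circle_char_def algebra_simps)
qed

lemma cfourier_add:
  assumes "continuous_on UNIV f" "continuous_on UNIV g"
  shows "cfourier (\<lambda>x. f x + g x) n = cfourier f n + cfourier g n"
  unfolding cfourier_def distrib_left
  by (intro integral_add integrable_01 continuous_intros assms)

lemma cfourier_diff:
  assumes "continuous_on UNIV f" "continuous_on UNIV g"
  shows "cfourier (\<lambda>x. f x - g x) n = cfourier f n - cfourier g n"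
  unfolding cfourier_def right_diff_distrib
  by (intro integral_diff integrable_01 continuous_intros assms)

lemma cfourier_cmult: "cfourier (\<lambda>x. c * f x) n = c * cfourier f n"
  unfolding cfourier_def by (simp add: mult.left_commute[of _ c])

lemma cfourier_char_mult: "cfourier (\<lambda>x. circle_char m x * f x) n = cfourier f (n - m)"
  unfolding cfourier_def by (simp add: mult.assoc[symmetric] circle_char_mult)

lemma cfourier_cmult_char_mult:
  "cfourier (\<lambda>x. c * circle_char m x * f x) n = c * cfourier f (n - m)"
  using cfourier_cmult[of c "\<lambda>x. circle_char m x * f x"] cfourier_char_mult[of m f]
  by (simp add: mult.assoc)

lemma cfourier_sum:
  assumes "finite M" "\<And>m. m \<in> M \<Longrightarrow> continuous_on UNIV (f m)"
  shows "cfourier (\<lambda>x. \<Sum>m\<in>M. f m x) n = (\<Sum>m\<in>M. cfourier (f m) n)"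
  unfolding cfourier_def sum_distrib_left using assms
  by (intro integral_sum integrable_01 continuous_intros) auto

lemma norm_cfourier_le:
  assumes "continuous_on UNIV f" "\<And>x. norm (f x) \<le> B"
  shows "norm (cfourier f n) \<le> B"
proof -
  have "continuous_on {0..1} (\<lambda>x. circle_char (- n) x * f x)"
    by (intro continuous_intros continuous_on_subset[OF assms(1)]) auto
  from integral_bound[OF _ this, of B] show ?thesis
    using assms(2) by (simp add: cfourier_def norm_mult)
qed

text \<open>Integration by parts over one period: the boundary terms cancel because
  \<open>f 1 = f 0\<close> and characters agree at both ends.\<close>

lemma cfourier_deriv:
  assumes "continuous_on UNIV f'" "\<And>x. (f has_vector_derivative f' x) (at x)" "f 1 = f 0"
  shows "cfourier f' n = 2 * pi * \<i> * of_int n * cfourier f n"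
proof -
  have contf: "continuous_on UNIV f"
    using assms(2) by (meson continuous_at_imp_continuous_on has_vector_derivative_continuous)
  have "((\<lambda>x. circle_char (-n) x * f' x - 2 * pi * \<i> * of_int n * (circle_char (- n) x * f x))
      has_integral circle_char (- n) 1 * f 1 - circle_char (- n) 0 * f 0) {0..1}"
    apply (rule fundamental_theorem_of_calculus)
     apply simp
    apply (rule has_vector_derivative_eq_rhs[OF has_vector_derivative_mult
        [OF circle_char_vector_derivative has_vector_derivative_at_within[OF assms(2)]]])
    apply simp
    done
  then have "integral {0..1} (\<lambda>x. circle_char (-n) x * f' x - 2 * pi * \<i> * of_int n * (circle_char (- n) x * f x)) = 0"
    using assms(3) by (simp add: integral_unique)
  moreover have "integral {0..1} (\<lambda>x. circle_char (-n) x * f' x - 2 * pi * \<i> * of_int n * (circle_char (- n) x * f x))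
     = cfourier f' n - 2 * pi * \<i> * of_int n * cfourier f n"
    unfolding cfourier_def
    by (subst integral_diff) (auto intro!: integrable_01 continuous_intros assms(1) contf)
  ultimately show ?thesis by simp
qed

text \<open>Orthogonality without computing an integral: the constant 1 has derivative 0, so the
  rule for derivatives forces its coefficients at nonzero indices to vanish; multiplication by a
  character then shifts the index.\<close>

lemma cfourier_char: "cfourier (circle_char m) n = (if m = n then 1 else 0)"
proof -
  have 0: "cfourier (\<lambda>x. 1) k = (if k = 0 then 1 else 0)" for k
    using cfourier_deriv[of "\<lambda>x. 0" "\<lambda>x. 1" k] by (auto simp: cfourier_def)
  show ?thesis
    using cfourier_char_mult[of m "\<lambda>x. 1" n] by (simp add: 0)
qed

lemma cfourier_const: "cfourier (\<lambda>x. c) n = (if n = 0 then c else 0)"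
  using cfourier_cmult[of c "circle_char 0" n] by (simp add: cfourier_char)

text \<open>One frequency is peeled off at a time: subtracting the component at \<open>k\<close>
  lowers the integral of the squared modulus by exactly the square of \<open>cmod c\<close> and
  leaves the coefficients at other indices alone.\<close>

lemma bessel:
  assumes "continuous_on UNIV f" "finite F"
  shows "(\<Sum>n\<in>F. (cmod (cfourier f n))\<^sup>2) \<le> integral {0..1} (\<lambda>x. (cmod (f x))\<^sup>2)"
  using assms(2,1)
proof (induction F arbitrary: f rule: finite_induct)
  case empty
  then show ?case by (auto intro!: integral_nonneg integrable_01 continuous_intros)
next
  case (insert k F)
  define c where "c = cfourier f k"
  define g where "g = (\<lambda>x. f x - c * circle_char k x)"
  have contg: "continuous_on UNIV g"
    unfolding g_def by (intro continuous_intros insert.prems)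
  have g: "cfourier g n = cfourier f n - (if n = k then c else 0)" for n
    unfolding g_def
    by (subst cfourier_diff) (auto intro!: continuous_intros insert.prems simp: cfourier_cmult cfourier_char)
  have "(cmod (g x))\<^sup>2 = (cmod (f x))\<^sup>2 + (cmod c)\<^sup>2 - 2 * Re (cnj c * (circle_char (- k) x * f x))" for x
  proof -
    have *: "(cmod (z - w))\<^sup>2 = (cmod z)\<^sup>2 + (cmod w)\<^sup>2 - 2 * Re (cnj w * z)" for z w
      unfolding cmod_power2 by (simp add: power2_eq_square algebra_simps)
    show ?thesis
      unfolding g_def by (subst *) (simp add: norm_mult cnj_circle_char mult.assoc)
  qed
  moreover have "Re (cnj c * cfourier f k) = (cmod c)\<^sup>2"
    unfolding c_def[symmetric] by (metis Re_complex_of_real complex_norm_square mult.commute)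
  moreover have "((\<lambda>x. (cmod (f x))\<^sup>2 + (cmod c)\<^sup>2 - 2 * Re (cnj c * (circle_char (- k) x * f x)))
     has_integral integral {0..1} (\<lambda>x. (cmod (f x))\<^sup>2) + (cmod c)\<^sup>2 - 2 * Re (cnj c * cfourier f k)) {0..1}"
  proof -
    have 1: "((\<lambda>x. cnj c * (circle_char (- k) x * f x)) has_integral cnj c * cfourier f k) {0..1}"
      unfolding cfourier_def
      by (intro has_integral_mult_right integrable_integral integrable_01 continuous_intros insert.prems)
    have 2: "((\<lambda>x::real. (cmod c)\<^sup>2) has_integral (cmod c)\<^sup>2) {0..1}"
      using has_integral_const_real[of "(cmod c)\<^sup>2" 0 1] by simp
    show ?thesis
      by (intro has_integral_add has_integral_diff has_integral_mult_right has_integral_Re[OF 1] 2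
          integrable_integral integrable_01 continuous_intros insert.prems)
  qed
  ultimately have "integral {0..1} (\<lambda>x. (cmod (g x))\<^sup>2) = integral {0..1} (\<lambda>x. (cmod (f x))\<^sup>2) - (cmod c)\<^sup>2"
    by (simp add: integral_unique)
  moreover have "(\<Sum>n\<in>F. (cmod (cfourier g n))\<^sup>2) = (\<Sum>n\<in>F. (cmod (cfourier f n))\<^sup>2)"
    using insert.hyps by (intro sum.cong) (auto simp: g)
  ultimately show ?case
    using insert.IH[OF contg] insert.hyps by (simp add: c_def)
qed

lemma periodic_int_shift:
  fixes f :: "real \<Rightarrow> 'a"
  assumes "\<And>x. f (x + 1) = f x"
  shows "f (x + of_int k) = f x"
proof -
  have nat: "f (x + of_nat n) = f x" for n x
  proof (induction n)
    case (Suc n)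
    then show ?case using assms[of "x + of_nat n"] by (simp add: algebra_simps)
  qed simp
  show ?thesis
  proof (cases "k \<ge> 0")
    case True
    then show ?thesis using nat[of x "nat k"] by simp
  next
    case False
    then show ?thesis using nat[of "x + of_int k" "nat (- k)"] by simp
  qed
qed

lemma periodic_value_01:
  fixes f :: "real \<Rightarrow> 'a"
  assumes "\<And>x. f (x + 1) = f x"
  obtains y where "y \<in> {0..1}" "f x = f y"
proof
  show "frac x \<in> {0..1}" by (simp add: frac_lt_1 less_imp_le)
  show "f x = f (frac x)"
    using periodic_int_shift[of f "frac x" "\<lfloor>x\<rfloor>", OF assms] by (simp add: frac_def)
qed

lemma periodic_bounded:
  fixes f :: "real \<Rightarrow> 'a::real_normed_vector"
  assumes "continuous_on UNIV f" "\<And>x. f (x + 1) = f x"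
  obtains B where "\<And>x. norm (f x) \<le> B"
proof -
  have "compact (f ` {0..1})"
    by (intro compact_continuous_image continuous_on_subset[OF assms(1)]) auto
  then have "bounded (f ` {0..1})" by (rule compact_imp_bounded)
  then obtain B where B: "\<forall>y\<in>f ` {0..1}. norm y \<le> B"
    unfolding bounded_iff by (elim exE)
  have "norm (f x) \<le> B" for x
  proof -
    obtain y where "y \<in> {0..1}" "f x = f y"
      by (rule periodic_value_01[of f, OF assms(2)])
    then show ?thesis using B by simp
  qed
  then show ?thesis by (rule that)
qed

lemma interval_integral_has_vector_derivative:
  fixes f :: "real \<Rightarrow> 'a::euclidean_space"
  assumes "continuous_on UNIV f"
  shows "((\<lambda>u. LBINT y=0..ereal u. f y) has_vector_derivative f x) (at x)"
proof -
  \<comment> \<open>An interval containing 0 with \<open>x\<close> in its interior, so that the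
    derivative within the interval is the full derivative.\<close>
  define a b where "a = min 0 x - 1" and "b = max 0 x + 1"
  have A: "a \<le> 0" "0 \<le> b" "a \<le> x" "x \<le> b" "a < x" "x < b" unfolding a_def b_def by linarith+
  have 1: "((\<lambda>u. LBINT y=ereal 0..ereal u. f y) has_vector_derivative f x) (at x within {a..b})"
    by (rule interval_integral_FTC2 continuous_on_subset[OF assms] subset_UNIV A)+
  have 2: "at x within {a..b} = at x"
    by (rule at_within_interior) (unfold interior_atLeastAtMost_real greaterThanLessThan_iff, use A in simp)
  show ?thesis using 1 unfolding 2 zero_ereal_def .
qed

lemma has_vector_derivative_zero_const:
  fixes f :: "real \<Rightarrow> 'a::real_normed_vector"
  assumes "\<And>x. (f has_vector_derivative 0) (at x)"
  shows "f x = f y"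
proof -
  have "(f has_derivative (\<lambda>h. 0)) (at x within UNIV)" for x
    using assms[of x] by (simp add: has_vector_derivative_def)
  then have "\<exists>c. \<forall>x\<in>UNIV. f x = c"
    by (intro has_derivative_zero_constant) auto
  then show ?thesis by auto
qed

lemma has_vector_derivative_imp_tendsto:
  fixes f :: "real \<Rightarrow> 'a::real_normed_vector"
  assumes "(f has_vector_derivative f') (at x)"
  shows "((\<lambda>y. (f y - f x) /\<^sub>R (y - x)) \<longlongrightarrow> f') (at x)"
proof -
  have "((\<lambda>y. norm ((f y - f x) - (y - x) *\<^sub>R f') / norm (y - x)) \<longlongrightarrow> 0) (at x)"
    using assms by (simp add: has_vector_derivative_def has_derivative_iff_norm)
  moreover have "\<forall>\<^sub>F y in at x. norm ((f y - f x) - (y - x) *\<^sub>R f') / norm (y - x)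
      = norm ((f y - f x) /\<^sub>R (y - x) - f')"
    using eventually_neq_at_within[of x x UNIV]
  proof eventually_elim
    case (elim y)
    then have "(f y - f x) /\<^sub>R (y - x) - f' = ((f y - f x) - (y - x) *\<^sub>R f') /\<^sub>R (y - x)"
      by (simp add: scaleR_diff_right)
    then show ?case by (simp add: divide_inverse)
  qed
  ultimately have "((\<lambda>y. norm ((f y - f x) /\<^sub>R (y - x) - f')) \<longlongrightarrow> 0) (at x)"
    by (rule Lim_transform_eventually)
  then show ?thesis
    by (simp add: tendsto_norm_zero_iff LIM_zero_iff)
qed

lemma periodic_antiderivative:
  fixes F f :: "real \<Rightarrow> 'a::real_normed_vector"
  assumes d: "\<And>x. (F has_vector_derivative f x) (at x)" and f: "\<And>x. f (x + 1) = f x"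
    and "F 1 = F 0"
  shows "F (x + 1) = F x"
proof -
  have "((\<lambda>x. F (x + 1)) has_vector_derivative f (x + 1)) (at x)" for x
  proof -
    have "((\<lambda>x::real. x + 1) has_vector_derivative 1) (at x)"
      unfolding has_real_derivative_iff_has_vector_derivative[symmetric]
      by (auto intro!: derivative_eq_intros)
    from vector_diff_chain_at[OF this d] show ?thesis by (simp add: o_def)
  qed
  then have "((\<lambda>x. F (x + 1) - F x) has_vector_derivative f (x + 1) - f x) (at x)" for x
    by (intro has_vector_derivative_diff d)
  then have "F (x + 1) - F x = F (0 + 1) - F 0"
    using has_vector_derivative_zero_const[of "\<lambda>x. F (x + 1) - F x" x 0] by (simp add: f)
  then show ?thesis using assms(3) by simp
qed

lemma periodic_primitive:
  fixes f :: "real \<Rightarrow> 'a::euclidean_space"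
  assumes F_def: "F = (\<lambda>u. LBINT y=0..ereal u. f y)"
    and f: "continuous_on UNIV f" "\<And>x. f (x + 1) = f x" and 0: "integral {0..1} f = 0"
  shows "\<And>x. (F has_vector_derivative f x) (at x)" "F 0 = 0" "F (x + 1) = F x"
proof -
  show d: "(F has_vector_derivative f x) (at x)" for x
    unfolding F_def by (rule interval_integral_has_vector_derivative[OF f(1)])
  show "F 0 = 0" by (simp add: F_def flip: zero_ereal_def)
  moreover have "F 1 = 0"
    using interval_integral_01[OF f(1)] 0 by (simp add: F_def flip: one_ereal_def)
  ultimately show "F (x + 1) = F x"
    by (intro periodic_antiderivative[of F f, OF d f(2)]) simp
qed

section \<open>Uniqueness of Fourier coefficients\<close>

lemma circle_char_1_eq_1_iff: "circle_char 1 x = 1 \<longleftrightarrow> x \<in> \<int>"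
proof
  assume "circle_char 1 x = 1"
  then have "cos (2 * pi * x) = 1"
    by (simp add: circle_char_def complex_eq_iff)
  then obtain k :: int where "2 * pi * x = of_int k * 2 * pi"
    using cos_one_2pi_int by blast
  then have "x = of_int k" by simp
  then show "x \<in> \<int>" by simp
next
  assume "x \<in> \<int>"
  then show "circle_char 1 x = 1"
    using periodic_int_shift[of "circle_char 1" 0] by (auto elim: Ints_cases)
qed

text \<open>The quotient of \<open>f - f x0\<close> by \<open>circle_char 1 (x - x0) - 1\<close> is continuous, so the Fourier
  coefficients of \<open>f - f x0\<close> telescope.\<close>

lemma cfourier_telescope:
  fixes f :: "real \<Rightarrow> complex"
  assumes contf: "continuous_on UNIV f" and per: "\<And>x. f (x + 1) = f x"
    and d: "(f has_vector_derivative f') (at x0)"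
  obtains h where "continuous_on UNIV h"
    "\<And>n. cfourier (\<lambda>x. f x - f x0) n = circle_char (- 1) x0 * cfourier h (n - 1) - cfourier h n"
proof -
  define E where "E = (\<lambda>x. circle_char 1 (x - x0) - 1)"
  have E0: "E x = 0 \<longleftrightarrow> x - x0 \<in> \<int>" for x
    using circle_char_1_eq_1_iff by (simp add: E_def)
  have Eper: "E (x + 1) = E x" for x
    using circle_char_simps(5)[of 1 "x - x0"] by (simp add: E_def add_diff_eq diff_add_eq)
  \<comment> \<open>The value at the zeros of \<open>E\<close>, which are the integer translates of
    \<open>x0\<close>, is the limit of the quotient there, because \<open>E\<close> has derivative
    \<open>2 * pi * \<i>\<close> at \<open>x0\<close>.\<close>
  define h where "h = (\<lambda>x. if E x = 0 then f' / (2 * pi * \<i>) else (f x - f x0) / E x)"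
  have hper: "h (x + 1) = h x" for x
    by (simp add: h_def Eper per)
  have fz: "f x = f x0" if "E x = 0" for x
  proof -
    from that obtain k where "x - x0 = of_int k" by (auto simp: E0 elim: Ints_cases)
    then have "x = x0 + of_int k" by simp
    then show ?thesis using periodic_int_shift[of f, OF per] by blast
  qed
  have contE: "continuous_on UNIV E"
    unfolding E_def by (intro continuous_intros)
  have h0: "isCont h x0"
  proof -
    have "E x0 = 0" by (simp add: E0)
    have 1: "((\<lambda>x. (f x - f x0) /\<^sub>R (x - x0)) \<longlongrightarrow> f') (at x0)"
      using d by (rule has_vector_derivative_imp_tendsto)
    have "((\<lambda>x. x - x0) has_vector_derivative 1) (at x0)"
      unfolding has_real_derivative_iff_has_vector_derivative[symmetric]
      by (auto intro!: derivative_eq_intros)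
    from vector_diff_chain_at[OF this circle_char_vector_derivative[where n = 1]]
    have "((\<lambda>x. circle_char 1 (x - x0)) has_vector_derivative 2 * pi * \<i>) (at x0)"
      by (simp add: o_def)
    then have "(E has_vector_derivative 2 * pi * \<i>) (at x0)"
      unfolding E_def by (auto intro!: derivative_eq_intros)
    then have 2: "((\<lambda>x. (E x - E x0) /\<^sub>R (x - x0)) \<longlongrightarrow> 2 * pi * \<i>) (at x0)"
      by (rule has_vector_derivative_imp_tendsto)
    have "((\<lambda>x. ((f x - f x0) /\<^sub>R (x - x0)) / ((E x - E x0) /\<^sub>R (x - x0))) \<longlongrightarrow> f' / (2 * pi * \<i>)) (at x0)"
      by (intro tendsto_divide 1 2) auto
    moreover have "\<forall>\<^sub>F x in at x0. ((f x - f x0) /\<^sub>R (x - x0)) / ((E x - E x0) /\<^sub>R (x - x0)) = h x"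
    proof -
      have "\<forall>\<^sub>F x in at x0. x \<in> {x0 - 1<..<x0 + 1} \<and> x \<noteq> x0"
        by (intro eventually_conj eventually_at_in_open' eventually_neq_at_within) auto
      then show ?thesis
      proof eventually_elim
        case (elim x)
        then have "x - x0 \<notin> \<int>"
        proof (intro notI)
          assume "x - x0 \<in> \<int>"
          then obtain z where z: "x - x0 = of_int z" by (auto elim: Ints_cases)
          then have "of_int z < (1::real)" "real_of_int (- 1) < real_of_int z" using elim by auto
          then have "z = 0" unfolding of_int_less_iff by simp
          then show False using z elim by simp
        qed
        moreover have "(a /\<^sub>R (x - x0)) / (b /\<^sub>R (x - x0)) = a / b" for a b :: complex
          using elim by (simp add: scaleR_conv_of_real)
        ultimately show ?case using \<open>E x0 = 0\<close> by (simp add: h_def E0)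
      qed
    qed
    ultimately have "(h \<longlongrightarrow> f' / (2 * pi * \<i>)) (at x0)"
      by (rule Lim_transform_eventually)
    then show ?thesis using \<open>E x0 = 0\<close> by (simp add: isCont_def h_def)
  qed
  have "isCont h x" for x
  proof (cases "E x = 0")
    case True
    then obtain k where "x - x0 = of_int k" by (auto simp: E0 elim: Ints_cases)
    then have x: "x = x0 + of_int k" by simp
    have "h = (\<lambda>y. h (y + of_int (- k)))"
      using periodic_int_shift[of h, OF hper] by (auto simp: fun_eq_iff simp del: of_int_minus)
    moreover have "isCont (\<lambda>y. h (y + of_int (- k))) x"
      by (rule isCont_o2[where g = h]) (use h0 x in auto)
    ultimately show ?thesis by simp
  next
    case False
    have "\<forall>\<^sub>F y in nhds x. y \<in> {y. E y \<noteq> 0}"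
      using False contE by (intro eventually_nhds_in_open open_Collect_neq) auto
    then have "\<forall>\<^sub>F y in nhds x. h y = (f y - f x0) / E y"
      by eventually_elim (simp add: h_def)
    moreover have "isCont (\<lambda>y. (f y - f x0) / E y) x"
      using False contE contf by (auto intro!: continuous_intros simp: continuous_on_eq_continuous_at)
    ultimately show ?thesis
      using isCont_cong by fastforce
  qed
  then have conth: "continuous_on UNIV h" by (simp add: continuous_at_imp_continuous_on)
  \<comment> \<open>Multiplication by \<open>circle_char 1\<close> shifts the index by one. Writing
    \<open>E\<close> as a multiple of this character minus 1 therefore turns the coefficients of
    \<open>E x * h x\<close> into differences of neighbouring coefficients of
    \<open>h\<close>.\<close>
  have eq: "f x - f x0 = circle_char (- 1) x0 * circle_char 1 x * h x - h x" for x
  proof -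
    have "E x = circle_char (- 1) x0 * circle_char 1 x - 1"
      by (simp add: E_def circle_char_def cis_mult algebra_simps)
    moreover have "f x - f x0 = E x * h x"
      using fz by (auto simp: h_def)
    ultimately have "f x - f x0 = (circle_char (- 1) x0 * circle_char 1 x - 1) * h x" by simp
    then show ?thesis by (simp add: left_diff_distrib)
  qed
  show ?thesis
  proof (rule that[OF conth])
    show "cfourier (\<lambda>x. f x - f x0) n = circle_char (- 1) x0 * cfourier h (n - 1) - cfourier h n" for n
      unfolding eq
      by (subst cfourier_diff) (auto intro!: continuous_intros conth simp: cfourier_cmult_char_mult)
  qed
qed

text \<open>By Bessel's inequality at most \<open>I / r\<^sup>2\<close> coefficients can have the
  same nonzero modulus \<open>r\<close>.\<close>

lemma constant_norm_cfourier_0: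
  assumes "continuous_on UNIV h" "infinite A" "\<And>n. n \<in> A \<Longrightarrow> cmod (cfourier h n) = r"
  shows "r = 0"
proof (rule ccontr)
  assume "r \<noteq> 0"
  define I where "I = integral {0..1} (\<lambda>x. (cmod (h x))\<^sup>2)"
  obtain m :: nat where m: "I / r\<^sup>2 < m" using reals_Archimedean2 by blast
  obtain F where F: "finite F" "card F = m" "F \<subseteq> A"
    using infinite_arbitrarily_large[OF assms(2)] by blast
  have "(\<Sum>n\<in>F. (cmod (cfourier h n))\<^sup>2) = m * r\<^sup>2"
    using F assms(3) by (subst sum.cong[OF refl, of _ _ "\<lambda>_. r\<^sup>2"]) auto
  then show False
    using bessel[OF assms(1) F(1)] m \<open>r \<noteq> 0\<close> by (simp add: I_def field_simps)
qed

text \<open>By the telescoping identity and Bessel's inequality, a periodic primitive of \<open>f\<close> takes its mean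
  value at every point.\<close>

lemma cfourier_unique_0:
  fixes f :: "real \<Rightarrow> complex"
  assumes contf: "continuous_on UNIV f" and per: "\<And>x. f (x + 1) = f x"
    and 0: "\<And>n. cfourier f n = 0"
  shows "f x = 0"
proof -
  \<comment> \<open>The telescoping identity needs a derivative at \<open>x0\<close>, which a
    continuous \<open>f\<close> need not have; its primitive has one everywhere and is periodic
    because \<open>f\<close> has mean zero.\<close>
  define D where "D = (\<lambda>u. LBINT y=0..ereal u. f y)"
  have "integral {0..1} f = 0"
    using 0[of 0] by (simp add: cfourier_def)
  note prim = periodic_primitive[OF D_def contf per this]
  note D = prim(1) and perD = prim(3)
  have contD: "continuous_on UNIV D"
    using D by (meson continuous_at_imp_continuous_on has_vector_derivative_continuous)
  have D10: "D 1 = D 0" using perD[of 0] by simp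
  have cD: "cfourier D n = 0" if "n \<noteq> 0" for n
    using cfourier_deriv[OF contf D D10, of n] 0[of n] that by simp
  have "D x0 = cfourier D 0" for x0
  proof -
    obtain h where h: "continuous_on UNIV h"
      "\<And>n. cfourier (\<lambda>x. D x - D x0) n = circle_char (- 1) x0 * cfourier h (n - 1) - cfourier h n"
      using cfourier_telescope[OF contD perD D[of x0]] by blast
    have *: "cfourier (\<lambda>x. D x - D x0) n = cfourier D n - (if n = 0 then D x0 else 0)" for n
      using contD by (subst cfourier_diff) (auto simp: cfourier_const)
    \<comment> \<open>For \<open>n \<noteq> 0\<close> the coefficient of \<open>D - D x0\<close>
      vanishes. The relation may fail only between the indices -1 and 0, so the modulus is constant
      on each of \<open>n \<ge> 0\<close> and \<open>n \<le> -1\<close>, and both constants must be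
      0.\<close>
    have rec: "cmod (cfourier h n) = cmod (cfourier h (n - 1))" if "n \<noteq> 0" for n
    proof -
      have "cfourier h n = circle_char (- 1) x0 * cfourier h (n - 1)"
        using that h(2)[of n] by (simp add: * cD)
      then show ?thesis by (simp add: norm_mult)
    qed
    have pos: "cmod (cfourier h n) = cmod (cfourier h 0)" if "n \<ge> 0" for n
      using that
    proof (induction n rule: int_ge_induct)
      case (step i)
      then show ?case using rec[of "i + 1"] by simp
    qed simp
    have "cmod (cfourier h 0) = 0"
      by (rule constant_norm_cfourier_0[OF h(1) infinite_Ici[of 0]], rule pos) simp
    have neg: "cmod (cfourier h n) = cmod (cfourier h (-1))" if "n \<le> -1" for n
      using that
    proof (induction n rule: int_le_induct)
      case (step i)
      then show ?case using rec[of i] by simp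
    qed simp
    have "cmod (cfourier h (-1)) = 0"
      by (rule constant_norm_cfourier_0[OF h(1) infinite_Iic[of "-1"]], rule neg) simp
    with \<open>cmod (cfourier h 0) = 0\<close> have "cfourier D 0 - D x0 = 0"
      using h(2)[of 0] by (simp add: *)
    then show ?thesis by simp
  qed
  then have "D = (\<lambda>x. cfourier D 0)" by auto
  then have "(D has_vector_derivative 0) (at x)"
    by (metis has_vector_derivative_const)
  then show ?thesis using D vector_derivative_unique_at by blast
qed

section \<open>Absolutely convergent Fourier series\<close>

definition char_series :: "(int \<Rightarrow> complex) \<Rightarrow> real \<Rightarrow> complex" where
  "char_series c x = (\<Sum>\<^sub>\<infinity>n. c n * circle_char n x)"

lemma uniform_limit_char_series:
  assumes "(\<lambda>n. cmod (c n)) summable_on UNIV"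
  shows "uniform_limit UNIV (\<lambda>F x. \<Sum>n\<in>F. c n * circle_char n x) (char_series c) (finite_subsets_at_top UNIV)"
  unfolding char_series_def
  by (rule Weierstrass_m_test_general[OF _ assms]) (simp add: norm_mult)

lemma continuous_on_char_series:
  assumes "(\<lambda>n. cmod (c n)) summable_on UNIV"
  shows "continuous_on UNIV (char_series c)"
  by (rule uniform_limit_theorem[OF _ uniform_limit_char_series[OF assms]])
     (auto intro!: always_eventually continuous_intros)

lemma char_series_periodic: "char_series c (x + 1) = char_series c x"
  by (simp add: char_series_def)

text \<open>Uniform convergence of the series lets sum and integral be exchanged. With
  \<open>g = 1\<close> this recovers the coefficients of the series; with a second function as
  \<open>g\<close> it exhibits the coefficients of a product as a convolution.\<close>

lemma tendsto_cfourier_char_series_mult: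
  assumes c: "(\<lambda>n. cmod (c n)) summable_on UNIV" and g: "continuous_on UNIV g"
  shows "((\<lambda>F. \<Sum>m\<in>F. c m * cfourier g (n - m)) \<longlongrightarrow> cfourier (\<lambda>x. char_series c x * g x) n)
           (finite_subsets_at_top UNIV)"
proof -
  have cont: "continuous_on {0..1} (\<lambda>x. circle_char (- n) x * g x)"
    "continuous_on {0..1} (char_series c)"
    by (intro continuous_intros continuous_on_subset[OF g] continuous_on_subset[OF continuous_on_char_series[OF c]]; simp)+
  have "uniform_limit {0..1} (\<lambda>F x. (\<Sum>m\<in>F. c m * circle_char m x) * (circle_char (- n) x * g x))
      (\<lambda>x. char_series c x * (circle_char (- n) x * g x)) (finite_subsets_at_top UNIV)"
    by (intro uniform_lim_mult uniform_limit_const uniform_limit_on_subset[OF uniform_limit_char_series[OF c]]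
        compact_imp_bounded compact_continuous_image cont) auto
  moreover have "continuous_on {0..1} (\<lambda>x. (\<Sum>m\<in>F. c m * circle_char m x) * (circle_char (- n) x * g x))" for F
    by (intro continuous_intros continuous_on_subset[OF g]) auto
  ultimately obtain I J where I: "\<And>F. ((\<lambda>x. (\<Sum>m\<in>F. c m * circle_char m x) * (circle_char (- n) x * g x)) has_integral I F) {0..1}"
    and J: "((\<lambda>x. char_series c x * (circle_char (- n) x * g x)) has_integral J) {0..1}"
    and lim: "(I \<longlongrightarrow> J) (finite_subsets_at_top UNIV)"
    by (rule uniform_limit_integral) auto
  have "J = cfourier (\<lambda>x. char_series c x * g x) n"
    using integral_unique[OF J] by (simp add: cfourier_def mult_ac)
  moreover have "\<forall>\<^sub>F F in finite_subsets_at_top UNIV. I F = (\<Sum>m\<in>F. c m * cfourier g (n - m))"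
  proof (rule eventually_finite_subsets_at_top_weakI)
    fix F :: "int set" assume "finite F"
    then have "cfourier (\<lambda>x. \<Sum>m\<in>F. c m * circle_char m x * g x) n = (\<Sum>m\<in>F. c m * cfourier g (n - m))"
      by (subst cfourier_sum) (auto intro!: continuous_intros g simp: cfourier_cmult_char_mult)
    then show "I F = (\<Sum>m\<in>F. c m * cfourier g (n - m))"
      using integral_unique[OF I, of F] by (simp add: cfourier_def sum_distrib_left sum_distrib_right mult_ac)
  qed
  ultimately show ?thesis using lim tendsto_cong by blast
qed

lemma cfourier_char_series:
  assumes "(\<lambda>n. cmod (c n)) summable_on UNIV"
  shows "cfourier (char_series c) n = c n"
proof -
  have lim: "((\<lambda>F. \<Sum>m\<in>F. c m * cfourier (\<lambda>x. 1) (n - m)) \<longlongrightarrow> cfourier (\<lambda>x. char_series c x * 1) n)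
           (finite_subsets_at_top UNIV)"
    by (rule tendsto_cfourier_char_series_mult[OF assms]) auto
  have ev: "\<forall>\<^sub>F F in finite_subsets_at_top UNIV. (\<Sum>m\<in>F. c m * cfourier (\<lambda>x. 1) (n - m)) = c n"
    unfolding eventually_finite_subsets_at_top
  proof (intro exI[of _ "{n}"] conjI allI impI)
    fix Y :: "int set" assume "finite Y \<and> {n} \<subseteq> Y \<and> Y \<subseteq> UNIV"
    moreover have "(\<Sum>m\<in>Y. c m * cfourier (\<lambda>x. 1) (n - m)) = (\<Sum>m\<in>Y. if m = n then c m else 0)"
      by (intro sum.cong) (auto simp: cfourier_const)
    ultimately show "(\<Sum>m\<in>Y. c m * cfourier (\<lambda>x. 1) (n - m)) = c n" by simp
  qed auto
  have "((\<lambda>F::int set. c n) \<longlongrightarrow> cfourier (\<lambda>x. char_series c x * 1) n) (finite_subsets_at_top UNIV)"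
    using lim unfolding tendsto_cong[OF ev] .
  then have "cfourier (\<lambda>x. char_series c x * 1) n = c n"
    by (intro tendsto_unique[OF _ _ tendsto_const]) auto
  then show ?thesis by simp
qed

text \<open>The difference of the two sides is continuous and periodic with all coefficients zero,
  so uniqueness gives equality at every point.\<close>

lemma char_series_cfourier:
  assumes "continuous_on UNIV f" "\<And>x. f (x + 1) = f x" "(\<lambda>n. cmod (cfourier f n)) summable_on UNIV"
  shows "char_series (cfourier f) = f"
proof
  fix x
  let ?S = "char_series (cfourier f)"
  have S: "continuous_on UNIV ?S"
    by (rule continuous_on_char_series[OF assms(3)])
  have "f x - ?S x = 0"
  proof (rule cfourier_unique_0[of "\<lambda>x. f x - ?S x"])
    show "continuous_on UNIV (\<lambda>x. f x - ?S x)"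
      by (intro continuous_intros assms(1) S)
    show "f (x + 1) - ?S (x + 1) = f x - ?S x" for x
      by (simp add: assms(2) char_series_periodic)
    show "cfourier (\<lambda>x. f x - ?S x) n = 0" for n
      unfolding cfourier_diff[OF assms(1) S] cfourier_char_series[OF assms(3)] by simp
  qed
  then show "?S x = f x" by simp
qed

section \<open>Sobolev spaces as Banach algebras\<close>

lemma one_plus_square_pos [simp]: "1 + (x::real)\<^sup>2 > 0" "1 + x\<^sup>2 \<noteq> 0" "1 + x\<^sup>2 \<ge> 0"
  using zero_le_power2[of x] by linarith+

text \<open>The Japanese bracket to the power \<open>s\<close>. Halving the exponent makes its
  square the weight in \<open>sobolev_weight\<close>, so that a Sobolev norm is the l2 norm of the
  weighted moduli of the coefficients.\<close>

definition japanese :: "real \<Rightarrow> int \<Rightarrow> real" where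
  "japanese s n = (1 + (real_of_int n)\<^sup>2) powr (s / 2)"

lemma japanese_pos [simp]: "japanese s n > 0"
  by (simp add: japanese_def)

lemma japanese_nonneg [simp]: "japanese s n \<ge> 0"
  using japanese_pos less_imp_le by blast

lemma japanese_add: "japanese (s + t) n = japanese s n * japanese t n"
  by (simp add: japanese_def powr_add add_divide_distrib)

lemma japanese_0 [simp]: "japanese 0 n = 1" "japanese s 0 = 1"
  by (simp_all add: japanese_def)

lemma japanese_mono: "s \<le> t \<Longrightarrow> japanese s n \<le> japanese t n"
  unfolding japanese_def by (intro powr_mono) auto

lemma japanese_square: "(japanese s n)\<^sup>2 = (1 + (real_of_int n)\<^sup>2) powr s"
  by (simp add: japanese_def power2_eq_square flip: powr_add)

text \<open>Splitting \<open>n = m + (n - m)\<close> gives \<open>1 + n\<^sup>2 \<le> 4 * M\<close>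
  with \<open>M\<close> the larger of the two weights; the 4 to the power \<open>s / 2\<close> is
  the constant, and a power of the maximum is at most the sum of both powers.\<close>

lemma japanese_subadd:
  assumes "s \<ge> 0"
  shows "japanese s n \<le> 2 powr s * (japanese s m + japanese s (n - m))"
proof -
  define M where "M = max (1 + (real_of_int m)\<^sup>2) (1 + (real_of_int (n - m))\<^sup>2)"
  have "M > 0" by (simp add: M_def less_max_iff_disj)
  have "(real_of_int n)\<^sup>2 \<le> 2 * (real_of_int m)\<^sup>2 + 2 * (real_of_int (n - m))\<^sup>2"
    using sum_squares_ge_zero[of "real_of_int m - real_of_int (n - m)" 0]
    by (simp add: power2_eq_square algebra_simps)
  moreover have "1 + (real_of_int m)\<^sup>2 \<le> M" "1 + (real_of_int (n - m))\<^sup>2 \<le> M"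
    by (simp_all add: M_def)
  ultimately have "1 + (real_of_int n)\<^sup>2 \<le> 4 * M" by linarith
  then have "japanese s n \<le> (4 * M) powr (s / 2)"
    unfolding japanese_def using assms by (intro powr_mono2) auto
  also have "\<dots> = 4 powr (s / 2) * M powr (s / 2)"
    using \<open>M > 0\<close> by (simp add: powr_mult)
  also have "(4::real) powr (s / 2) = 2 powr s"
    using powr_powr[of 2 2 "s / 2"] by simp
  also have "M powr (s / 2) \<le> japanese s m + japanese s (n - m)"
    by (auto simp: M_def max_def japanese_def)
  finally show ?thesis by simp
qed

lemma sum_int_le_suminf:
  fixes g :: "nat \<Rightarrow> real"
  assumes "summable g" "\<And>n. g n \<ge> 0" "finite F"
  shows "(\<Sum>n\<in>F. g (nat \<bar>n\<bar>)) \<le> 2 * suminf g"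
proof -
  have *: "(\<Sum>n\<in>S. g (nat \<bar>n\<bar>)) \<le> suminf g" if "finite S" "inj_on (\<lambda>n. nat \<bar>n\<bar>) S" for S :: "int set"
    using sum_le_suminf[OF assms(1), of "(\<lambda>n. nat \<bar>n\<bar>) ` S"] assms(2) that
    by (simp add: sum.reindex)
  have "(\<Sum>n\<in>F. g (nat \<bar>n\<bar>)) = (\<Sum>n\<in>F \<inter> {0..}. g (nat \<bar>n\<bar>)) + (\<Sum>n\<in>F - {0..}. g (nat \<bar>n\<bar>))"
    by (rule sum.Int_Diff[OF assms(3)])
  moreover have "(\<Sum>n\<in>F \<inter> {0..}. g (nat \<bar>n\<bar>)) \<le> suminf g"
    using assms(3) by (intro *) (auto simp: inj_on_def)
  moreover have "(\<Sum>n\<in>F - {0..}. g (nat \<bar>n\<bar>)) \<le> suminf g"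
    using assms(3) by (intro *) (auto simp: inj_on_def)
  ultimately show ?thesis by linarith
qed

text \<open>Here the threshold 1/2 of the Sobolev embedding enters: the squares decay like the power
  \<open>- 2 * s\<close> of the index, which is summable for \<open>s > 1/2\<close>. The bound can
  be stated for all \<open>F\<close> because \<open>L2_set\<close> is 0 on infinite sets.\<close>

lemma L2_set_japanese_bounded:
  assumes "s > 1/2"
  shows "\<exists>K>0. \<forall>F. L2_set (japanese (- s)) F \<le> K"
proof -
  define g where "g = (\<lambda>n::nat. (1 + (real n)\<^sup>2) powr (- s))"
  have "summable g"
  proof (rule summable_comparison_test_ev)
    show "summable (\<lambda>n. of_nat n powr (- 2 * s) :: real)"
      using assms by (subst summable_real_powr_iff) simp
    have "norm (g n) \<le> of_nat n powr (- 2 * s)" if "n \<ge> 1" for n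
    proof -
      have "(1 + (real n)\<^sup>2) powr (- s) \<le> ((real n)\<^sup>2) powr (- s)"
        using that assms by (intro powr_mono2') auto
      also have "\<dots> = real n powr (- 2 * s)"
        using that powr_powr[of "real n" 2 "- s"] by simp
      finally show ?thesis by (simp add: g_def)
    qed
    then show "\<forall>\<^sub>F n in sequentially. norm (g n) \<le> of_nat n powr (- 2 * s)"
      unfolding eventually_sequentially by blast
  qed
  have g0: "g n \<ge> 0" for n by (simp add: g_def)
  show ?thesis
  proof (intro exI conjI allI)
    \<comment> \<open>The summand 1 makes the constant strictly positive.\<close>
    show "sqrt (2 * suminf g) + 1 > 0"
      using suminf_nonneg[OF \<open>summable g\<close> g0] by (simp add: add_nonneg_pos)
    show "L2_set (japanese (- s)) F \<le> sqrt (2 * suminf g) + 1" for F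
    proof (cases "finite F")
      case True
      have "(\<Sum>n\<in>F. (japanese (- s) n)\<^sup>2) = (\<Sum>n\<in>F. g (nat \<bar>n\<bar>))"
        by (intro sum.cong) (auto simp: japanese_square g_def)
      also have "\<dots> \<le> 2 * suminf g" by (rule sum_int_le_suminf[OF \<open>summable g\<close> g0 True])
      finally show ?thesis
        unfolding L2_set_def by (smt (verit) real_sqrt_le_mono)
    next
      case False
      then show ?thesis
        using suminf_nonneg[OF \<open>summable g\<close> g0] by (simp add: add_nonneg_nonneg)
    qed
  qed
qed

lemma sobolev_weight_conv_japanese:
  "sobolev_weight s f n = (japanese s n * cmod (fourier_coeff f n))\<^sup>2"
  by (simp add: sobolev_weight_def japanese_square power_mult_distrib)

section \<open>Sobolev norms through finite truncations\<close>

abbreviation partial_norm :: "real \<Rightarrow> (real \<Rightarrow> real) \<Rightarrow> int set \<Rightarrow> real" where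
  "partial_norm s f \<equiv> L2_set (\<lambda>n. japanese s n * cmod (fourier_coeff f n))"

text \<open>The weights are nonnegative, so a bound on finite truncations that is uniform in
  \<open>F\<close> gives summability and the norm estimate together. Estimates below are therefore
  made on truncations only.\<close>

lemma sobolevI:
  assumes "continuous_on UNIV f" "\<And>x. f (x + 1) = f x"
    and le: "\<And>F. finite F \<Longrightarrow> partial_norm s f F \<le> B"
  shows "f \<in> sobolev s" "sobolev_norm s f \<le> B"
proof -
  have "B \<ge> 0" using le[of "{}"] by simp
  have *: "(\<Sum>n\<in>F. sobolev_weight s f n) \<le> B\<^sup>2" if "finite F" for F
  proof -
    have "(\<Sum>n\<in>F. sobolev_weight s f n) = (partial_norm s f F)\<^sup>2"
      by (simp add: L2_set_def sum_nonneg sobolev_weight_conv_japanese)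
    also have "\<dots> \<le> B\<^sup>2"
      using le[OF that] by (intro power_mono) auto
    finally show ?thesis .
  qed
  have s: "sobolev_weight s f summable_on UNIV"
    by (rule nonneg_bdd_above_summable_on)
       (auto simp: sobolev_weight_conv_japanese[abs_def] intro!: bdd_aboveI2[where M = "B\<^sup>2"] *[unfolded sobolev_weight_conv_japanese])
  then show "f \<in> sobolev s"
    using assms by (simp add: sobolev_def)
  have "(\<Sum>\<^sub>\<infinity>n. sobolev_weight s f n) \<le> B\<^sup>2"
    by (rule infsum_le_finite_sums[OF s]) (use * in auto)
  then show "sobolev_norm s f \<le> B"
    unfolding sobolev_norm_def using \<open>B \<ge> 0\<close> by (rule real_le_lsqrt[rotated])
qed

lemma sobolev_continuous: "f \<in> sobolev s \<Longrightarrow> continuous_on UNIV f"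
  and sobolev_periodic: "f \<in> sobolev s \<Longrightarrow> f (x + 1) = f x"
  by (auto simp: sobolev_def)

lemma L2_set_le_sobolev_norm:
  assumes "f \<in> sobolev s"
  shows "partial_norm s f F \<le> sobolev_norm s f"
proof (cases "finite F")
  case True
  then have "(\<Sum>n\<in>F. sobolev_weight s f n) \<le> (\<Sum>\<^sub>\<infinity>n. sobolev_weight s f n)"
    using assms by (intro finite_sum_le_infsum) (auto simp: sobolev_def, simp add: sobolev_weight_conv_japanese)
  then show ?thesis
    by (simp add: L2_set_def sobolev_norm_def sobolev_weight_conv_japanese)
next
  case False
  then show ?thesis
    by (simp add: sobolev_norm_def infsum_nonneg sobolev_weight_conv_japanese)
qed

lemma sobolev_norm_nonneg [simp]: "sobolev_norm s f \<ge> 0"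
  by (simp add: sobolev_norm_def infsum_nonneg sobolev_weight_conv_japanese)

lemma fourier_coeff_add:
  assumes "continuous_on UNIV f" "continuous_on UNIV g"
  shows "fourier_coeff (\<lambda>x. f x + g x) n = fourier_coeff f n + fourier_coeff g n"
  using assms by (simp add: fourier_coeff_conv_cfourier continuous_intros cfourier_add)

lemma fourier_coeff_cmult:
  assumes "continuous_on UNIV f"
  shows "fourier_coeff (\<lambda>x. c * f x) n = c * fourier_coeff f n"
  using assms by (simp add: fourier_coeff_conv_cfourier continuous_intros cfourier_cmult)

lemma fourier_coeff_const: "fourier_coeff (\<lambda>x. c) n = (if n = 0 then of_real c else 0)"
  by (simp add: fourier_coeff_conv_cfourier cfourier_const)

lemma sobolev_add:
  assumes "f \<in> sobolev s" "g \<in> sobolev s"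
  shows "(\<lambda>x. f x + g x) \<in> sobolev s"
    "sobolev_norm s (\<lambda>x. f x + g x) \<le> sobolev_norm s f + sobolev_norm s g"
proof -
  note cont = sobolev_continuous[OF assms(1)] sobolev_continuous[OF assms(2)]
  have *: "partial_norm s (\<lambda>x. f x + g x) F
      \<le> sobolev_norm s f + sobolev_norm s g" for F
  proof -
    have "partial_norm s (\<lambda>x. f x + g x) F
       \<le> L2_set (\<lambda>n. japanese s n * cmod (fourier_coeff f n) + japanese s n * cmod (fourier_coeff g n)) F"
      by (intro L2_set_mono) (auto simp: fourier_coeff_add cont norm_triangle_ineq simp flip: distrib_left)
    also have "\<dots> \<le> partial_norm s f F
        + partial_norm s g F"
      by (rule L2_set_triangle_ineq)
    also have "\<dots> \<le> sobolev_norm s f + sobolev_norm s g"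
      by (intro add_mono L2_set_le_sobolev_norm assms)
    finally show ?thesis .
  qed
  show "(\<lambda>x. f x + g x) \<in> sobolev s"
    "sobolev_norm s (\<lambda>x. f x + g x) \<le> sobolev_norm s f + sobolev_norm s g"
    by (rule sobolevI[OF _ _ *]; simp add: continuous_on_add cont sobolev_periodic[OF assms(1)] sobolev_periodic[OF assms(2)])+
qed

lemma sobolev_cmult:
  assumes "f \<in> sobolev s"
  shows "(\<lambda>x. c * f x) \<in> sobolev s"
    "sobolev_norm s (\<lambda>x. c * f x) \<le> \<bar>c\<bar> * sobolev_norm s f"
proof -
  note cont = sobolev_continuous[OF assms(1)]
  have *: "partial_norm s (\<lambda>x. c * f x) F
      \<le> \<bar>c\<bar> * sobolev_norm s f" for F
  proof -
    have "partial_norm s (\<lambda>x. c * f x) F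
       = L2_set (\<lambda>n. \<bar>c\<bar> * (japanese s n * cmod (fourier_coeff f n))) F"
      by (intro L2_set_cong) (auto simp: fourier_coeff_cmult cont norm_mult)
    also have "\<dots> = \<bar>c\<bar> * partial_norm s f F"
      by (rule L2_set_right_distrib[symmetric]) simp
    also have "\<dots> \<le> \<bar>c\<bar> * sobolev_norm s f"
      by (intro mult_left_mono L2_set_le_sobolev_norm assms) simp
    finally show ?thesis .
  qed
  show "(\<lambda>x. c * f x) \<in> sobolev s"
    "sobolev_norm s (\<lambda>x. c * f x) \<le> \<bar>c\<bar> * sobolev_norm s f"
    by (rule sobolevI[OF _ _ *]; simp add: continuous_on_mult_left cont sobolev_periodic[OF assms(1)])+
qed

lemma sobolev_diff:
  assumes "f \<in> sobolev s" "g \<in> sobolev s"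
  shows "(\<lambda>x. f x - g x) \<in> sobolev s"
    "sobolev_norm s (\<lambda>x. f x - g x) \<le> sobolev_norm s f + sobolev_norm s g"
  using sobolev_add[OF assms(1) sobolev_cmult(1)[OF assms(2), of "-1"]] sobolev_cmult(2)[OF assms(2), of "-1"]
  by simp_all

lemma sobolev_const:
  shows "(\<lambda>x. c) \<in> sobolev s" "sobolev_norm s (\<lambda>x. c) \<le> \<bar>c\<bar>"
proof -
  have *: "partial_norm s (\<lambda>x. c) F \<le> \<bar>c\<bar>" for F
  proof -
    have "partial_norm s (\<lambda>x. c) F
       \<le> (\<Sum>n\<in>F. japanese s n * cmod (fourier_coeff (\<lambda>x. c) n))"
      by (rule L2_set_le_sum) auto
    also have "\<dots> = (\<Sum>n\<in>F. if n = 0 then \<bar>c\<bar> else 0)"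
      by (intro sum.cong) (auto simp: fourier_coeff_const)
    also have "\<dots> \<le> \<bar>c\<bar>"
      by (cases "finite F") auto
    finally show ?thesis .
  qed
  show "(\<lambda>x. c) \<in> sobolev s" "sobolev_norm s (\<lambda>x. c) \<le> \<bar>c\<bar>"
    by (rule sobolevI[OF _ _ *]; simp)+
qed

lemma sobolev_mono:
  assumes "f \<in> sobolev t" "s \<le> t"
  shows "f \<in> sobolev s" "sobolev_norm s f \<le> sobolev_norm t f"
proof -
  have *: "partial_norm s f F \<le> sobolev_norm t f" for F
  proof -
    have "partial_norm s f F
       \<le> partial_norm t f F"
      using assms(2) by (intro L2_set_mono mult_right_mono japanese_mono) auto
    also have "\<dots> \<le> sobolev_norm t f"
      by (rule L2_set_le_sobolev_norm[OF assms(1)])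
    finally show ?thesis .
  qed
  show "f \<in> sobolev s" "sobolev_norm s f \<le> sobolev_norm t f"
    by (rule sobolevI[OF _ _ *]; simp add: sobolev_continuous[OF assms(1)] sobolev_periodic[OF assms(1)])+
qed

text \<open>Cauchy-Schwarz after inserting \<open>japanese (- s) n * japanese s n = 1\<close>. This
  is the passage from H^s to absolutely summable coefficients.\<close>

lemma sum_le_L2_set_japanese:
  assumes "s > 1/2"
  shows "\<exists>K>0. \<forall>F c. (\<Sum>n\<in>F. \<bar>c n\<bar>) \<le> K * L2_set (\<lambda>n. japanese s n * \<bar>c n\<bar>) F"
proof -
  obtain K where K: "K > 0" "\<forall>F. L2_set (japanese (- s)) F \<le> K"
    using L2_set_japanese_bounded[OF assms] by blast
  show ?thesis
  proof (intro exI[of _ K] conjI allI K(1))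
    fix F and c :: "int \<Rightarrow> real"
    have "(\<Sum>n\<in>F. \<bar>c n\<bar>) = (\<Sum>n\<in>F. \<bar>japanese (- s) n\<bar> * \<bar>japanese s n * \<bar>c n\<bar>\<bar>)"
    proof (intro sum.cong refl)
      fix n
      have "japanese (- s) n * japanese s n = 1"
        by (simp flip: japanese_add)
      then show "\<bar>c n\<bar> = \<bar>japanese (- s) n\<bar> * \<bar>japanese s n * \<bar>c n\<bar>\<bar>"
        by (simp add: abs_mult)
    qed
    also have "\<dots> \<le> L2_set (japanese (- s)) F * L2_set (\<lambda>n. japanese s n * \<bar>c n\<bar>) F"
      by (rule L2_set_mult_ineq)
    also have "\<dots> \<le> K * L2_set (\<lambda>n. japanese s n * \<bar>c n\<bar>) F"
      using K by (intro mult_right_mono) auto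
    finally show "(\<Sum>n\<in>F. \<bar>c n\<bar>) \<le> K * L2_set (\<lambda>n. japanese s n * \<bar>c n\<bar>) F" .
  qed
qed

lemma fourier_coeff_l1_bound:
  assumes "s > 1/2"
  shows "\<exists>K>0. \<forall>f\<in>sobolev s. \<forall>F. finite F \<longrightarrow> (\<Sum>n\<in>F. cmod (fourier_coeff f n)) \<le> K * sobolev_norm s f"
proof -
  obtain K where K: "K > 0"
    "\<forall>F c. (\<Sum>n\<in>F. \<bar>c n\<bar>) \<le> K * L2_set (\<lambda>n. japanese s n * \<bar>c n\<bar>) F"
    using sum_le_L2_set_japanese[OF assms] by blast
  show ?thesis
  proof (intro exI[of _ K] conjI ballI allI impI K(1))
    fix f F assume f: "f \<in> sobolev s"
    have "(\<Sum>n\<in>F. cmod (fourier_coeff f n)) \<le> K * partial_norm s f F"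
      using K(2)[rule_format, where F = F and c = "\<lambda>n. cmod (fourier_coeff f n)"] by simp
    also have "\<dots> \<le> K * sobolev_norm s f"
      using K(1) by (intro mult_left_mono L2_set_le_sobolev_norm f) auto
    finally show "(\<Sum>n\<in>F. cmod (fourier_coeff f n)) \<le> K * sobolev_norm s f" .
  qed
qed

lemma fourier_coeff_summable:
  assumes "s > 1/2" "f \<in> sobolev s"
  shows "(\<lambda>n. cmod (fourier_coeff f n)) summable_on UNIV"
proof -
  obtain K where K: "K > 0"
    "\<forall>f\<in>sobolev s. \<forall>F. finite F \<longrightarrow> (\<Sum>n\<in>F. cmod (fourier_coeff f n)) \<le> K * sobolev_norm s f"
    using fourier_coeff_l1_bound[OF assms(1)] by blast
  show ?thesis
    by (rule nonneg_bdd_above_summable_on) (use K(2) assms(2) in \<open>auto intro!: bdd_aboveI2\<close>)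
qed

lemma char_series_fourier_coeff:
  assumes "s > 1/2" "f \<in> sobolev s"
  shows "char_series (fourier_coeff f) x = of_real (f x)"
proof -
  have eq: "fourier_coeff f = cfourier (\<lambda>x. of_real (f x))"
    using fourier_coeff_conv_cfourier[OF sobolev_continuous[OF assms(2)]] by auto
  have "char_series (cfourier (\<lambda>x. of_real (f x))) = (\<lambda>x. of_real (f x))"
  proof (rule char_series_cfourier)
    show "continuous_on UNIV (\<lambda>x. complex_of_real (f x))"
      by (intro continuous_intros sobolev_continuous[OF assms(2)])
    show "complex_of_real (f (x + 1)) = complex_of_real (f x)" for x
      using sobolev_periodic[OF assms(2)] by simp
    show "(\<lambda>n. cmod (cfourier (\<lambda>x. of_real (f x)) n)) summable_on UNIV"
      using fourier_coeff_summable[OF assms] by (simp add: eq)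
  qed
  then show ?thesis by (simp add: eq)
qed

lemma sobolev_sup_bound:
  assumes "s > 1/2"
  shows "\<exists>K>0. \<forall>f\<in>sobolev s. \<forall>x. \<bar>f x\<bar> \<le> K * sobolev_norm s f"
proof -
  obtain K where K: "K > 0"
    "\<forall>f\<in>sobolev s. \<forall>F. finite F \<longrightarrow> (\<Sum>n\<in>F. cmod (fourier_coeff f n)) \<le> K * sobolev_norm s f"
    using fourier_coeff_l1_bound[OF assms(1)] by blast
  show ?thesis
  proof (intro exI[of _ K] conjI ballI allI K(1))
    fix f x assume f: "f \<in> sobolev s"
    have "\<bar>f x\<bar> = cmod (char_series (fourier_coeff f) x)"
      by (simp add: char_series_fourier_coeff[OF assms f])
    also have "\<dots> \<le> (\<Sum>\<^sub>\<infinity>n. cmod (fourier_coeff f n * circle_char n x))"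
      unfolding char_series_def
      by (rule norm_infsum_bound) (simp add: norm_mult fourier_coeff_summable[OF assms f])
    also have "\<dots> = (\<Sum>\<^sub>\<infinity>n. cmod (fourier_coeff f n))"
      by (simp add: norm_mult)
    also have "\<dots> \<le> K * sobolev_norm s f"
      by (rule infsum_le_finite_sums[OF fourier_coeff_summable[OF assms f]]) (use K(2) f in auto)
    finally show "\<bar>f x\<bar> \<le> K * sobolev_norm s f" .
  qed
qed

lemma L2_set_sum_le: "L2_set (\<lambda>n. \<Sum>m\<in>M. h m n) F \<le> (\<Sum>m\<in>M. L2_set (h m) F)"
proof (induction M rule: infinite_finite_induct)
  case (insert m M)
  then show ?case
    using L2_set_triangle_ineq[of "h m" "\<lambda>n. \<Sum>m\<in>M. h m n" F] by simp
qed (simp_all add: L2_set_def)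

text \<open>Young's inequality for l1 and l2: the convolution is a sum of translates of
  \<open>X\<close> weighted by \<open>Y\<close>, all translates obey the same l2 bound, and the
  triangle inequality adds them up.\<close>

lemma L2_set_convolution_le:
  fixes X Y :: "int \<Rightarrow> real"
  assumes "\<And>n. X n \<ge> 0" "\<And>n. Y n \<ge> 0" "B \<ge> 0"
    and X: "\<And>F. L2_set X F \<le> B" and Y: "\<And>F. finite F \<Longrightarrow> sum Y F \<le> A"
    and "finite M"
  shows "L2_set (\<lambda>n. \<Sum>m\<in>M. Y m * X (n - m)) F \<le> A * B"
proof -
  have shift: "L2_set (\<lambda>n. X (n - m)) F \<le> B" for m
  proof -
    have "L2_set (\<lambda>n. X (n - m)) F = L2_set X ((\<lambda>n. n - m) ` F)"
      by (simp add: L2_set_def sum.reindex inj_on_def)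
    then show ?thesis using X by simp
  qed
  have "L2_set (\<lambda>n. \<Sum>m\<in>M. Y m * X (n - m)) F \<le> (\<Sum>m\<in>M. L2_set (\<lambda>n. Y m * X (n - m)) F)"
    by (rule L2_set_sum_le)
  also have "\<dots> = (\<Sum>m\<in>M. Y m * L2_set (\<lambda>n. X (n - m)) F)"
    using assms(2) by (simp add: L2_set_right_distrib)
  also have "\<dots> \<le> (\<Sum>m\<in>M. Y m * B)"
    using assms(2) by (intro sum_mono mult_left_mono shift)
  also have "\<dots> \<le> A * B"
    using Y[OF assms(6)] assms(3) by (simp add: mult_right_mono flip: sum_distrib_right)
  finally show ?thesis .
qed

text \<open>Here \<open>X\<close> carries the summation index. Substituting \<open>k = n - m\<close>
  makes the range of summation depend on \<open>n\<close>; enlarging it to the set \<open>K\<close>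
  of all differences removes the dependence, and costs nothing since all terms are
  nonnegative.\<close>

lemma L2_set_convolution_le':
  fixes X Y :: "int \<Rightarrow> real"
  assumes "\<And>n. X n \<ge> 0" "\<And>n. Y n \<ge> 0" "B \<ge> 0"
    and X: "\<And>F. L2_set X F \<le> B" and Y: "\<And>F. finite F \<Longrightarrow> sum Y F \<le> A"
    and "finite M" "finite F"
  shows "L2_set (\<lambda>n. \<Sum>m\<in>M. X m * Y (n - m)) F \<le> A * B"
proof -
  define K where "K = (\<lambda>(n, m). n - m) ` (F \<times> M)"
  have "finite K" using assms by (simp add: K_def)
  have "(\<Sum>m\<in>M. X m * Y (n - m)) \<le> (\<Sum>k\<in>K. Y k * X (n - k))" if "n \<in> F" for n
  proof -
    have "(\<Sum>m\<in>M. X m * Y (n - m)) = (\<Sum>k\<in>(\<lambda>m. n - m) ` M. Y k * X (n - k))"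
      by (simp add: sum.reindex inj_on_def mult.commute)
    also have "\<dots> \<le> (\<Sum>k\<in>K. Y k * X (n - k))"
      using that assms(1,2) by (intro sum_mono2 \<open>finite K\<close>) (auto simp: K_def)
    finally show ?thesis .
  qed
  then have "L2_set (\<lambda>n. \<Sum>m\<in>M. X m * Y (n - m)) F \<le> L2_set (\<lambda>n. \<Sum>k\<in>K. Y k * X (n - k)) F"
    using assms(1,2) by (intro L2_set_mono) (auto intro!: sum_nonneg)
  also have "\<dots> \<le> A * B"
    by (rule L2_set_convolution_le[OF assms(1-5) \<open>finite K\<close>])
  finally show ?thesis .
qed

lemma tendsto_fourier_coeff_mult:
  assumes "s > 1/2" and f: "f \<in> sobolev s" and g: "g \<in> sobolev s"
  shows "((\<lambda>M. \<Sum>m\<in>M. fourier_coeff f m * fourier_coeff g (n - m)) \<longlongrightarrow>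
     fourier_coeff (\<lambda>x. f x * g x) n) (finite_subsets_at_top UNIV)"
proof -
  note cont = sobolev_continuous[OF f] sobolev_continuous[OF g]
  have "((\<lambda>M. \<Sum>m\<in>M. fourier_coeff f m * cfourier (\<lambda>x. of_real (g x)) (n - m)) \<longlongrightarrow>
      cfourier (\<lambda>x. char_series (fourier_coeff f) x * of_real (g x)) n) (finite_subsets_at_top UNIV)"
    by (rule tendsto_cfourier_char_series_mult[OF fourier_coeff_summable[OF assms(1) f]])
       (intro continuous_intros cont)
  moreover have "cfourier (\<lambda>x. char_series (fourier_coeff f) x * of_real (g x)) n
      = fourier_coeff (\<lambda>x. f x * g x) n"
    by (simp add: char_series_fourier_coeff[OF assms(1) f] fourier_coeff_conv_cfourier cont continuous_on_mult)
  ultimately show ?thesis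
    by (simp add: fourier_coeff_conv_cfourier[OF cont(2)])
qed

text \<open>The weight is put on one factor at a time: \<open>japanese_subadd\<close> dominates it
  by its values at \<open>m\<close> and \<open>n - m\<close>, and each part is a convolution of a
  weighted l2 sequence with an unweighted one, which is l1 because \<open>s > 1/2\<close>.\<close>

lemma sobolev_mult:
  assumes "s > 1/2"
  shows "\<exists>C>0. \<forall>f\<in>sobolev s. \<forall>g\<in>sobolev s. (\<lambda>x. f x * g x) \<in> sobolev s \<and>
    sobolev_norm s (\<lambda>x. f x * g x) \<le> C * sobolev_norm s f * sobolev_norm s g"
proof -
  obtain K where K: "K > 0"
    "\<forall>f\<in>sobolev s. \<forall>F. finite F \<longrightarrow> (\<Sum>n\<in>F. cmod (fourier_coeff f n)) \<le> K * sobolev_norm s f"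
    using fourier_coeff_l1_bound[OF assms] by blast
  \<comment> \<open>\<open>2 powr s\<close> comes from \<open>japanese_subadd\<close>, and
    \<open>K\<close> once from each of the two convolutions.\<close>
  define C where "C = 2 powr s * (2 * K)"
  have "C > 0" using K(1) by (simp add: C_def)
  have main: "partial_norm s (\<lambda>x. f x * g x) F
      \<le> C * sobolev_norm s f * sobolev_norm s g"
    if f: "f \<in> sobolev s" and g: "g \<in> sobolev s" and F: "finite F" for f g F
  proof -
    define a b where "a = (\<lambda>n. cmod (fourier_coeff f n))" and "b = (\<lambda>n. cmod (fourier_coeff g n))"
    \<comment> \<open>The convolution is truncated to a finite \<open>M\<close>. The bound obtained
      does not depend on \<open>M\<close>, so it passes to the limit, in which only the finitely
      many indices in \<open>F\<close> take part.\<close>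
    define P where "P = (\<lambda>M n. \<Sum>m\<in>M. fourier_coeff f m * fourier_coeff g (n - m))"
    have lim: "((\<lambda>M. L2_set (\<lambda>n. japanese s n * cmod (P M n)) F) \<longlongrightarrow>
        partial_norm s (\<lambda>x. f x * g x) F) (finite_subsets_at_top UNIV)"
      unfolding L2_set_def P_def
      by (intro tendsto_intros tendsto_fourier_coeff_mult[OF assms f g])
    have bound: "L2_set (\<lambda>n. japanese s n * cmod (P M n)) F \<le> C * sobolev_norm s f * sobolev_norm s g"
      if M: "finite M" for M
    proof -
      have pw: "japanese s n * cmod (P M n) \<le> 2 powr s *
          ((\<Sum>m\<in>M. (japanese s m * a m) * b (n - m)) + (\<Sum>m\<in>M. a m * (japanese s (n - m) * b (n - m))))" for n
      proof -
        have "japanese s n * cmod (P M n) \<le> japanese s n * (\<Sum>m\<in>M. a m * b (n - m))"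
          unfolding P_def a_def b_def
          by (intro mult_left_mono order_trans[OF norm_sum]) (auto simp: norm_mult)
        also have "\<dots> = (\<Sum>m\<in>M. japanese s n * (a m * b (n - m)))"
          by (simp add: sum_distrib_left)
        also have "\<dots> \<le> (\<Sum>m\<in>M. 2 powr s * (japanese s m + japanese s (n - m)) * (a m * b (n - m)))"
          using assms by (intro sum_mono mult_right_mono japanese_subadd) (auto simp: a_def b_def)
        also have "\<dots> = 2 powr s *
          ((\<Sum>m\<in>M. (japanese s m * a m) * b (n - m)) + (\<Sum>m\<in>M. a m * (japanese s (n - m) * b (n - m))))"
          unfolding sum.distrib[symmetric] sum_distrib_left
          by (intro sum.cong) (auto simp: algebra_simps)
        finally show ?thesis .
      qed
      have 1: "L2_set (\<lambda>n. \<Sum>m\<in>M. (japanese s m * a m) * b (n - m)) F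
          \<le> (K * sobolev_norm s g) * sobolev_norm s f"
        by (rule L2_set_convolution_le'[OF _ _ _ _ _ M F])
           (use K g L2_set_le_sobolev_norm[OF f] in \<open>auto simp: a_def b_def\<close>)
      have 2: "L2_set (\<lambda>n. \<Sum>m\<in>M. a m * (japanese s (n - m) * b (n - m))) F
          \<le> (K * sobolev_norm s f) * sobolev_norm s g"
        by (rule L2_set_convolution_le[OF _ _ _ _ _ M, where X = "\<lambda>n. japanese s n * b n"])
           (use K f L2_set_le_sobolev_norm[OF g] in \<open>auto simp: a_def b_def\<close>)
      have "L2_set (\<lambda>n. japanese s n * cmod (P M n)) F \<le> L2_set (\<lambda>n. 2 powr s *
          ((\<Sum>m\<in>M. (japanese s m * a m) * b (n - m)) + (\<Sum>m\<in>M. a m * (japanese s (n - m) * b (n - m))))) F"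
        by (intro L2_set_mono pw) auto
      also have "\<dots> = 2 powr s * L2_set (\<lambda>n.
          (\<Sum>m\<in>M. (japanese s m * a m) * b (n - m)) + (\<Sum>m\<in>M. a m * (japanese s (n - m) * b (n - m)))) F"
        by (rule L2_set_right_distrib[symmetric]) simp
      also have "\<dots> \<le> 2 powr s * (L2_set (\<lambda>n. \<Sum>m\<in>M. (japanese s m * a m) * b (n - m)) F
          + L2_set (\<lambda>n. \<Sum>m\<in>M. a m * (japanese s (n - m) * b (n - m))) F)"
        by (intro mult_left_mono L2_set_triangle_ineq) simp
      also have "\<dots> \<le> 2 powr s * ((K * sobolev_norm s g) * sobolev_norm s f
          + (K * sobolev_norm s f) * sobolev_norm s g)"
        by (intro mult_left_mono add_mono 1 2) simp
      also have "\<dots> = C * sobolev_norm s f * sobolev_norm s g"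
        by (simp add: C_def algebra_simps)
      finally show ?thesis .
    qed
    show ?thesis
      by (rule tendsto_upperbound[OF lim eventually_finite_subsets_at_top_weakI]) (use bound in auto)
  qed
  show ?thesis
  proof (intro exI[of _ C] conjI ballI \<open>C > 0\<close>)
    fix f g assume f: "f \<in> sobolev s" and g: "g \<in> sobolev s"
    note cont = sobolev_continuous[OF f] sobolev_continuous[OF g]
    show "(\<lambda>x. f x * g x) \<in> sobolev s"
      "sobolev_norm s (\<lambda>x. f x * g x) \<le> C * sobolev_norm s f * sobolev_norm s g"
      by (rule sobolevI[OF _ _ main[OF f g]];
          simp add: cont continuous_on_mult sobolev_periodic[OF f] sobolev_periodic[OF g])+
  qed
qed

section \<open>Derivatives, primitives and reciprocals in Sobolev spaces\<close>

lemma fourier_coeff_deriv: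
  assumes "continuous_on UNIV f'" "\<And>x. (f has_real_derivative f' x) (at x)" "f 1 = f 0"
  shows "fourier_coeff f' n = 2 * pi * \<i> * of_int n * fourier_coeff f n"
proof -
  have "continuous_on UNIV f"
    using assms(2) by (meson DERIV_isCont continuous_at_imp_continuous_on)
  moreover have "cfourier (\<lambda>x. of_real (f' x)) n = 2 * pi * \<i> * of_int n * cfourier (\<lambda>x. of_real (f x)) n"
  proof (rule cfourier_deriv)
    show "continuous_on UNIV (\<lambda>x. complex_of_real (f' x))"
      by (intro continuous_intros assms(1))
    show "((\<lambda>x. complex_of_real (f x)) has_vector_derivative complex_of_real (f' x)) (at x)" for x
      using assms(2)[of x] by (intro has_vector_derivative_of_real)
  qed (simp add: assms(3))
  ultimately show ?thesis
    by (simp add: fourier_coeff_conv_cfourier assms(1))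
qed

text \<open>Away from frequency 0 differentiation multiplies a coefficient by
  \<open>2 * pi * \<bar>n\<bar>\<close>, which dominates \<open>japanese 1 n\<close>. The
  coefficient at 0 is invisible in the derivative and is controlled by the sup bound
  \<open>B\<close>.\<close>

lemma sobolev_antiderivative:
  assumes d: "\<And>x. (f has_real_derivative f' x) (at x)" and f': "f' \<in> sobolev s"
    and per: "\<And>x. f (x + 1) = f x" and B: "\<And>x. \<bar>f x\<bar> \<le> B"
  shows "f \<in> sobolev (s + 1)" "sobolev_norm (s + 1) f \<le> B + sobolev_norm s f'"
proof -
  have cont: "continuous_on UNIV f"
    using d by (meson DERIV_isCont continuous_at_imp_continuous_on)
  have "f 1 = f 0" using per[of 0] by simp
  note coeff = fourier_coeff_deriv[OF sobolev_continuous[OF f'] d this]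
  have "cmod (fourier_coeff f 0) \<le> B"
    unfolding fourier_coeff_conv_cfourier[OF cont]
    by (rule norm_cfourier_le) (use B in \<open>auto intro!: continuous_intros cont\<close>)
  have pw: "japanese (s + 1) n * cmod (fourier_coeff f n)
      \<le> (if n = 0 then B else 0) + japanese s n * cmod (fourier_coeff f' n)" for n
  proof (cases "n = 0")
    case True
    then show ?thesis using \<open>cmod (fourier_coeff f 0) \<le> B\<close> by (simp add: coeff)
  next
    case False
    have "japanese 1 n \<le> 2 * pi * \<bar>real_of_int n\<bar>"
    proof -
      have "1 \<le> \<bar>n\<bar>" using False by simp
      then have "1 \<le> \<bar>real_of_int n\<bar>" by linarith
      then have "1 \<le> (real_of_int n)\<^sup>2" using power_mono[of 1 "\<bar>real_of_int n\<bar>" 2] by simp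
      then have "1 + (real_of_int n)\<^sup>2 \<le> (2 * \<bar>real_of_int n\<bar>)\<^sup>2" by (simp add: power_mult_distrib)
      then have "sqrt (1 + (real_of_int n)\<^sup>2) \<le> 2 * \<bar>real_of_int n\<bar>" by (intro real_le_lsqrt) auto
      also have "\<dots> \<le> 2 * pi * \<bar>real_of_int n\<bar>"
        using pi_gt3 by (intro mult_right_mono) auto
      finally show ?thesis by (simp add: japanese_def powr_half_sqrt)
    qed
    then have "japanese s n * (japanese 1 n * cmod (fourier_coeff f n))
        \<le> japanese s n * (2 * pi * \<bar>real_of_int n\<bar> * cmod (fourier_coeff f n))"
      by (intro mult_left_mono mult_right_mono) auto
    then show ?thesis using False by (simp add: japanese_add coeff norm_mult mult.assoc)
  qed
  have "B \<ge> 0" using B[of 0] by linarith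
  have *: "partial_norm (s + 1) f F \<le> B + sobolev_norm s f'" for F
  proof -
    have "partial_norm (s + 1) f F
        \<le> L2_set (\<lambda>n. (if n = 0 then B else 0) + japanese s n * cmod (fourier_coeff f' n)) F"
      by (intro L2_set_mono pw) auto
    also have "\<dots> \<le> L2_set (\<lambda>n. if n = 0 then B else 0) F
        + partial_norm s f' F"
      by (rule L2_set_triangle_ineq)
    also have "L2_set (\<lambda>n::int. if n = 0 then B else 0) F \<le> (\<Sum>n\<in>F. if n = 0 then B else 0)"
      using \<open>B \<ge> 0\<close> by (intro L2_set_le_sum) auto
    also have "\<dots> \<le> B"
      using \<open>B \<ge> 0\<close> by (cases "finite F") auto
    finally show ?thesis
      using L2_set_le_sobolev_norm[OF f', of F] by linarith
  qed
  show "f \<in> sobolev (s + 1)" "sobolev_norm (s + 1) f \<le> B + sobolev_norm s f'"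
    by (rule sobolevI[OF cont per *])+
qed

text \<open>The series obtained by formal differentiation converges absolutely; its primitive has
  the coefficients of \<open>f\<close> away from 0, so by uniqueness it differs from
  \<open>f\<close> by a constant, and \<open>f\<close> is differentiable in the classical
  sense.\<close>

lemma sobolev_has_derivative:
  assumes "s > 1/2" and f: "f \<in> sobolev (s + 1)"
  shows "(f has_real_derivative deriv f x) (at x)" "deriv f \<in> sobolev s"
    "sobolev_norm s (deriv f) \<le> 2 * pi * sobolev_norm (s + 1) f"
proof -
  note cont = sobolev_continuous[OF f]
  define cf where "cf = (\<lambda>x. complex_of_real (f x))"
  have contcf: "continuous_on UNIV cf"
    unfolding cf_def by (intro continuous_intros cont)
  have fc: "fourier_coeff f n = cfourier cf n" for n
    unfolding cf_def by (rule fourier_coeff_conv_cfourier[OF cont])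
  define c where "c = (\<lambda>n. 2 * pi * \<i> * of_int n * cfourier cf n)"
  have c_le: "japanese s n * cmod (c n) \<le> 2 * pi * (japanese (s + 1) n * cmod (fourier_coeff f n))" for n
  proof -
    have "\<bar>real_of_int n\<bar> \<le> japanese 1 n"
      unfolding japanese_def by (simp add: powr_half_sqrt real_le_rsqrt)
    then have "2 * pi * japanese s n * (\<bar>real_of_int n\<bar> * cmod (fourier_coeff f n))
        \<le> 2 * pi * japanese s n * (japanese 1 n * cmod (fourier_coeff f n))"
      by (intro mult_left_mono mult_right_mono) auto
    then show ?thesis
      by (simp add: c_def fc norm_mult japanese_add mult_ac)
  qed
  have L2c: "L2_set (\<lambda>n. japanese s n * cmod (c n)) F \<le> 2 * pi * sobolev_norm (s + 1) f" for F
  proof -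
    have "L2_set (\<lambda>n. japanese s n * cmod (c n)) F
        \<le> L2_set (\<lambda>n. 2 * pi * (japanese (s + 1) n * cmod (fourier_coeff f n))) F"
      by (intro L2_set_mono c_le) auto
    also have "\<dots> = 2 * pi * partial_norm (s + 1) f F"
      by (rule L2_set_right_distrib[symmetric]) simp
    also have "\<dots> \<le> 2 * pi * sobolev_norm (s + 1) f"
      by (intro mult_left_mono L2_set_le_sobolev_norm f) simp
    finally show ?thesis .
  qed
  have c: "(\<lambda>n. cmod (c n)) summable_on UNIV"
  proof -
    obtain K where K: "K > 0"
      "\<forall>F c. (\<Sum>n\<in>F. \<bar>c n\<bar>) \<le> K * L2_set (\<lambda>n. japanese s n * \<bar>c n\<bar>) F"
      using sum_le_L2_set_japanese[OF assms(1)] by blast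
    have "(\<Sum>n\<in>F. cmod (c n)) \<le> K * (2 * pi * sobolev_norm (s + 1) f)" for F
    proof -
      have "(\<Sum>n\<in>F. cmod (c n)) \<le> K * L2_set (\<lambda>n. japanese s n * cmod (c n)) F"
        using K(2)[rule_format, where F = F and c = "\<lambda>n. cmod (c n)"] by simp
      also have "\<dots> \<le> K * (2 * pi * sobolev_norm (s + 1) f)"
        using K(1) by (intro mult_left_mono L2c) auto
      finally show ?thesis .
    qed
    then show ?thesis
      by (intro nonneg_bdd_above_summable_on) (auto intro!: bdd_aboveI2)
  qed
  define g where "g = char_series c"
  have contg: "continuous_on UNIV g"
    unfolding g_def by (rule continuous_on_char_series[OF c])
  have cg: "cfourier g n = c n" for n
    unfolding g_def by (rule cfourier_char_series[OF c])
  have perg: "g (x + 1) = g x" for x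
    unfolding g_def by (rule char_series_periodic)
  define D where "D = (\<lambda>u. LBINT y=0..ereal u. g y)"
  have "integral {0..1} g = 0"
    using cg[of 0] by (simp add: cfourier_def c_def)
  note prim = periodic_primitive[OF D_def contg perg this]
  note D = prim(1) and perD = prim(3)
  have contD: "continuous_on UNIV D"
    using D by (meson continuous_at_imp_continuous_on has_vector_derivative_continuous)
  have D10: "D 1 = D 0" using perD[of 0] by simp
  \<comment> \<open>The coefficient at 0 is the one that differentiation does not determine;
    \<open>k\<close> is the resulting difference of means.\<close>
  define k where "k = cfourier D 0 - cfourier cf 0"
  have "D x - (cf x + k) = 0" for x
  proof (rule cfourier_unique_0[of "\<lambda>x. D x - (cf x + k)"])
    show "continuous_on UNIV (\<lambda>x. D x - (cf x + k))"
      by (intro continuous_intros contD contcf)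
    show "D (x + 1) - (cf (x + 1) + k) = D x - (cf x + k)" for x
      using perD sobolev_periodic[OF f] by (simp add: cf_def)
    show "cfourier (\<lambda>x. D x - (cf x + k)) n = 0" for n
    proof -
      have "cfourier (\<lambda>x. D x - (cf x + k)) n = cfourier D n - (cfourier cf n + (if n = 0 then k else 0))"
        by (subst cfourier_diff cfourier_add; (intro continuous_intros contD contcf)?)+
           (simp add: cfourier_const)
      moreover have "cfourier D n = cfourier cf n" if "n \<noteq> 0"
        using cfourier_deriv[OF contg D D10, of n] that by (simp add: cg c_def)
      ultimately show ?thesis by (simp add: k_def)
    qed
  qed
  then have "cf = (\<lambda>x. D x - k)" by (auto simp: algebra_simps fun_eq_iff)
  then have "(cf has_vector_derivative g x) (at x)" for x
    using has_vector_derivative_diff[OF D has_vector_derivative_const[of k]] by simp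
  then have d: "(f has_real_derivative Re (g x)) (at x)" for x
    using has_derivative_Re[of cf _ "at x"]
    unfolding has_real_derivative_iff_has_vector_derivative has_vector_derivative_def cf_def
    by fastforce
  then have deriv: "deriv f = (\<lambda>x. Re (g x))"
    using DERIV_imp_deriv by blast
  show "(f has_real_derivative deriv f x) (at x)" for x
    using d unfolding deriv by simp
  have contd: "continuous_on UNIV (deriv f)"
    unfolding deriv by (intro continuous_intros contg)
  have "f 1 = f 0" using sobolev_periodic[OF f, of 0] by simp
  from fourier_coeff_deriv[OF contd _ this]
  have "fourier_coeff (deriv f) n = c n" for n
    using d by (simp add: deriv c_def fc)
  then have *: "partial_norm s (deriv f) F \<le> 2 * pi * sobolev_norm (s + 1) f" for F
    using L2c by simp
  have "deriv f (x + 1) = deriv f x" for x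
    by (simp add: deriv perg)
  then show "deriv f \<in> sobolev s" "sobolev_norm s (deriv f) \<le> 2 * pi * sobolev_norm (s + 1) f"
    by (auto intro: sobolevI[OF contd _ *])
qed

text \<open>For exponent 0 the weight is 1 and the bound is Bessel's inequality; it is the entry
  point of the bootstrapping for reciprocals.\<close>

lemma continuous_periodic_sobolev_0:
  assumes "continuous_on UNIV f" "\<And>x. f (x + 1) = f x"
  shows "f \<in> sobolev 0"
proof (rule sobolevI(1)[OF assms])
  define I where "I = integral {0..1} (\<lambda>x. (cmod (of_real (f x)))\<^sup>2)"
  fix F :: "int set" assume F: "finite F"
  have "(\<Sum>n\<in>F. (cmod (cfourier (\<lambda>x. of_real (f x)) n))\<^sup>2) \<le> I"
    unfolding I_def by (rule bessel[OF _ F]) (intro continuous_intros assms)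
  then show "L2_set (\<lambda>n. japanese 0 n * cmod (fourier_coeff f n)) F \<le> sqrt I"
    unfolding L2_set_def by (simp add: fourier_coeff_conv_cfourier[OF assms(1)])
qed

lemma C1_periodic_sobolev_1:
  assumes "\<And>x. (f has_real_derivative f' x) (at x)" "continuous_on UNIV f'"
    and per: "\<And>x. f (x + 1) = f x"
  shows "f \<in> sobolev 1"
proof -
  have cont: "continuous_on UNIV f"
    using assms(1) by (meson DERIV_isCont continuous_at_imp_continuous_on)
  obtain B where B: "\<And>x. norm (f x) \<le> B"
    using periodic_bounded[OF cont per] by blast
  have "((\<lambda>x. f (x + 1)) has_real_derivative f' (x + 1)) (at x)" for x
    using assms(1)[of "x + 1"] by (simp add: DERIV_shift)
  then have "f' (x + 1) = f' x" for x
    unfolding per using assms(1) DERIV_unique by blast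
  then have "f \<in> sobolev (0 + 1)"
    by (intro sobolev_antiderivative(1)[OF assms(1) continuous_periodic_sobolev_0[OF assms(2)] per])
       (use B in auto)
  then show ?thesis by simp
qed

text \<open>Bootstrapping along \<open>(1/f)' = - f' / f\<^sup>2\<close>: each step gains one derivative, up to the regularity
  of \<open>f\<close>.\<close>

lemma sobolev_inverse:
  assumes s: "s > 3/2" and f: "f \<in> sobolev s" and nz: "\<And>x. f x \<noteq> 0"
  shows "(\<lambda>x. 1 / f x) \<in> sobolev s"
proof -
  have "f \<in> sobolev ((s - 1) + 1)" "s - 1 > 1/2" using s f by auto
  note f' = sobolev_has_derivative(1,2)[OF this(2,1)]
  have d: "((\<lambda>x. 1 / f x) has_real_derivative - (deriv f x * ((1 / f x) * (1 / f x)))) (at x)" for x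
    using f'(1) nz[of x]
    by (auto intro!: derivative_eq_intros simp: power2_eq_square)
  have cont: "continuous_on UNIV (\<lambda>x. 1 / f x)"
    using d by (meson DERIV_isCont continuous_at_imp_continuous_on)
  have per: "1 / f (x + 1) = 1 / f x" for x
    by (simp add: sobolev_periodic[OF f])
  obtain B where B: "\<And>x. norm (1 / f x) \<le> B"
    using periodic_bounded[OF cont per] by blast
  have "(\<lambda>x. 1 / f x) \<in> sobolev (min (1 + real j) s)" for j
  proof (induction j)
    case 0
    \<comment> \<open>The induction starts at exponent 1, supplied by continuous differentiability,
      because its step multiplies functions and so needs an exponent above 1/2.\<close>
    have "(\<lambda>x. 1 / f x) \<in> sobolev 1"
    proof (rule C1_periodic_sobolev_1[OF d _ per])
      show "continuous_on UNIV (\<lambda>x. - (deriv f x * ((1 / f x) * (1 / f x))))"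
        by (intro continuous_intros sobolev_continuous[OF f'(2)] sobolev_continuous[OF f] ballI nz)
    qed
    then show ?case using s by simp
  next
    case (Suc j)
    \<comment> \<open>The cap \<open>s - 1\<close> is the regularity of \<open>deriv f\<close>; it
      exceeds 1/2 because \<open>s > 3/2\<close>, so \<open>sobolev r\<close> is an algebra.\<close>
    define r where "r = min (1 + real j) (s - 1)"
    have r: "r > 1/2" "r \<le> s - 1" "r \<le> min (1 + real j) s"
      using s by (auto simp: r_def)
    have 1: "deriv f \<in> sobolev r" by (rule sobolev_mono(1)[OF f'(2) r(2)])
    have 2: "(\<lambda>x. 1 / f x) \<in> sobolev r" by (rule sobolev_mono(1)[OF Suc.IH r(3)])
    have mult: "(\<lambda>x. g x * h x) \<in> sobolev r" if "g \<in> sobolev r" "h \<in> sobolev r" for g h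
      using sobolev_mult[OF r(1)] that by blast
    have "(\<lambda>x. - 1 * (deriv f x * ((1 / f x) * (1 / f x)))) \<in> sobolev r"
      by (intro sobolev_cmult(1) mult 1 2)
    then have "(\<lambda>x. 1 / f x) \<in> sobolev (r + 1)"
      by (intro sobolev_antiderivative(1)[OF d _ per]) (use B in auto)
    moreover have "r + 1 = min (1 + real (Suc j)) s" by (simp add: r_def)
    ultimately show ?case by simp
  qed
  moreover have "min (1 + real (nat \<lceil>s\<rceil>)) s = s"
    using real_nat_ceiling_ge[of s] by (intro min_absorb2) linarith
  ultimately show ?thesis by metis
qed

section \<open>The tangent space and the group\<close>

definition mean :: "(real \<Rightarrow> real) \<Rightarrow> real" where
  "mean f = (LBINT x=0..1. f x)"

lemma mean_conv_integral:
  "continuous_on UNIV f \<Longrightarrow> mean f = integral {0..1} f"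
  unfolding mean_def by (rule interval_integral_01)

abbreviation dfst :: "fun_pair \<Rightarrow> real \<Rightarrow> real" where
  "dfst U \<equiv> deriv (fst U)"

text \<open>Inverse of the map sending \<open>U\<close> to \<open>(dfst U, snd U)\<close>. In these
  coordinates the tangent space consists of the pairs in H^(s-1) whose first entry has mean
  zero.\<close>

definition primitive_pair :: "(real \<Rightarrow> real) \<Rightarrow> (real \<Rightarrow> real) \<Rightarrow> fun_pair" where
  "primitive_pair a b = (\<lambda>x. LBINT y=0..ereal x. a y, b)"

lemma fun_pair_simps [simp]:
  fixes U V :: fun_pair
  shows "fst (U + V) x = fst U x + fst V x" "snd (U + V) x = snd U x + snd V x"
    "fst (U - V) x = fst U x - fst V x" "snd (U - V) x = snd U x - snd V x"
    "fst (c *\<^sub>R U) x = c * fst U x" "snd (c *\<^sub>R U) x = c * snd U x"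
    "fst (- U) x = - fst U x" "snd (- U) x = - snd U x"
    "fst (0 :: fun_pair) x = 0" "snd (0 :: fun_pair) x = 0"
  by (auto simp: scaleR_fun_def)

lemma fun_pair_eqI: "(\<And>x. fst U x = fst V x) \<Longrightarrow> (\<And>x. snd U x = snd V x) \<Longrightarrow> U = (V :: fun_pair)"
  by (auto simp: prod_eq_iff)

locale circle_sobolev =
  fixes s :: real
  assumes s: "s > 5/2"
begin

abbreviation "A \<equiv> sobolev (s - 1)"
abbreviation "T \<equiv> tangent s"
abbreviation "tn \<equiv> tangent_norm s"
abbreviation "frechet \<equiv> has_frechet_derivative s"

abbreviation "An \<equiv> sobolev_norm (s - 1)"

text \<open>One constant serves for both bounds, so that a single rescaling of the norm absorbs
  them.\<close>

lemma ex_alg_const: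
  "\<exists>C>0. (\<forall>f\<in>A. \<forall>x. \<bar>f x\<bar> \<le> C * An f) \<and> (\<forall>f\<in>A. \<forall>g\<in>A. An (\<lambda>x. f x * g x) \<le> C * An f * An g)"
proof -
  have "s - 1 > 1/2" using s by simp
  obtain C where C: "C > 0" "\<forall>f\<in>A. \<forall>g\<in>A. (\<lambda>x. f x * g x) \<in> A \<and> An (\<lambda>x. f x * g x) \<le> C * An f * An g"
    using sobolev_mult[OF \<open>s - 1 > 1/2\<close>] by blast
  obtain K where K: "K > 0" "\<forall>f\<in>A. \<forall>x. \<bar>f x\<bar> \<le> K * An f"
    using sobolev_sup_bound[OF \<open>s - 1 > 1/2\<close>] by blast
  show ?thesis
  proof (intro exI[of _ "max C K"] conjI ballI allI)
    show "max C K > 0" using C by auto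
    show "\<bar>f x\<bar> \<le> max C K * An f" if "f \<in> A" for f x
      using K(2) that by (meson max.cobounded2 mult_right_mono order_trans sobolev_norm_nonneg)
    show "An (\<lambda>x. f x * g x) \<le> max C K * An f * An g" if "f \<in> A" "g \<in> A" for f g
    proof -
      have "C * An f * An g \<le> max C K * An f * An g"
        by (intro mult_right_mono) auto
      then show ?thesis using C(2) that by force
    qed
  qed
qed

definition alg_const :: real where
  "alg_const = (SOME C. C > 0 \<and> (\<forall>f\<in>A. \<forall>x. \<bar>f x\<bar> \<le> C * An f) \<and>
     (\<forall>f\<in>A. \<forall>g\<in>A. An (\<lambda>x. f x * g x) \<le> C * An f * An g))"

lemma alg_const: "alg_const > 0" "f \<in> A \<Longrightarrow> \<bar>f x\<bar> \<le> alg_const * An f"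
    "f \<in> A \<Longrightarrow> g \<in> A \<Longrightarrow> An (\<lambda>x. f x * g x) \<le> alg_const * An f * An g"
  using someI_ex[OF ex_alg_const, folded alg_const_def] by auto

text \<open>The rescaling makes the Sobolev norm submultiplicative and larger than the supremum norm.\<close>

definition M :: "(real \<Rightarrow> real) \<Rightarrow> real" where
  "M f = alg_const * An f"

lemma M_nonneg [simp]: "M f \<ge> 0"
  using alg_const(1) by (simp add: M_def)

lemma abs_le_M: "f \<in> A \<Longrightarrow> \<bar>f x\<bar> \<le> M f"
  unfolding M_def by (rule alg_const(2))

lemma A_mult: "f \<in> A \<Longrightarrow> g \<in> A \<Longrightarrow> (\<lambda>x. f x * g x) \<in> A"
  using sobolev_mult[of "s - 1"] s by auto

lemma M_mult: "f \<in> A \<Longrightarrow> g \<in> A \<Longrightarrow> M (\<lambda>x. f x * g x) \<le> M f * M g"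
  using mult_left_mono[OF alg_const(3), of f g alg_const] alg_const(1)
  by (simp add: M_def mult_ac)

lemma A_const: "(\<lambda>x. c) \<in> A"
  by (rule sobolev_const)

lemma A_add: "f \<in> A \<Longrightarrow> g \<in> A \<Longrightarrow> (\<lambda>x. f x + g x) \<in> A"
  and A_diff: "f \<in> A \<Longrightarrow> g \<in> A \<Longrightarrow> (\<lambda>x. f x - g x) \<in> A"
  and A_minus: "f \<in> A \<Longrightarrow> (\<lambda>x. - f x) \<in> A"
  using sobolev_add(1) sobolev_diff(1) sobolev_cmult(1)[of f "s - 1" "-1"] by auto

lemma M_add: "f \<in> A \<Longrightarrow> g \<in> A \<Longrightarrow> M (\<lambda>x. f x + g x) \<le> M f + M g"
  using mult_left_mono[OF sobolev_add(2), of f "s - 1" g alg_const] alg_const(1)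
  by (simp add: M_def distrib_left)

lemma M_diff: "f \<in> A \<Longrightarrow> g \<in> A \<Longrightarrow> M (\<lambda>x. f x - g x) \<le> M f + M g"
  using mult_left_mono[OF sobolev_diff(2), of f "s - 1" g alg_const] alg_const(1)
  by (simp add: M_def distrib_left)

lemma M_cmult: "f \<in> A \<Longrightarrow> M (\<lambda>x. c * f x) \<le> \<bar>c\<bar> * M f"
  using mult_left_mono[OF sobolev_cmult(2), of f "s - 1" alg_const c] alg_const(1)
  by (simp add: M_def mult_ac)

lemma A_inverse: "f \<in> A \<Longrightarrow> (\<And>x. f x \<noteq> 0) \<Longrightarrow> (\<lambda>x. 1 / f x) \<in> A"
  using s by (intro sobolev_inverse) auto

lemmas A_intros = A_mult A_const A_add A_diff A_minus

lemma A_continuous: "f \<in> A \<Longrightarrow> continuous_on UNIV f"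
  by (rule sobolev_continuous)

lemma mean_add: "f \<in> A \<Longrightarrow> g \<in> A \<Longrightarrow> mean (\<lambda>x. f x + g x) = mean f + mean g"
  and mean_diff: "f \<in> A \<Longrightarrow> g \<in> A \<Longrightarrow> mean (\<lambda>x. f x - g x) = mean f - mean g"
  and mean_cmult: "f \<in> A \<Longrightarrow> mean (\<lambda>x. c * f x) = c * mean f"
  by (simp_all add: mean_conv_integral A_continuous continuous_on_add continuous_on_diff
      continuous_on_mult_left integral_add integral_diff)

lemma abs_mean_le:
  assumes "f \<in> A"
  shows "\<bar>mean f\<bar> \<le> M f"
  using integral_bound[of 0 1 f "M f"] abs_le_M[OF assms] A_continuous[OF assms]
  by (simp add: mean_conv_integral continuous_on_subset)

text \<open>The hypothesis \<open>s > 5/2\<close> enters as \<open>s - 2 > 1/2\<close>: elements of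
  H^(s-1) are continuously differentiable. The Christoffel map needs this, since it differentiates
  products of such functions before applying \<open>A_inv\<close>.\<close>

lemma A_has_derivative:
  assumes "f \<in> A"
  shows "(f has_real_derivative deriv f x) (at x)" "continuous_on UNIV (deriv f)"
proof -
  have "s - 2 > 1/2" "f \<in> sobolev (s - 2 + 1)" using s assms by auto
  from sobolev_has_derivative(1,2)[OF this]
  show "(f has_real_derivative deriv f x) (at x)" "continuous_on UNIV (deriv f)"
    by (auto intro: sobolev_continuous)
qed

lemma tangentD:
  assumes "U \<in> T"
  shows "(fst U has_real_derivative dfst U x) (at x)" "dfst U \<in> A" "snd U \<in> A" "fst U 0 = 0"
    "fst U (x + 1) = fst U x"
proof -
  have "s - 1 > 1/2" "fst U \<in> sobolev (s - 1 + 1)"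
    using s assms by (auto simp: tangent_def sobolev0_def)
  from sobolev_has_derivative(1,2)[OF this]
  show "(fst U has_real_derivative dfst U x) (at x)" "dfst U \<in> A" by auto
qed (use assms in \<open>auto simp: tangent_def sobolev0_def intro: sobolev_periodic\<close>)

lemma tangent_0: "0 \<in> T"
  using sobolev_const[of 0 s] sobolev_const[of 0 "s - 1"]
  by (auto simp: tangent_def sobolev0_def zero_prod_def zero_fun_def)

lemma tangent_add: "U \<in> T \<Longrightarrow> V \<in> T \<Longrightarrow> U + V \<in> T"
  by (auto simp: tangent_def sobolev0_def plus_fun_def plus_prod_def sobolev_add)

lemma tangent_diff: "U \<in> T \<Longrightarrow> V \<in> T \<Longrightarrow> U - V \<in> T"
  by (auto simp: tangent_def sobolev0_def fun_diff_def minus_prod_def sobolev_diff)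

lemma tangent_scaleR: "U \<in> T \<Longrightarrow> c *\<^sub>R U \<in> T"
  by (auto simp: tangent_def sobolev0_def scaleR_fun_def scaleR_prod_def sobolev_cmult)

lemma dfst_add: "U \<in> T \<Longrightarrow> V \<in> T \<Longrightarrow> dfst (U + V) x = dfst U x + dfst V x"
  using DERIV_add[OF tangentD(1)[of U x] tangentD(1)[of V x]] by (auto intro!: DERIV_imp_deriv simp: plus_fun_def)

lemma dfst_diff: "U \<in> T \<Longrightarrow> V \<in> T \<Longrightarrow> dfst (U - V) x = dfst U x - dfst V x"
  using DERIV_diff[OF tangentD(1)[of U x] tangentD(1)[of V x]] by (auto intro!: DERIV_imp_deriv simp: fun_diff_def)

lemma dfst_scaleR: "U \<in> T \<Longrightarrow> dfst (c *\<^sub>R U) x = c * dfst U x"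
  using DERIV_cmult[OF tangentD(1)[of U x], of c] by (auto intro!: DERIV_imp_deriv simp: scaleR_fun_def)

lemma tn_nonneg [simp]: "tn U \<ge> 0"
  by (simp add: tangent_norm_def)

lemma tn_triangle:
  assumes "U \<in> T" "V \<in> T"
  shows "tn (U + V) \<le> tn U + tn V"
proof -
  have "tn (U + V) \<le> sqrt ((sobolev_norm s (fst U) + sobolev_norm s (fst V))\<^sup>2
      + (An (snd U) + An (snd V))\<^sup>2)"
    unfolding tangent_norm_def using assms
    by (intro real_sqrt_le_mono add_mono power_mono)
       (auto simp: tangent_def sobolev0_def plus_fun_def sobolev_add)
  also have "\<dots> \<le> tn U + tn V"
    unfolding tangent_norm_def by (rule real_sqrt_sum_squares_triangle_ineq)
  finally show ?thesis .
qed

lemma tn_scaleR: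
  assumes "U \<in> T"
  shows "tn (c *\<^sub>R U) \<le> \<bar>c\<bar> * tn U"
proof -
  have "tn (c *\<^sub>R U) \<le> sqrt ((\<bar>c\<bar> * sobolev_norm s (fst U))\<^sup>2 + (\<bar>c\<bar> * An (snd U))\<^sup>2)"
    unfolding tangent_norm_def using assms
    by (intro real_sqrt_le_mono add_mono power_mono)
       (auto simp: tangent_def sobolev0_def scaleR_fun_def sobolev_cmult)
  also have "\<dots> = \<bar>c\<bar> * tn U"
    by (simp add: tangent_norm_def power_mult_distrib real_sqrt_mult flip: distrib_left)
  finally show ?thesis .
qed

lemma tn_diff: "U \<in> T \<Longrightarrow> V \<in> T \<Longrightarrow> tn (U - V) \<le> tn U + tn V"
  using tn_triangle[of U "(-1) *\<^sub>R V"] tn_scaleR[of V "-1"] tangent_scaleR[of V "-1"] by simp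

lemma tn_0: "tn 0 = 0"
  using tn_scaleR[OF tangent_0, of 0] by (simp add: order_antisym)

text \<open>The factor \<open>2 * pi\<close> comes from differentiating a Fourier mode,
  \<open>alg_const\<close> from the rescaling in \<open>M\<close>. Together with
  \<open>tn_le_M\<close> this makes \<open>tn U\<close> equivalent to
  \<open>M (dfst U) + M (snd U)\<close>.\<close>

lemma M_le_tn:
  obtains C where "C > 0" "\<And>U. U \<in> T \<Longrightarrow> M (dfst U) \<le> C * tn U" "\<And>U. U \<in> T \<Longrightarrow> M (snd U) \<le> C * tn U"
proof (rule that[of "alg_const * (2 * pi)"])
  show "alg_const * (2 * pi) > 0" using alg_const(1) by simp
  fix U assume U: "U \<in> T"
  have 1: "sobolev_norm s (fst U) \<le> tn U" "An (snd U) \<le> tn U"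
    by (simp_all add: tangent_norm_def real_le_rsqrt)
  have "s - 1 > 1/2" "fst U \<in> sobolev (s - 1 + 1)"
    using s U by (auto simp: tangent_def sobolev0_def)
  from sobolev_has_derivative(3)[OF this]
  have "An (dfst U) \<le> 2 * pi * sobolev_norm s (fst U)" by simp
  also have "\<dots> \<le> 2 * pi * tn U" by (intro mult_left_mono 1) simp
  finally show "M (dfst U) \<le> alg_const * (2 * pi) * tn U"
    using alg_const(1) by (simp add: M_def)
  have "1 * tn U \<le> 2 * pi * tn U" using pi_gt3 by (intro mult_right_mono) auto
  then have "An (snd U) \<le> 2 * pi * tn U" using 1 by linarith
  then show "M (snd U) \<le> alg_const * (2 * pi) * tn U"
    using alg_const(1) by (simp add: M_def)
qed

text \<open>Mean zero makes the primitive periodic. On one period it is bounded by the supremum of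
  \<open>a\<close>, hence by \<open>M a\<close>, as \<open>sobolev_antiderivative\<close> requires.
  Dividing \<open>M\<close> by \<open>alg_const\<close> recovers the Sobolev norm, which explains
  the shape of the constant.\<close>

lemma primitive_pair:
  assumes a: "a \<in> A" and b: "b \<in> A" and "mean a = 0"
  shows "primitive_pair a b \<in> T" "dfst (primitive_pair a b) = a" "snd (primitive_pair a b) = b"
    "tn (primitive_pair a b) \<le> (1 + 2 / alg_const) * (M a + M b)"
proof -
  define h where "h = (\<lambda>x. LBINT y=0..ereal x. a y)"
  have "integral {0..1} a = 0"
    using assms(3) by (simp add: mean_conv_integral A_continuous[OF a])
  note prim = periodic_primitive[OF h_def A_continuous[OF a] sobolev_periodic[OF a] this]
  note h0 = prim(2) and per = prim(3) and d = prim(1)[folded has_real_derivative_iff_has_vector_derivative]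
  have B: "\<bar>h x\<bar> \<le> M a" for x
  proof -
    obtain y where y: "y \<in> {0..1}" "h x = h y"
      by (rule periodic_value_01[of h, OF per])
    have "norm (h y - h 0) \<le> M a * norm (y - 0)"
      using y by (intro field_differentiable_bound[of "{0..1}" h a])
        (auto intro: has_field_derivative_at_within d abs_le_M[OF a])
    also have "\<dots> \<le> M a * 1" using y by (intro mult_left_mono) auto
    finally show ?thesis using y h0 by simp
  qed
  have h: "h \<in> sobolev s" "sobolev_norm s h \<le> M a + An a"
    using sobolev_antiderivative[OF d a per B] by auto
  show "primitive_pair a b \<in> T" "snd (primitive_pair a b) = b"
    using h h0 b by (auto simp: primitive_pair_def tangent_def sobolev0_def h_def)
  show "dfst (primitive_pair a b) = a"
    using DERIV_imp_deriv[OF d] by (auto simp: primitive_pair_def h_def)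
  have "tn (primitive_pair a b) \<le> \<bar>sobolev_norm s h\<bar> + \<bar>An b\<bar>"
    unfolding tangent_norm_def by (simp add: primitive_pair_def sqrt_sum_squares_le_sum flip: h_def)
  also have "\<dots> \<le> M a + An a + An b"
    using h(2) by simp
  also have "\<dots> = M a + M a / alg_const + M b / alg_const"
    using alg_const(1) by (simp add: M_def)
  also have "\<dots> \<le> M a + M b + 2 * (M a / alg_const) + 2 * (M b / alg_const)"
    using alg_const(1) by (simp add: field_simps)
  also have "\<dots> = (1 + 2 / alg_const) * (M a + M b)"
    using alg_const(1) by (simp add: field_simps)
  finally show "tn (primitive_pair a b) \<le> (1 + 2 / alg_const) * (M a + M b)" .
qed

lemma mean_dfst:
  assumes "U \<in> T"
  shows "mean (dfst U) = 0"
proof -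
  have "(dfst U has_integral fst U 1 - fst U 0) {0..1}"
    by (rule fundamental_theorem_of_calculus)
       (auto intro: has_vector_derivative_at_within tangentD(1)[OF assms, unfolded has_real_derivative_iff_has_vector_derivative])
  then show ?thesis
    using tangentD(4)[OF assms] tangentD(5)[OF assms, of 0] tangentD(2)[OF assms]
    by (simp add: mean_conv_integral A_continuous integral_unique)
qed

text \<open>First components vanish at 0, so they are recovered from their derivatives. All
  identities between tangent vectors below are checked in this form.\<close>

lemma tangent_eqI:
  assumes U: "U \<in> T" and V: "V \<in> T" and "\<And>x. dfst U x = dfst V x" "\<And>x. snd U x = snd V x"
  shows "U = V"
proof (rule fun_pair_eqI)
  fix x
  have "((\<lambda>x. fst U x - fst V x) has_vector_derivative 0) (at x)" for x
    using DERIV_diff[OF tangentD(1)[OF U, of x] tangentD(1)[OF V, of x]] assms(3)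
    by (simp add: has_real_derivative_iff_has_vector_derivative)
  then have "fst U x - fst V x = fst U 0 - fst V 0"
    using has_vector_derivative_zero_const[of "\<lambda>x. fst U x - fst V x"] by blast
  then show "fst U x = fst V x"
    using tangentD(4)[OF U] tangentD(4)[OF V] by simp
qed (rule assms)

lemma primitive_pair_dfst:
  assumes "U \<in> T"
  shows "primitive_pair (dfst U) (snd U) = U"
  using primitive_pair(1-3)[OF tangentD(2,3)[OF assms] mean_dfst[OF assms]]
  by (intro tangent_eqI[OF _ assms]) auto

lemma tn_le_M:
  assumes "U \<in> T"
  shows "tn U \<le> (1 + 2 / alg_const) * (M (dfst U) + M (snd U))"
  using primitive_pair(4)[OF tangentD(2,3)[OF assms] mean_dfst[OF assms]]
  by (simp add: primitive_pair_dfst[OF assms])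

lemma abs_fst_le_tn:
  obtains C where "C > 0" "\<And>U x. U \<in> T \<Longrightarrow> \<bar>fst U x\<bar> \<le> C * tn U" "\<And>U x. U \<in> T \<Longrightarrow> \<bar>snd U x\<bar> \<le> C * tn U"
proof -
  obtain C where C: "C > 0" "\<And>U. U \<in> T \<Longrightarrow> M (dfst U) \<le> C * tn U" "\<And>U. U \<in> T \<Longrightarrow> M (snd U) \<le> C * tn U"
    using M_le_tn by blast
  show ?thesis
  proof (rule that[OF C(1)])
    fix U x assume U: "U \<in> T"
    show "\<bar>snd U x\<bar> \<le> C * tn U"
      using abs_le_M[OF tangentD(3)[OF U], of x] C(3)[OF U] by linarith
    obtain y where y: "y \<in> {0..1}" "fst U x = fst U y"
      by (rule periodic_value_01[of "fst U", OF tangentD(5)[OF U]])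
    have "norm (fst U y - fst U 0) \<le> M (dfst U) * norm (y - 0)"
      using y by (intro field_differentiable_bound[of "{0..1}" "fst U" "dfst U"])
        (auto intro: has_field_derivative_at_within tangentD(1)[OF U] abs_le_M[OF tangentD(2)[OF U]])
    also have "\<dots> \<le> M (dfst U) * 1" using y by (intro mult_left_mono) auto
    finally show "\<bar>fst U x\<bar> \<le> C * tn U"
      using y C(2)[OF U] tangentD(4)[OF U] by simp
  qed
qed

section \<open>The group as an open subset of an affine space\<close>

lemma G_tangent:
  assumes "p \<in> G s"
  shows "(\<lambda>x. fst p x - x, snd p) \<in> T"
  using assms by (auto simp: G_def Diff0_def tangent_def)

text \<open>Monotonicity alone gives a nonnegative derivative. It is nonzero because the inverse is
  differentiable: at a zero the chain rule would give the identity the derivative 0. The mean 1 is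
  the increment of the lift over one period.\<close>

lemma GD:
  assumes p: "p \<in> G s"
  shows "(fst p has_real_derivative dfst p x) (at x)" "dfst p \<in> A" "dfst p x > 0" "fst p 0 = 0"
    "fst p (x + 1) = fst p x + 1" "snd p \<in> A" "mean (dfst p) = 1" "bij (fst p)"
proof -
  note h = tangentD[OF G_tangent[OF p], unfolded fst_conv snd_conv]
  define h' where "h' = deriv (\<lambda>x. fst p x - x)"
  have d': "(fst p has_real_derivative h' x + 1) (at x)" for x
    using DERIV_add[OF h(1)[of x] DERIV_ident] by (simp add: h'_def)
  have eq: "dfst p = (\<lambda>x. h' x + 1)"
    using DERIV_imp_deriv[OF d'] by auto
  show d: "(fst p has_real_derivative dfst p x) (at x)" for x
    using d' by (simp add: eq)
  show "dfst p \<in> A"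
    unfolding eq h'_def by (intro A_intros h(2))
  have "mean (\<lambda>x. 1) = 1"
    by (simp add: mean_conv_integral)
  then show "mean (dfst p) = 1"
    using mean_dfst[OF G_tangent[OF p]] mean_add[OF h(2) A_const[of 1]]
    by (simp add: eq h'_def)
  show "fst p 0 = 0" "fst p (x + 1) = fst p x + 1"
    using h(4) h(5)[of x] by simp_all
  show "snd p \<in> A" by (rule h(3))
  show "bij (fst p)" using p by (auto simp: G_def Diff0_def)
  have mono: "strict_mono (fst p)" and inv: "inv (fst p) differentiable_on UNIV"
    using p by (auto simp: G_def Diff0_def)
  have "dfst p x \<noteq> 0"
  proof
    assume 0: "dfst p x = 0"
    have "inv (fst p) differentiable (at (fst p x))"
      using inv by (simp add: differentiable_on_def)
    then obtain c where "(inv (fst p) has_real_derivative c) (at (fst p x))"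
      using real_differentiable_def by blast
    from DERIV_chain[OF this d] have "((inv (fst p) \<circ> fst p) has_real_derivative 0) (at x)"
      by (simp add: 0)
    moreover have "inv (fst p) \<circ> fst p = (\<lambda>x. x)"
      using strict_mono_imp_inj_on[OF mono] by (auto simp: o_def)
    ultimately have "((\<lambda>x. x) has_real_derivative 0) (at x)" by simp
    then show False
      using DERIV_unique[OF DERIV_ident, of 0 x] by simp
  qed
  moreover have "\<not> dfst p x < 0"
  proof
    assume "dfst p x < 0"
    then obtain e where "e > 0" "\<forall>h>0. h < e \<longrightarrow> fst p (x + h) < fst p x"
      using DERIV_neg_dec_right[OF d] by blast
    then have "fst p (x + e / 2) < fst p x" by simp
    moreover have "fst p x < fst p (x + e / 2)"
      using \<open>e > 0\<close> by (intro strict_monoD[OF mono]) simp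
    ultimately show False by simp
  qed
  ultimately show "dfst p x > 0" by linarith
qed

lemma GD': "p \<in> G s \<Longrightarrow> dfst p x \<noteq> 0"
  using GD(3) by (metis less_irrefl)

text \<open>A positive derivative yields the rest of the definition: monotonicity, and a
  differentiable inverse through the inverse function theorem.\<close>

lemma GI:
  assumes h: "(\<lambda>x. \<phi> x - x, \<alpha>) \<in> T"
    and d: "\<And>x. (\<phi> has_real_derivative \<phi>' x) (at x)" and pos: "\<And>x. \<phi>' x > 0"
  shows "(\<phi>, \<alpha>) \<in> G s"
proof -
  have cont: "continuous_on UNIV \<phi>"
    using d by (meson DERIV_isCont continuous_at_imp_continuous_on)
  have mono: "strict_mono \<phi>"
    by (rule strict_monoI) (use DERIV_pos_imp_increasing d pos in blast)
  then have inj: "inj \<phi>" by (rule strict_mono_imp_inj_on)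
  \<comment> \<open>Integers are fixed since \<open>\<phi> x - x\<close> is periodic and vanishes at
    0. The intermediate value theorem between consecutive integers then gives surjectivity.\<close>
  have "\<phi> (of_int k) = of_int k" for k
    using periodic_int_shift[of "\<lambda>x. \<phi> x - x" 0 k] tangentD(4,5)[OF h] by simp
  moreover have "\<exists>x. \<phi> x = y" for y
  proof -
    have "\<exists>x\<ge>of_int \<lfloor>y\<rfloor>. x \<le> of_int (\<lfloor>y\<rfloor> + 1) \<and> \<phi> x = y"
      by (rule IVT') (use calculation in \<open>auto intro: continuous_on_subset[OF cont] simp: calculation[of "_ + _"] simp del: of_int_add\<close>, linarith)
    then show ?thesis by blast
  qed
  then have "surj \<phi>" by (metis surjI)
  have "inv \<phi> differentiable_on UNIV"
    unfolding differentiable_on_def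
  proof
    fix y
    obtain x where y: "y = \<phi> x" using \<open>surj \<phi>\<close> by blast
    have "(inv \<phi> has_real_derivative inverse (\<phi>' x)) (at (\<phi> x))"
      unfolding has_field_derivative_def
    proof (rule has_derivative_inverse_strong[where S = UNIV and f = \<phi> and f' = "(*) (\<phi>' x)"])
      show "(*) (\<phi>' x) \<circ> (*) (inverse (\<phi>' x)) = id"
        using pos[of x] by (auto simp: fun_eq_iff)
      show "(\<phi> has_derivative (*) (\<phi>' x)) (at x)"
        using d[of x] by (simp add: has_field_derivative_def)
    qed (use cont inj in auto)
    then show "inv \<phi> differentiable at y within UNIV"
      unfolding y using real_differentiable_def by auto
  qed
  then show ?thesis
    using h inj \<open>surj \<phi>\<close> mono by (simp add: G_def Diff0_def tangent_def bij_def)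
qed

lemma G_diff_tangent:
  assumes "p \<in> G s" "q \<in> G s"
  shows "q - p \<in> T" "dfst (q - p) x = dfst q x - dfst p x"
proof -
  have "q - p = (\<lambda>x. fst q x - x, snd q) - (\<lambda>x. fst p x - x, snd p)"
    by (simp add: prod_eq_iff fun_diff_def)
  then show "q - p \<in> T"
    using tangent_diff[OF G_tangent[OF assms(2)] G_tangent[OF assms(1)]] by simp
  show "dfst (q - p) x = dfst q x - dfst p x"
    using DERIV_diff[OF GD(1)[OF assms(2), of x] GD(1)[OF assms(1), of x]]
    by (auto intro!: DERIV_imp_deriv simp: fun_diff_def)
qed

text \<open>By periodicity \<open>dfst p\<close> attains a positive minimum, and a tangent vector of
  small norm changes the derivative by less than this minimum everywhere.\<close>

lemma G_open:
  assumes p: "p \<in> G s"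
  shows "\<exists>\<delta>>0. \<forall>h\<in>T. tn h < \<delta> \<longrightarrow> p + h \<in> G s"
proof -
  obtain C where C: "C > 0" "\<And>U. U \<in> T \<Longrightarrow> M (dfst U) \<le> C * tn U"
      "\<And>U. U \<in> T \<Longrightarrow> M (snd U) \<le> C * tn U"
    using M_le_tn by blast
  have "\<exists>x\<in>{0..1}. \<forall>y\<in>{0..1}. dfst p x \<le> dfst p y"
    by (intro continuous_attains_inf continuous_on_subset[OF A_continuous[OF GD(2)[OF p]]]) auto
  then obtain x0 where x0: "\<forall>y\<in>{0..1}. dfst p x0 \<le> dfst p y" by blast
  have min: "dfst p x0 \<le> dfst p x" for x
  proof -
    obtain y where "y \<in> {0..1}" "dfst p x = dfst p y"
      by (rule periodic_value_01[of "dfst p", OF sobolev_periodic[OF GD(2)[OF p]]])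
    then show ?thesis using x0 by simp
  qed
  have "dfst p x0 / C > 0" using C(1) GD(3)[OF p] by simp
  moreover have "p + h \<in> G s" if h: "h \<in> T" and small: "tn h < dfst p x0 / C" for h
  proof -
    have "(fst (p + h), snd (p + h)) \<in> G s"
    proof (rule GI)
      have "(\<lambda>x. fst (p + h) x - x, snd (p + h)) = (\<lambda>x. fst p x - x, snd p) + h"
        by (simp add: prod_eq_iff plus_fun_def add_diff_eq diff_add_eq)
      then show "(\<lambda>x. fst (p + h) x - x, snd (p + h)) \<in> T"
        using tangent_add[OF G_tangent[OF p] h] by simp
      show "(fst (p + h) has_real_derivative dfst p x + dfst h x) (at x)" for x
        using DERIV_add[OF GD(1)[OF p, of x] tangentD(1)[OF h, of x]] by (simp add: plus_fun_def)
      have "C * tn h < dfst p x0" using small C(1) by (simp add: field_simps)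
      then have "\<bar>dfst h x\<bar> < dfst p x0" for x
        using abs_le_M[OF tangentD(2)[OF h], of x] C(2)[OF h] by linarith
      then show "dfst p x + dfst h x > 0" for x
        using min[of x] by (smt (verit))
    qed
    then show ?thesis by (simp only: prod.collapse)
  qed
  ultimately show ?thesis by blast
qed

section \<open>Frechet derivatives and the symmetry of second derivatives\<close>

lemma tangent_bounded_linearD:
  assumes "tangent_bounded_linear s L"
  shows "h \<in> T \<Longrightarrow> L h \<in> T" "h \<in> T \<Longrightarrow> k \<in> T \<Longrightarrow> L (h + k) = L h + L k"
    "h \<in> T \<Longrightarrow> L (c *\<^sub>R h) = c *\<^sub>R L h" "\<exists>C>0. \<forall>h\<in>T. tn (L h) \<le> C * tn h"
proof -
  from assms obtain C where C: "\<forall>h\<in>T. tn (L h) \<le> C * tn h"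
    by (auto simp: tangent_bounded_linear_def)
  have "tn (L h) \<le> (\<bar>C\<bar> + 1) * tn h" if "h \<in> T" for h
  proof -
    have "C * tn h \<le> (\<bar>C\<bar> + 1) * tn h" by (intro mult_right_mono) auto
    then show ?thesis using C that by force
  qed
  then show "\<exists>C>0. \<forall>h\<in>T. tn (L h) \<le> C * tn h"
    by (intro exI[of _ "\<bar>C\<bar> + 1"]) auto
qed (use assms in \<open>auto simp: tangent_bounded_linear_def tangent_linear_def\<close>)

lemma frechet_bounded_linear: "frechet F L p \<Longrightarrow> tangent_bounded_linear s L"
  by (simp add: has_frechet_derivative_def)

lemmas frechet_derivD = tangent_bounded_linearD[OF frechet_bounded_linear]

lemma frechet_derivD_remainder:
  "frechet F L p \<Longrightarrow> e > 0 \<Longrightarrow>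
    \<exists>d>0. \<forall>q\<in>G s. tn (q - p) < d \<longrightarrow> tn (F q - F p - L (q - p)) \<le> e * tn (q - p)"
  by (simp add: has_frechet_derivative_def)

text \<open>Scalarisation: vector fields are composed with such functionals and restricted to lines,
  where the mean value theorem and the uniqueness of derivatives for real functions apply. The
  conditions are relative to \<open>T\<close>, a mere subset of a function type.\<close>

definition bounded_functional :: "(fun_pair \<Rightarrow> real) \<Rightarrow> bool" where
  "bounded_functional ev \<longleftrightarrow> (\<forall>U\<in>T. \<forall>V\<in>T. ev (U - V) = ev U - ev V) \<and>
     (\<forall>c. \<forall>U\<in>T. ev (c *\<^sub>R U) = c * ev U) \<and> (\<exists>K>0. \<forall>U\<in>T. \<bar>ev U\<bar> \<le> K * tn U)"

lemma line_derivative: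
  assumes q: "q0 + \<tau> *\<^sub>R h \<in> G s" and Z: "\<And>q. q \<in> G s \<Longrightarrow> Z q \<in> T" and h: "h \<in> T"
    and L: "frechet Z L (q0 + \<tau> *\<^sub>R h)" and ev: "bounded_functional ev"
  shows "((\<lambda>t. ev (Z (q0 + t *\<^sub>R h))) has_real_derivative ev (L h)) (at \<tau>)"
  unfolding has_field_derivative_def has_derivative_at_alt
proof (intro conjI allI impI)
  show "bounded_linear ((*) (ev (L h)))" by (rule bounded_linear_mult_right)
  fix e :: real assume "e > 0"
  obtain K where K: "K > 0" "\<forall>U\<in>T. \<bar>ev U\<bar> \<le> K * tn U"
    using ev by (auto simp: bounded_functional_def)
  have ev_diff: "ev (U - V) = ev U - ev V" if "U \<in> T" "V \<in> T" for U V
    using ev that by (simp add: bounded_functional_def)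
  have ev_scale: "ev (c *\<^sub>R U) = c * ev U" if "U \<in> T" for c U
    using ev that by (simp add: bounded_functional_def)
  define q where "q = q0 + \<tau> *\<^sub>R h"
  \<comment> \<open>The 1 keeps \<open>a\<close> positive when \<open>tn h = 0\<close>. With
    \<open>e'\<close> below, the error \<open>K * (e' * (\<bar>y - \<tau>\<bar> * a))\<close> is
    exactly \<open>e * \<bar>y - \<tau>\<bar>\<close>.\<close>
  define a where "a = tn h + 1"
  have a: "a > 0" "tn h \<le> a" using tn_nonneg[of h] unfolding a_def by linarith+
  define e' where "e' = e / (K * a)"
  have "e' > 0" using \<open>e > 0\<close> K a by (simp add: e'_def)
  obtain d where d: "d > 0" "\<forall>q'\<in>G s. tn (q' - q) < d \<longrightarrow> tn (Z q' - Z q - L (q' - q)) \<le> e' * tn (q' - q)"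
    using frechet_derivD_remainder[OF L \<open>e' > 0\<close>] unfolding q_def by blast
  obtain \<delta> where \<delta>: "\<delta> > 0" "\<forall>h\<in>T. tn h < \<delta> \<longrightarrow> q + h \<in> G s"
    using G_open[OF q] unfolding q_def by blast
  define r where "r = min d \<delta> / a"
  have "r > 0" using d \<delta> a by (simp add: r_def)
  moreover have "norm (ev (Z (q0 + y *\<^sub>R h)) - ev (Z (q0 + \<tau> *\<^sub>R h)) - ev (L h) * (y - \<tau>)) \<le> e * norm (y - \<tau>)"
    if y: "norm (y - \<tau>) < r" for y
  proof -
    define q' where "q' = q + (y - \<tau>) *\<^sub>R h"
    have q'y: "q0 + y *\<^sub>R h = q'" by (simp add: q'_def q_def algebra_simps)
    have tnh: "tn ((y - \<tau>) *\<^sub>R h) \<le> \<bar>y - \<tau>\<bar> * a"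
      using tn_scaleR[OF h, of "y - \<tau>"] mult_left_mono[OF a(2), of "\<bar>y - \<tau>\<bar>"] by simp
    also have "\<dots> < min d \<delta>"
      using y a(1) by (simp add: r_def field_simps)
    finally have small: "tn ((y - \<tau>) *\<^sub>R h) < d" "tn ((y - \<tau>) *\<^sub>R h) < \<delta>" by auto
    have q': "q' \<in> G s" using \<delta>(2) small(2) tangent_scaleR[OF h] by (simp add: q'_def)
    have "q' - q = (y - \<tau>) *\<^sub>R h" by (simp add: q'_def)
    then have R: "tn (Z q' - Z q - (y - \<tau>) *\<^sub>R L h) \<le> e' * tn ((y - \<tau>) *\<^sub>R h)"
      using d(2)[rule_format, OF q'] small(1) frechet_derivD(3)[OF L h, of "y - \<tau>"] by simp
    have mem: "Z q' \<in> T" "Z q \<in> T" "L h \<in> T"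
      using Z[OF q'] Z[OF q] frechet_derivD(1)[OF L h] by (auto simp: q_def)
    have "ev (Z q') - ev (Z q) - ev (L h) * (y - \<tau>) = ev (Z q' - Z q - (y - \<tau>) *\<^sub>R L h)"
      by (simp add: ev_diff ev_scale mem tangent_diff tangent_scaleR)
    also have "\<bar>\<dots>\<bar> \<le> K * (e' * (\<bar>y - \<tau>\<bar> * a))"
    proof -
      have "\<bar>ev (Z q' - Z q - (y - \<tau>) *\<^sub>R L h)\<bar> \<le> K * tn (Z q' - Z q - (y - \<tau>) *\<^sub>R L h)"
        using K(2) mem by (auto intro!: tangent_diff tangent_scaleR)
      also have "\<dots> \<le> K * (e' * tn ((y - \<tau>) *\<^sub>R h))"
        using K(1) R by (intro mult_left_mono) auto
      also have "\<dots> \<le> K * (e' * (\<bar>y - \<tau>\<bar> * a))"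
        using K(1) \<open>e' > 0\<close> tnh by (intro mult_left_mono) auto
      finally show ?thesis .
    qed
    also have "\<dots> = e * \<bar>y - \<tau>\<bar>"
      using K(1) a(1) by (simp add: e'_def)
    finally show ?thesis by (simp add: q'y flip: q_def)
  qed
  ultimately show "\<exists>d>0. \<forall>y. norm (y - \<tau>) < d \<longrightarrow>
      norm (ev (Z (q0 + y *\<^sub>R h)) - ev (Z (q0 + \<tau> *\<^sub>R h)) - ev (L h) * (y - \<tau>)) \<le> e * norm (y - \<tau>)"
    by blast
qed

text \<open>Point evaluations of the two components are bounded functionals and already separate
  tangent vectors.\<close>

lemma bounded_functional_ext:
  assumes "U \<in> T" "V \<in> T" and eq: "\<And>ev. bounded_functional ev \<Longrightarrow> ev U = ev V"
  shows "U = V"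
proof -
  obtain C where C: "C > 0" "\<And>U x. U \<in> T \<Longrightarrow> \<bar>fst U x\<bar> \<le> C * tn U" "\<And>U x. U \<in> T \<Longrightarrow> \<bar>snd U x\<bar> \<le> C * tn U"
    using abs_fst_le_tn by blast
  show ?thesis
  proof (rule fun_pair_eqI)
    fix x
    have "bounded_functional (\<lambda>U. fst U x)" "bounded_functional (\<lambda>U. snd U x)"
      using C unfolding bounded_functional_def by (auto simp: scaleR_fun_def)
    from this[THEN eq] show "fst U x = fst V x" "snd U x = snd V x" by auto
  qed
qed

text \<open>Both candidates produce the derivative at 0 of the real function
  \<open>ev \<circ> F\<close> along the line through \<open>p\<close> in direction \<open>h\<close>.
  This fixes the value of the choice made in \<open>frechet_deriv\<close>.\<close>

lemma frechet_derivative_unique: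
  assumes p: "p \<in> G s" and F: "\<And>q. q \<in> G s \<Longrightarrow> F q \<in> T"
    and L: "frechet F L p" and L': "frechet F L' p" and h: "h \<in> T"
  shows "L h = L' h"
proof (rule bounded_functional_ext)
  fix ev assume ev: "bounded_functional ev"
  have p0: "p + 0 *\<^sub>R h = p" by simp
  show "ev (L h) = ev (L' h)"
    using line_derivative[of p 0 h F, unfolded p0, OF p F h L ev]
      line_derivative[of p 0 h F, unfolded p0, OF p F h L' ev] by (rule DERIV_unique)
qed (use frechet_derivD(1)[OF L h] frechet_derivD(1)[OF L' h] in auto)

lemma frechet_deriv_eq:
  assumes "p \<in> G s" "\<And>q. q \<in> G s \<Longrightarrow> F q \<in> T" "frechet F L p" "h \<in> T"
  shows "frechet_deriv s F p h = L h"
proof -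
  have "frechet F (frechet_deriv s F p) p"
    unfolding frechet_deriv_def by (rule someI[of "\<lambda>L. frechet F L p"]) (rule assms(3))
  from frechet_derivative_unique[OF assms(1,2) this assms(3,4)] show ?thesis by simp
qed

text \<open>Isolates the clause of \<open>C2_vector_field\<close> that relates \<open>D\<close> to
  its derivative, because the operators \<open>Christoffel q (Z q)\<close> are to satisfy the same
  condition.\<close>

definition operator_derivative ::
    "fun_pair \<Rightarrow> (fun_pair \<Rightarrow> fun_pair \<Rightarrow> fun_pair) \<Rightarrow> (fun_pair \<Rightarrow> fun_pair \<Rightarrow> fun_pair) \<Rightarrow> bool" where
  "operator_derivative p D B \<longleftrightarrow> (\<forall>e>0. \<exists>d>0. \<forall>q\<in>G s. tn (q - p) < d \<longrightarrow>
     (\<forall>h\<in>T. tn (D q h - D p h - B (q - p) h) \<le> e * tn (q - p) * tn h))"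

definition second_diff :: "(fun_pair \<Rightarrow> real) \<Rightarrow> fun_pair \<Rightarrow> fun_pair \<Rightarrow> fun_pair \<Rightarrow> real" where
  "second_diff f p h k = f (p + h + k) - f (p + h) - f (p + k) + f p"

lemma second_diff_commute: "second_diff f p h k = second_diff f p k h"
  by (simp add: second_diff_def add_ac)

text \<open>The increment in direction \<open>k\<close> is regarded as a function along
  \<open>h\<close>. The mean value theorem turns its change into a difference of first derivatives,
  which is \<open>t * ev (B k h)\<close> up to \<open>e * t\<close>.\<close>

lemma second_difference:
  assumes p: "p \<in> G s" and Z: "\<And>q. q \<in> G s \<Longrightarrow> Z q \<in> T"
    and D: "\<And>q. q \<in> G s \<Longrightarrow> frechet Z (D q) q"
    and B: "tangent_bounded_bilinear s B"
    and D2: "operator_derivative p D B"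
    and ev: "bounded_functional ev" and h: "h \<in> T" and k: "k \<in> T" and e: "e > 0"
  shows "\<exists>r>0. \<forall>t. 0 < t \<and> t < r \<longrightarrow>
    \<bar>second_diff (ev \<circ> Z) p (t *\<^sub>R h) (t *\<^sub>R k) - t\<^sup>2 * ev (B k h)\<bar> \<le> e * t\<^sup>2"
proof -
  obtain K where K: "K > 0" "\<forall>U\<in>T. \<bar>ev U\<bar> \<le> K * tn U"
    using ev by (auto simp: bounded_functional_def)
  have ev_diff: "ev (U - V) = ev U - ev V" if "U \<in> T" "V \<in> T" for U V
    using ev that by (simp add: bounded_functional_def)
  have ev_scale: "ev (c *\<^sub>R U) = c * ev U" if "U \<in> T" for c U
    using ev that by (simp add: bounded_functional_def)
  have B_add: "B (U + V) h = B U h + B V h" and B_scale: "B (c *\<^sub>R U) h = c *\<^sub>R B U h" and BT: "B U h \<in> T"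
    if "U \<in> T" "V \<in> T" for U V c
    using B that h by (auto simp: tangent_bounded_bilinear_def tangent_linear_def)
  define a where "a = tn h + tn k + 1"
  have a: "a > 0" "tn h \<le> a" "tn h + tn k \<le> a" using tn_nonneg[of h] tn_nonneg[of k] unfolding a_def by linarith+
  \<comment> \<open>Each of two comparisons with the derivative at \<open>p\<close> costs
    \<open>K * (e' * (t * a) * a)\<close>, hence the 2 in the denominator.\<close>
  define e' where "e' = e / (2 * K * a * a)"
  have "e' > 0" using e K a by (simp add: e'_def)
  obtain d where d: "d > 0" "\<forall>q\<in>G s. tn (q - p) < d \<longrightarrow> (\<forall>h\<in>T. tn (D q h - D p h - B (q - p) h) \<le> e' * tn (q - p) * tn h)"
    using D2 \<open>e' > 0\<close> unfolding operator_derivative_def by blast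
  obtain \<delta> where \<delta>: "\<delta> > 0" "\<forall>h\<in>T. tn h < \<delta> \<longrightarrow> p + h \<in> G s"
    using G_open[OF p] by blast
  define r where "r = min d \<delta> / a"
  have "r > 0" using d \<delta> a by (simp add: r_def)
  have main: "\<bar>second_diff (ev \<circ> Z) p (t *\<^sub>R h) (t *\<^sub>R k) - t\<^sup>2 * ev (B k h)\<bar> \<le> e * t\<^sup>2" if t: "0 < t" "t < r" for t
  proof -
    have ta: "t * a < min d \<delta>" using t a(1) by (simp add: r_def field_simps)
    have vec: "x *\<^sub>R h + y *\<^sub>R k \<in> T" "tn (x *\<^sub>R h + y *\<^sub>R k) \<le> t * a" "p + (x *\<^sub>R h + y *\<^sub>R k) \<in> G s"
      if "0 \<le> x" "x \<le> t" "0 \<le> y" "y \<le> t" for x y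
    proof -
      show mem: "x *\<^sub>R h + y *\<^sub>R k \<in> T" by (intro tangent_add tangent_scaleR h k)
      have "tn (x *\<^sub>R h + y *\<^sub>R k) \<le> tn (x *\<^sub>R h) + tn (y *\<^sub>R k)"
        by (intro tn_triangle tangent_scaleR h k)
      also have "\<dots> \<le> x * tn h + y * tn k"
        using tn_scaleR[OF h, of x] tn_scaleR[OF k, of y] that by simp
      also have "\<dots> \<le> t * tn h + t * tn k"
        using that by (intro add_mono mult_right_mono) auto
      also have "\<dots> \<le> t * a"
        using mult_left_mono[OF a(3), of t] t by (simp add: distrib_left)
      finally show "tn (x *\<^sub>R h + y *\<^sub>R k) \<le> t * a" .
      then show "p + (x *\<^sub>R h + y *\<^sub>R k) \<in> G s" using \<delta>(2) mem ta by auto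
    qed
    have tk: "t *\<^sub>R k + x *\<^sub>R h = x *\<^sub>R h + t *\<^sub>R k" for x by simp
    define f where "f = (\<lambda>x. ev (Z (p + t *\<^sub>R k + x *\<^sub>R h)) - ev (Z (p + x *\<^sub>R h)))"
    define f' where "f' = (\<lambda>x. ev (D (p + t *\<^sub>R k + x *\<^sub>R h) h) - ev (D (p + x *\<^sub>R h) h))"
    have G1: "p + t *\<^sub>R k + x *\<^sub>R h \<in> G s" and G2: "p + x *\<^sub>R h \<in> G s" if "0 \<le> x" "x \<le> t" for x
      using vec(3)[of x t] vec(3)[of x 0] that t by (simp_all add: add.assoc add.commute[of "t *\<^sub>R k"])
    have deriv: "(f has_real_derivative f' x) (at x)" if "0 \<le> x" "x \<le> t" for x
      unfolding f_def f'_def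
      by (intro DERIV_diff line_derivative[OF _ Z h _ ev] D G1 G2 that)
    obtain z where z: "0 < z" "z < t" "f t - f 0 = (t - 0) * f' z"
      using MVT2[OF t(1) deriv] by auto
    have err: "\<bar>ev (D (p + w) h) - ev (D p h) - ev (B w h)\<bar> \<le> K * (e' * (t * a) * a)"
      if w: "w \<in> T" "tn w \<le> t * a" "p + w \<in> G s" for w
    proof -
      have mem: "D (p + w) h \<in> T" "D p h \<in> T" "B w h \<in> T"
        using frechet_derivD(1)[OF D[OF w(3)] h] frechet_derivD(1)[OF D[OF p] h] BT[OF w(1) w(1)] by auto
      have "\<bar>ev (D (p + w) h - D p h - B w h)\<bar> \<le> K * tn (D (p + w) h - D p h - B w h)"
        using K(2) mem by (auto intro!: tangent_diff)
      also have "\<dots> \<le> K * (e' * tn w * tn h)"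
        using d(2)[rule_format, OF w(3) _ h] w(2) ta K(1) by (intro mult_left_mono) auto
      also have "\<dots> \<le> K * (e' * (t * a) * a)"
        using K(1) \<open>e' > 0\<close> w(2) a t(1) by (intro mult_left_mono mult_mono) auto
      finally show ?thesis by (simp add: ev_diff mem tangent_diff)
    qed
    \<comment> \<open>The derivative of \<open>D\<close> is given at \<open>p\<close> alone, so the
      two intermediate points are each compared with \<open>p\<close> and not with each
      other.\<close>
    define w1 w2 where "w1 = z *\<^sub>R h + t *\<^sub>R k" and "w2 = z *\<^sub>R h"
    have w1: "w1 \<in> T" "tn w1 \<le> t * a" "p + w1 \<in> G s"
      using vec[of z t] z t by (auto simp: w1_def)
    have w2: "w2 \<in> T" "tn w2 \<le> t * a" "p + w2 \<in> G s"
      using vec[of z 0] z t by (auto simp: w2_def)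
    have "w1 - w2 = t *\<^sub>R k" by (simp add: w1_def w2_def)
    have "B w1 h = B w2 h + t *\<^sub>R B k h"
      unfolding w1_def w2_def using B_add[OF tangent_scaleR[OF h] tangent_scaleR[OF k]] B_scale[OF k k] by simp
    then have "B w1 h - B w2 h = t *\<^sub>R B k h" by simp
    then have evB: "ev (B w1 h) - ev (B w2 h) = t * ev (B k h)"
      using ev_diff[OF BT[OF w1(1) w1(1)] BT[OF w2(1) w2(1)]] ev_scale[OF BT[OF k k]] by metis
    have f'z: "f' z = ev (D (p + w1) h) - ev (D (p + w2) h)"
      by (simp add: f'_def w1_def w2_def add.assoc add.commute[of "t *\<^sub>R k"])
    have "\<bar>f' z - t * ev (B k h)\<bar> \<le> 2 * (K * (e' * (t * a) * a))"
      using err[OF w1] err[OF w2] evB unfolding f'z by linarith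
    also have "\<dots> = e * t" using K(1) a(1) by (simp add: e'_def)
    finally have "t * \<bar>f' z - t * ev (B k h)\<bar> \<le> t * (e * t)"
      using t by (intro mult_left_mono) auto
    then have "\<bar>t * f' z - t * (t * ev (B k h))\<bar> \<le> e * t\<^sup>2"
      using t by (simp add: abs_mult power2_eq_square flip: right_diff_distrib)
    moreover have "f t - f 0 = second_diff (ev \<circ> Z) p (t *\<^sub>R h) (t *\<^sub>R k)"
      by (simp add: f_def second_diff_def add.assoc add.commute[of "t *\<^sub>R k"])
    ultimately show ?thesis using z(3) by (simp add: power2_eq_square mult.assoc)
  qed
  show ?thesis using \<open>r > 0\<close> main by blast
qed

text \<open>The second difference is symmetric in its two directions, so after division by
  \<open>t\<^sup>2\<close> both \<open>ev (B h k)\<close> and \<open>ev (B k h)\<close> lie within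
  \<open>e / 2\<close> of the same number.\<close>

lemma second_derivative_symmetric:
  assumes p: "p \<in> G s" and Z: "\<And>q. q \<in> G s \<Longrightarrow> Z q \<in> T"
    and D: "\<And>q. q \<in> G s \<Longrightarrow> frechet Z (D q) q"
    and B: "tangent_bounded_bilinear s B"
    and D2: "operator_derivative p D B"
    and h: "h \<in> T" and k: "k \<in> T"
  shows "B h k = B k h"
proof -
  have *: "ev (B h k) = ev (B k h)" if ev: "bounded_functional ev" for ev
  proof -
    have "\<bar>ev (B h k) - ev (B k h)\<bar> \<le> 0 + e" if "e > 0" for e
    proof -
      have half: "e / 2 > 0" using that by simp
      obtain r where r: "r > 0" "\<forall>t. 0 < t \<and> t < r \<longrightarrow>
          \<bar>second_diff (ev \<circ> Z) p (t *\<^sub>R h) (t *\<^sub>R k) - t\<^sup>2 * ev (B k h)\<bar> \<le> e / 2 * t\<^sup>2"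
        using second_difference[OF p Z D B D2 ev h k half] by blast
      obtain r' where r': "r' > 0" "\<forall>t. 0 < t \<and> t < r' \<longrightarrow>
          \<bar>second_diff (ev \<circ> Z) p (t *\<^sub>R k) (t *\<^sub>R h) - t\<^sup>2 * ev (B h k)\<bar> \<le> e / 2 * t\<^sup>2"
        using second_difference[OF p Z D B D2 ev k h half] by blast
      define t where "t = min r r' / 2"
      have t: "0 < t" "t < r" "t < r'" using r r' by (auto simp: t_def min_def)
      define \<Delta> where "\<Delta> = second_diff (ev \<circ> Z) p (t *\<^sub>R h) (t *\<^sub>R k)"
      have "\<bar>\<Delta> - t\<^sup>2 * ev (B k h)\<bar> \<le> e / 2 * t\<^sup>2"
        unfolding \<Delta>_def using r(2) t by blast
      moreover have "\<bar>\<Delta> - t\<^sup>2 * ev (B h k)\<bar> \<le> e / 2 * t\<^sup>2"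
        unfolding \<Delta>_def second_diff_commute[of _ p "t *\<^sub>R h"] using r'(2) t by blast
      ultimately have "\<bar>t\<^sup>2 * ev (B h k) - t\<^sup>2 * ev (B k h)\<bar> \<le> e * t\<^sup>2"
        by linarith
      moreover have "t\<^sup>2 * \<bar>ev (B h k) - ev (B k h)\<bar> = \<bar>t\<^sup>2 * ev (B h k) - t\<^sup>2 * ev (B k h)\<bar>"
        by (simp add: abs_mult flip: right_diff_distrib)
      ultimately have "t\<^sup>2 * \<bar>ev (B h k) - ev (B k h)\<bar> \<le> t\<^sup>2 * e" by (simp add: mult.commute)
      then show ?thesis using t by simp
    qed
    then have "\<bar>ev (B h k) - ev (B k h)\<bar> \<le> 0" by (rule field_le_epsilon)
    then show ?thesis by simp
  qed
  show ?thesis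
    by (rule bounded_functional_ext)
       (use B h k * in \<open>auto simp: tangent_bounded_bilinear_def tangent_linear_def\<close>)
qed

section \<open>The Christoffel map and its derivative\<close>

text \<open>Four times the integrand of the metric. The reciprocal is kept as a separate factor so
  that membership in \<open>A\<close> and norm bounds follow from the rules for products.\<close>

definition metric_density :: "fun_pair \<Rightarrow> fun_pair \<Rightarrow> fun_pair \<Rightarrow> real \<Rightarrow> real" where
  "metric_density p U V = (\<lambda>x. dfst U x * dfst V x * (1 / dfst p x) - snd U x * snd V x * dfst p x)"

definition gamma1 :: "fun_pair \<Rightarrow> fun_pair \<Rightarrow> fun_pair \<Rightarrow> real \<Rightarrow> real" where
  "gamma1 p U V = (\<lambda>x. 1/2 * (metric_density p U V x - dfst p x * mean (metric_density p U V)))"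

definition gamma2 :: "fun_pair \<Rightarrow> fun_pair \<Rightarrow> fun_pair \<Rightarrow> real \<Rightarrow> real" where
  "gamma2 p U V = (\<lambda>x. (-1/2) * ((dfst U x * snd V x + dfst V x * snd U x) * (1 / dfst p x)))"

lemma G_metric_conv_mean: "G_metric p U V = 1/4 * mean (metric_density p U V)"
  by (simp add: G_metric_def mean_def metric_density_def)

lemma A_recip: "p \<in> G s \<Longrightarrow> (\<lambda>x. 1 / dfst p x) \<in> A"
  by (intro A_inverse GD GD')

lemma A_metric_density: "p \<in> G s \<Longrightarrow> U \<in> T \<Longrightarrow> V \<in> T \<Longrightarrow> metric_density p U V \<in> A"
  unfolding metric_density_def by (intro A_intros tangentD A_recip GD)

lemma A_gamma: "p \<in> G s \<Longrightarrow> U \<in> T \<Longrightarrow> V \<in> T \<Longrightarrow> gamma1 p U V \<in> A"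
  "p \<in> G s \<Longrightarrow> U \<in> T \<Longrightarrow> V \<in> T \<Longrightarrow> gamma2 p U V \<in> A"
  unfolding gamma1_def gamma2_def by (intro A_intros A_metric_density tangentD A_recip GD; assumption)+

text \<open>The subtracted multiple of \<open>dfst p\<close> has the same mean as the density
  because \<open>dfst p\<close> has mean 1.\<close>

lemma mean_gamma1:
  assumes "p \<in> G s" "U \<in> T" "V \<in> T"
  shows "mean (gamma1 p U V) = 0"
proof -
  have "mean (\<lambda>x. metric_density p U V x - mean (metric_density p U V) * dfst p x) = 0"
    by (subst mean_diff[OF A_metric_density[OF assms] A_mult[OF A_const GD(2)[OF assms(1)]]])
       (simp add: mean_cmult[OF GD(2)[OF assms(1)]] GD(7)[OF assms(1)])
  then show ?thesis
    unfolding gamma1_def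
    by (subst mean_cmult) (auto intro!: A_intros A_metric_density assms GD simp: mult.commute)
qed

lemma inverse_G:
  assumes p: "p \<in> G s"
  shows "inv (fst p) (fst p x) = x" "fst p (inv (fst p) y) = y"
    "(inv (fst p) has_real_derivative 1 / dfst p (inv (fst p) y)) (at y)"
proof -
  have bij: "bij (fst p)" by (rule GD(8)[OF p])
  show 1: "inv (fst p) (fst p x) = x" for x
    using bij by (simp add: bij_def)
  show 2: "fst p (inv (fst p) y) = y"
    using bij by (simp add: bij_def surj_f_inv_f)
  have "inv (fst p) differentiable (at y)"
    using p by (auto simp: G_def Diff0_def differentiable_on_def)
  then obtain c where c: "(inv (fst p) has_real_derivative c) (at y)"
    using real_differentiable_def by blast
  define x where "x = inv (fst p) y"
  have "(inv (fst p) has_real_derivative c) (at (fst p x))"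
    using c 2 by (simp add: x_def)
  from DERIV_chain[OF this GD(1)[OF p]] have "((\<lambda>x. x) has_real_derivative c * dfst p x) (at x)"
    by (simp add: o_def 1)
  then have "c * dfst p x = 1"
    using DERIV_unique[OF DERIV_ident] by metis
  then have "c = 1 / dfst p x" using GD'[OF p, of x] by (simp add: field_simps)
  then show "(inv (fst p) has_real_derivative 1 / dfst p (inv (fst p) y)) (at y)"
    using c by (simp add: x_def)
qed

lemma interval_integral_primitive:
  fixes F f :: "real \<Rightarrow> real"
  assumes "continuous_on UNIV f" "\<And>x. (F has_real_derivative f x) (at x)"
  shows "(LBINT y=0..ereal x. f y) = F x - F 0"
  unfolding zero_ereal_def
  by (rule interval_integral_FTC_finite)
     (auto intro: continuous_on_subset[OF assms(1)] has_vector_derivative_at_within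
       assms(2)[unfolded has_real_derivative_iff_has_vector_derivative])

text \<open>Integrating the derivative returns \<open>H\<close> up to the constant
  \<open>H 0\<close>, and the linear functions which this constant contributes to the two terms of
  \<open>A_inv\<close> cancel.\<close>

lemma A_inv_deriv:
  assumes H: "\<And>x. (H has_real_derivative H' x) (at x)" "continuous_on UNIV H'"
  shows "A_inv (deriv H) x = - (LBINT y=0..ereal x. H y) + x * (LBINT y=0..1. H y)"
proof -
  have contH: "continuous_on UNIV H"
    using H(1) by (meson DERIV_isCont continuous_at_imp_continuous_on)
  have "deriv H = H'" using DERIV_imp_deriv[OF H(1)] by auto
  then have 1: "(LBINT z=0..ereal y. deriv H z) = H y - H 0" for y
    using interval_integral_primitive[OF H(2,1)] by simp
  define P where "P = (\<lambda>x. LBINT y=0..ereal x. H y)"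
  have P: "(P has_real_derivative H x) (at x)" for x
    unfolding P_def has_real_derivative_iff_has_vector_derivative
    by (rule interval_integral_has_vector_derivative[OF contH])
  have P0: "P 0 = 0" by (simp add: P_def flip: zero_ereal_def)
  have 2: "(LBINT y=0..ereal x. H y - H 0) = P x - x * H 0" for x
  proof -
    have "((\<lambda>x. P x - x * H 0) has_real_derivative H x - H 0) (at x)" for x
      using P by (auto intro!: derivative_eq_intros)
    from interval_integral_primitive[OF _ this] show ?thesis
      using contH P0 by (simp add: continuous_on_diff)
  qed
  show ?thesis
    using 2[of x] 2[of 1] P0
    by (simp add: A_inv_def 1 P_def[symmetric] one_ereal_def[symmetric])
       (simp add: P_def algebra_simps flip: one_ereal_def)
qed

text \<open>The chain rule makes \<open>P \<circ> fst p\<close> a primitive of the density: it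
  supplies the factor \<open>dfst p\<close> that turns \<open>g0\<close> into
  \<open>metric_density p U V\<close>. The minus sign in front of the double integral in
  \<open>A_inv\<close> cancels that of the factor -1/2.\<close>

lemma Christoffel_eq:
  assumes p: "p \<in> G s" and U: "U \<in> T" and V: "V \<in> T"
  shows "Christoffel p U V = primitive_pair (gamma1 p U V) (gamma2 p U V)"
proof -
  define \<psi> where "\<psi> = inv (fst p)"
  note \<psi> = inverse_G[OF p, folded \<psi>_def]
  have cont\<psi>: "continuous_on UNIV \<psi>"
    using \<psi>(3) by (meson DERIV_isCont continuous_at_imp_continuous_on)
  have dcomp: "deriv (fst W \<circ> \<psi>) y = dfst W (\<psi> y) * (1 / dfst p (\<psi> y))" if "W \<in> T" for W y
    by (rule DERIV_imp_deriv[OF DERIV_chain[OF tangentD(1)[OF that] \<psi>(3)]])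
  \<comment> \<open>The function under the derivative, written before composition with
    \<open>\<psi>\<close>. It lies in \<open>A\<close> and is therefore continuously differentiable,
    which makes \<open>H\<close> differentiable as \<open>A_inv_deriv\<close> requires.\<close>
  define g0 where "g0 = (\<lambda>x. (dfst U x * (1 / dfst p x)) * (dfst V x * (1 / dfst p x)) - snd U x * snd V x)"
  have g0: "g0 \<in> A" unfolding g0_def by (intro A_intros tangentD U V A_recip p)
  define H where "H = (\<lambda>y. g0 (\<psi> y))"
  define H' where "H' = (\<lambda>y. deriv g0 (\<psi> y) * (1 / dfst p (\<psi> y)))"
  have H: "(H has_real_derivative H' y) (at y)" for y
    using DERIV_chain[OF A_has_derivative(1)[OF g0] \<psi>(3)] by (simp add: H_def H'_def o_def)
  have contH: "continuous_on UNIV H"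
    using H by (meson DERIV_isCont continuous_at_imp_continuous_on)
  have contH': "continuous_on UNIV H'"
    unfolding H'_def
    by (intro continuous_intros continuous_on_compose2[OF A_has_derivative(2)[OF g0] cont\<psi>]
        continuous_on_compose2[OF A_continuous[OF A_recip[OF p]] cont\<psi>, simplified]) auto
  define P where "P = (\<lambda>x. LBINT y=0..ereal x. H y)"
  have P: "(P has_real_derivative H x) (at x)" for x
    unfolding P_def has_real_derivative_iff_has_vector_derivative
    by (rule interval_integral_has_vector_derivative[OF contH])
  have g: "g0 x * dfst p x = metric_density p U V x" for x
    using GD'[OF p, of x] by (simp add: g0_def metric_density_def field_simps)
  have P\<phi>: "((\<lambda>x. P (fst p x)) has_real_derivative metric_density p U V x) (at x)" for x
    using DERIV_chain[OF P GD(1)[OF p], of x] by (simp add: o_def H_def \<psi>(1) g)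
  have P0: "P (fst p 0) = 0" by (simp add: P_def GD(4)[OF p] flip: zero_ereal_def)
  have "mean (metric_density p U V) = P (fst p 1)"
    using interval_integral_primitive[OF A_continuous[OF A_metric_density[OF p U V]] P\<phi>, of 1] P0
    by (simp add: mean_def flip: one_ereal_def)
  moreover have "fst p 1 = 1" using GD(5)[OF p, of 0] GD(4)[OF p] by simp
  ultimately have P1: "P 1 = mean (metric_density p U V)" by simp
  have A_inv: "A_inv (deriv H) x = - P x + x * P 1" for x
    using A_inv_deriv[OF H contH', of x] by (simp add: P_def flip: one_ereal_def)
  have HH: "(\<lambda>y. deriv (fst (right_compose U \<psi>)) y * deriv (fst (right_compose V \<psi>)) y
      - snd (right_compose U \<psi>) y * snd (right_compose V \<psi>) y) = H"
    by (simp add: right_compose_def dcomp U V H_def g0_def fun_eq_iff)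
  have C: "Christoffel p U V = (\<lambda>x. 1/2 * (P (fst p x) - fst p x * mean (metric_density p U V)), gamma2 p U V)"
  proof (rule prod_eqI; rule ext; unfold fst_conv snd_conv)
    fix x
    have "fst (Christoffel p U V) x = - (1/2) * A_inv (deriv H) (fst p x)"
      unfolding Christoffel_def \<psi>_def[symmetric] Christoffel_id_def HH by (simp add: right_compose_def)
    then show "fst (Christoffel p U V) x = 1/2 * (P (fst p x) - fst p x * mean (metric_density p U V))"
      by (simp add: A_inv P1 field_simps)
    show "snd (Christoffel p U V) x = gamma2 p U V x"
      unfolding Christoffel_def \<psi>_def[symmetric] Christoffel_id_def
      by (simp add: right_compose_def dcomp U V \<psi>(1) gamma2_def add_divide_distrib)
  qed
  have "((\<lambda>x. 1/2 * (P (fst p x) - fst p x * mean (metric_density p U V)))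
      has_real_derivative gamma1 p U V x) (at x)" for x
    unfolding gamma1_def by (intro DERIV_cmult DERIV_diff P\<phi> DERIV_cmult_right GD(1)[OF p])
  from interval_integral_primitive[OF A_continuous[OF A_gamma(1)[OF p U V]] this]
  have "(LBINT y=0..ereal x. gamma1 p U V y) = 1/2 * (P (fst p x) - fst p x * mean (metric_density p U V))" for x
    by (simp add: P0[unfolded GD(4)[OF p]] GD(4)[OF p])
  then show ?thesis by (simp only: C primitive_pair_def)
qed

lemma Christoffel:
  assumes "p \<in> G s" "U \<in> T" "V \<in> T"
  shows "Christoffel p U V \<in> T" "dfst (Christoffel p U V) = gamma1 p U V" "snd (Christoffel p U V) = gamma2 p U V"
  using primitive_pair(1-3)[OF A_gamma[OF assms] mean_gamma1[OF assms]]
  by (simp_all add: Christoffel_eq[OF assms])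

text \<open>Formal derivative of \<open>metric_density\<close> in \<open>dfst p\<close>: the factor
  \<open>1 / f\<close> contributes \<open>- h' / f\<^sup>2\<close> and the factor \<open>f\<close>
  contributes \<open>h'\<close>. The error made is estimated in
  \<open>Christoffel_remainder\<close>.\<close>

definition density_deriv :: "fun_pair \<Rightarrow> fun_pair \<Rightarrow> fun_pair \<Rightarrow> fun_pair \<Rightarrow> real \<Rightarrow> real" where
  "density_deriv p h U V = (\<lambda>x. - (dfst U x * dfst V x * dfst h x * ((1 / dfst p x) * (1 / dfst p x))
     + snd U x * snd V x * dfst h x))"

definition gamma1_deriv :: "fun_pair \<Rightarrow> fun_pair \<Rightarrow> fun_pair \<Rightarrow> fun_pair \<Rightarrow> real \<Rightarrow> real" where
  "gamma1_deriv p h U V = (\<lambda>x. 1/2 * (density_deriv p h U V x -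
     (dfst h x * mean (metric_density p U V) + dfst p x * mean (density_deriv p h U V))))"

definition gamma2_deriv :: "fun_pair \<Rightarrow> fun_pair \<Rightarrow> fun_pair \<Rightarrow> fun_pair \<Rightarrow> real \<Rightarrow> real" where
  "gamma2_deriv p h U V = (\<lambda>x. 1/2 * ((dfst U x * snd V x + dfst V x * snd U x) * dfst h x
     * ((1 / dfst p x) * (1 / dfst p x))))"

definition dGamma :: "fun_pair \<Rightarrow> fun_pair \<Rightarrow> fun_pair \<Rightarrow> fun_pair \<Rightarrow> fun_pair" where
  "dGamma p h U V = primitive_pair (gamma1_deriv p h U V) (gamma2_deriv p h U V)"

lemma A_density_deriv: "p \<in> G s \<Longrightarrow> h \<in> T \<Longrightarrow> U \<in> T \<Longrightarrow> V \<in> T \<Longrightarrow> density_deriv p h U V \<in> A"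
  unfolding density_deriv_def by (intro A_intros tangentD A_recip GD)

lemma A_gamma_deriv: "p \<in> G s \<Longrightarrow> h \<in> T \<Longrightarrow> U \<in> T \<Longrightarrow> V \<in> T \<Longrightarrow> gamma1_deriv p h U V \<in> A"
  "p \<in> G s \<Longrightarrow> h \<in> T \<Longrightarrow> U \<in> T \<Longrightarrow> V \<in> T \<Longrightarrow> gamma2_deriv p h U V \<in> A"
  unfolding gamma1_deriv_def gamma2_deriv_def
  by (intro A_intros A_metric_density A_density_deriv tangentD A_recip GD; assumption)+

lemma mean_gamma1_deriv:
  assumes "p \<in> G s" "h \<in> T" "U \<in> T" "V \<in> T"
  shows "mean (gamma1_deriv p h U V) = 0"
proof -
  note D = A_density_deriv[OF assms] and h = tangentD(2)[OF assms(2)] and p = GD(2)[OF assms(1)]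
  define c d where "c = mean (metric_density p U V)" and "d = mean (density_deriv p h U V)"
  have 1: "gamma1_deriv p h U V = (\<lambda>x. 1/2 * (density_deriv p h U V x - (c * dfst h x + d * dfst p x)))"
    by (simp add: gamma1_deriv_def c_def d_def mult.commute)
  have 2: "mean (\<lambda>x. 1/2 * (density_deriv p h U V x - (c * dfst h x + d * dfst p x)))
      = 1/2 * (d - (c * mean (dfst h) + d * mean (dfst p)))"
    by (simp only: mean_cmult mean_diff mean_add A_intros D h p d_def)
  show ?thesis unfolding 1 2 by (simp add: mean_dfst[OF assms(2)] GD(7)[OF assms(1)])
qed

lemma dGamma:
  assumes "p \<in> G s" "h \<in> T" "U \<in> T" "V \<in> T"
  shows "dGamma p h U V \<in> T" "dfst (dGamma p h U V) = gamma1_deriv p h U V"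
    "snd (dGamma p h U V) = gamma2_deriv p h U V"
  using primitive_pair(1-3)[OF A_gamma_deriv[OF assms] mean_gamma1_deriv[OF assms]]
  by (simp_all add: dGamma_def)

text \<open>These would rewrite \<open>dfst (U + V)\<close> before \<open>dfst_add\<close> applies.\<close>

declare fst_add [simp del] snd_add [simp del] fst_diff [simp del] snd_diff [simp del]
  fst_scaleR [simp del] snd_scaleR [simp del]

lemma metric_density_commute: "metric_density p U V = metric_density p V U"
  by (simp add: metric_density_def mult_ac)

lemma metric_density_add:
  "U \<in> T \<Longrightarrow> U' \<in> T \<Longrightarrow> V \<in> T \<Longrightarrow>
    metric_density p (U + U') V = (\<lambda>x. metric_density p U V x + metric_density p U' V x)"
  by (auto simp: metric_density_def dfst_add algebra_simps fun_eq_iff)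

lemma metric_density_scaleR:
  "U \<in> T \<Longrightarrow> V \<in> T \<Longrightarrow> metric_density p (c *\<^sub>R U) V = (\<lambda>x. c * metric_density p U V x)"
  by (auto simp: metric_density_def dfst_scaleR algebra_simps fun_eq_iff)

lemma Christoffel_commute:
  assumes "p \<in> G s" "U \<in> T" "V \<in> T"
  shows "Christoffel p U V = Christoffel p V U"
  by (rule tangent_eqI)
     (simp_all add: Christoffel assms gamma1_def gamma2_def metric_density_commute[of p U V] algebra_simps)

lemma Christoffel_add:
  assumes "p \<in> G s" "U \<in> T" "U' \<in> T" "V \<in> T"
  shows "Christoffel p (U + U') V = Christoffel p U V + Christoffel p U' V"
  by (rule tangent_eqI)
     (simp_all add: Christoffel assms tangent_add dfst_add gamma1_def gamma2_def metric_density_add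
       mean_add A_metric_density algebra_simps add_divide_distrib diff_divide_distrib)

lemma Christoffel_scaleR:
  assumes "p \<in> G s" "U \<in> T" "V \<in> T"
  shows "Christoffel p (c *\<^sub>R U) V = c *\<^sub>R Christoffel p U V"
  by (rule tangent_eqI)
     (simp_all add: Christoffel assms tangent_scaleR dfst_scaleR gamma1_def gamma2_def metric_density_scaleR
       mean_cmult A_metric_density algebra_simps add_divide_distrib diff_divide_distrib)

lemma Christoffel_diff:
  assumes "p \<in> G s" "U \<in> T" "U' \<in> T" "V \<in> T"
  shows "Christoffel p (U - U') V = Christoffel p U V - Christoffel p U' V"
  using Christoffel_add[OF assms(1,2) tangent_scaleR[OF assms(3)] assms(4), of "-1"]
    Christoffel_scaleR[OF assms(1,3,4), of "-1"] by simp

lemma density_deriv_commute: "density_deriv p h U V = density_deriv p h V U"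
  by (simp add: density_deriv_def mult_ac)

lemma density_deriv_add:
  "U \<in> T \<Longrightarrow> U' \<in> T \<Longrightarrow> V \<in> T \<Longrightarrow>
    density_deriv p h (U + U') V = (\<lambda>x. density_deriv p h U V x + density_deriv p h U' V x)"
  by (auto simp: density_deriv_def dfst_add algebra_simps fun_eq_iff add_divide_distrib)

lemma density_deriv_scaleR:
  "U \<in> T \<Longrightarrow> V \<in> T \<Longrightarrow> density_deriv p h (c *\<^sub>R U) V = (\<lambda>x. c * density_deriv p h U V x)"
  by (auto simp: density_deriv_def dfst_scaleR algebra_simps fun_eq_iff)

lemma density_deriv_add_dir:
  "h \<in> T \<Longrightarrow> h' \<in> T \<Longrightarrow>
    density_deriv p (h + h') U V = (\<lambda>x. density_deriv p h U V x + density_deriv p h' U V x)"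
  by (auto simp: density_deriv_def dfst_add algebra_simps fun_eq_iff add_divide_distrib)

lemma density_deriv_scaleR_dir:
  "h \<in> T \<Longrightarrow> density_deriv p (c *\<^sub>R h) U V = (\<lambda>x. c * density_deriv p h U V x)"
  by (auto simp: density_deriv_def dfst_scaleR algebra_simps fun_eq_iff)

lemma dGamma_commute:
  assumes "p \<in> G s" "h \<in> T" "U \<in> T" "V \<in> T"
  shows "dGamma p h U V = dGamma p h V U"
  by (rule tangent_eqI)
     (simp_all add: dGamma assms gamma1_deriv_def gamma2_deriv_def metric_density_commute[of p U V]
       density_deriv_commute[of p h U V] algebra_simps)

lemma dGamma_add:
  assumes "p \<in> G s" "h \<in> T" "U \<in> T" "U' \<in> T" "V \<in> T"
  shows "dGamma p h (U + U') V = dGamma p h U V + dGamma p h U' V"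
  by (rule tangent_eqI)
     (simp_all add: dGamma assms tangent_add dfst_add gamma1_deriv_def gamma2_deriv_def
       metric_density_add density_deriv_add mean_add A_metric_density A_density_deriv
       algebra_simps add_divide_distrib diff_divide_distrib)

lemma dGamma_scaleR:
  assumes "p \<in> G s" "h \<in> T" "U \<in> T" "V \<in> T"
  shows "dGamma p h (c *\<^sub>R U) V = c *\<^sub>R dGamma p h U V"
  by (rule tangent_eqI)
     (simp_all add: dGamma assms tangent_scaleR dfst_scaleR gamma1_deriv_def gamma2_deriv_def
       metric_density_scaleR density_deriv_scaleR mean_cmult A_metric_density A_density_deriv
       algebra_simps add_divide_distrib diff_divide_distrib)

lemma dGamma_diff:
  assumes "p \<in> G s" "h \<in> T" "U \<in> T" "U' \<in> T" "V \<in> T"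
  shows "dGamma p h (U - U') V = dGamma p h U V - dGamma p h U' V"
  using dGamma_add[OF assms(1-3) tangent_scaleR[OF assms(4)] assms(5), of "-1"]
    dGamma_scaleR[OF assms(1,2,4,5), of "-1"] by simp

lemma dGamma_add_dir:
  assumes "p \<in> G s" "h \<in> T" "h' \<in> T" "U \<in> T" "V \<in> T"
  shows "dGamma p (h + h') U V = dGamma p h U V + dGamma p h' U V"
  by (rule tangent_eqI)
     (simp_all add: dGamma assms tangent_add dfst_add gamma1_deriv_def gamma2_deriv_def
       density_deriv_add_dir mean_add A_metric_density A_density_deriv
       algebra_simps add_divide_distrib diff_divide_distrib)

lemma dGamma_scaleR_dir:
  assumes "p \<in> G s" "h \<in> T" "U \<in> T" "V \<in> T"
  shows "dGamma p (c *\<^sub>R h) U V = c *\<^sub>R dGamma p h U V"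
  by (rule tangent_eqI)
     (simp_all add: dGamma assms tangent_scaleR dfst_scaleR gamma1_deriv_def gamma2_deriv_def
       density_deriv_scaleR_dir mean_cmult A_metric_density A_density_deriv
       algebra_simps add_divide_distrib diff_divide_distrib)

section \<open>Estimates in the rescaled algebra norm\<close>

definition bnd :: "(real \<Rightarrow> real) \<Rightarrow> real \<Rightarrow> bool" where
  "bnd a \<alpha> \<longleftrightarrow> a \<in> A \<and> M a \<le> \<alpha>"

lemma bnd_mult: "bnd a \<alpha> \<Longrightarrow> bnd b \<beta> \<Longrightarrow> bnd (\<lambda>x. a x * b x) (\<alpha> * \<beta>)"
  unfolding bnd_def using order_trans[OF M_mult mult_mono, of a b \<alpha> \<beta>] M_nonneg[of a] M_nonneg[of b]
  by (auto intro: A_mult simp del: M_nonneg)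

lemma bnd_add: "bnd a \<alpha> \<Longrightarrow> bnd b \<beta> \<Longrightarrow> bnd (\<lambda>x. a x + b x) (\<alpha> + \<beta>)"
  unfolding bnd_def using order_trans[OF M_add add_mono, of a b \<alpha> \<beta>] by (auto intro: A_add)

lemma bnd_diff: "bnd a \<alpha> \<Longrightarrow> bnd b \<beta> \<Longrightarrow> bnd (\<lambda>x. a x - b x) (\<alpha> + \<beta>)"
  unfolding bnd_def using order_trans[OF M_diff add_mono, of a b \<alpha> \<beta>] by (auto intro: A_diff)

lemma bnd_cmult: "bnd a \<alpha> \<Longrightarrow> bnd (\<lambda>x. c * a x) (\<bar>c\<bar> * \<alpha>)"
  unfolding bnd_def using order_trans[OF M_cmult mult_left_mono, of a \<alpha> c] by (auto intro: A_mult A_const)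

lemma bnd_minus: "bnd a \<alpha> \<Longrightarrow> bnd (\<lambda>x. - a x) \<alpha>"
  using bnd_cmult[of a \<alpha> "-1"] by simp

lemma bnd_mean:
  assumes "bnd a \<alpha>" "bnd g \<gamma>"
  shows "bnd (\<lambda>x. a x * mean g) (\<alpha> * \<gamma>)"
proof -
  have "\<bar>mean g\<bar> \<le> \<gamma>"
    using assms(2) abs_mean_le[of g] by (auto simp: bnd_def)
  moreover have "\<alpha> \<ge> 0" using assms(1) order_trans[OF M_nonneg] unfolding bnd_def by blast
  ultimately have "\<bar>mean g\<bar> * \<alpha> \<le> \<alpha> * \<gamma>"
    by (simp add: mult.commute[of _ \<alpha>] mult_left_mono)
  then show ?thesis
    using bnd_cmult[OF assms(1), of "mean g"] by (auto simp: bnd_def mult.commute)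
qed

lemma bnd_weaken: "bnd a \<alpha> \<Longrightarrow> \<alpha> \<le> \<beta> \<Longrightarrow> bnd a \<beta>"
  by (auto simp: bnd_def)

text \<open>A bound has the same syntactic shape as the function it belongs to, so repeated
  resolution verifies it. The order matters: \<open>bnd_mult\<close> also matches scalar factors and
  means and would leave bounds on constant functions to prove, so \<open>bnd_cmult\<close> and
  \<open>bnd_mean\<close> are tried before it.\<close>

lemmas bnd_rules = bnd_cmult bnd_mean bnd_diff bnd_add bnd_minus bnd_mult

lemma tn_le_bnd:
  "U \<in> T \<Longrightarrow> bnd (dfst U) \<alpha> \<Longrightarrow> bnd (snd U) \<beta> \<Longrightarrow> tn U \<le> (1 + 2 / alg_const) * (\<alpha> + \<beta>)"
  using alg_const(1) by (intro order_trans[OF tn_le_M] mult_left_mono) (auto simp: bnd_def)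

lemma tangent_bnd:
  obtains C where "C > 0" "\<And>U. U \<in> T \<Longrightarrow> bnd (dfst U) (C * tn U)" "\<And>U. U \<in> T \<Longrightarrow> bnd (snd U) (C * tn U)"
proof -
  obtain C where C: "C > 0" "\<And>U. U \<in> T \<Longrightarrow> M (dfst U) \<le> C * tn U" "\<And>U. U \<in> T \<Longrightarrow> M (snd U) \<le> C * tn U"
    using M_le_tn by blast
  show ?thesis
    by (rule that[OF C(1)]) (auto simp: bnd_def C tangentD)
qed

text \<open>\<open>R\<close> is made strictly positive because the radius in
  \<open>Christoffel_remainder\<close> divides by it.\<close>

lemma G_bnd:
  assumes "p \<in> G s"
  obtains F R where "F \<ge> 0" "R > 0" "bnd (dfst p) F" "bnd (\<lambda>x. 1 / dfst p x) R"
proof (rule that[of "M (dfst p)" "M (\<lambda>x. 1 / dfst p x) + 1"])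
  show "M (\<lambda>x. 1 / dfst p x) + 1 > 0" by (rule add_nonneg_pos[OF M_nonneg zero_less_one])
qed (simp_all add: bnd_def GD(2) A_recip assms)

lemma Christoffel_bounded:
  assumes p: "p \<in> G s"
  shows "\<exists>K\<ge>0. \<forall>U\<in>T. \<forall>V\<in>T. tn (Christoffel p U V) \<le> K * tn U * tn V"
proof -
  obtain C where C: "C > 0" "\<And>U. U \<in> T \<Longrightarrow> bnd (dfst U) (C * tn U)" "\<And>U. U \<in> T \<Longrightarrow> bnd (snd U) (C * tn U)"
    using tangent_bnd by blast
  obtain F R where FR: "F \<ge> 0" "R > 0" and bF: "bnd (dfst p) F" and bR: "bnd (\<lambda>x. 1 / dfst p x) R"
    by (rule G_bnd[OF p])
  define K0 where "K0 = 1 + 2 / alg_const"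
  have "K0 \<ge> 0" using alg_const(1) by (simp add: K0_def)
  \<comment> \<open>Read off from the bounds \<open>1\<close> and \<open>2\<close> below after
    extracting \<open>u * v\<close>; \<open>K0\<close> is the constant of
    \<open>tn_le_bnd\<close>.\<close>
  define K where "K = K0 * (C * C * (1/2 * ((R + F) * (1 + F)) + R))"
  have "K \<ge> 0" using \<open>K0 \<ge> 0\<close> C(1) FR by (simp add: K_def)
  moreover have "tn (Christoffel p U V) \<le> K * tn U * tn V" if U: "U \<in> T" and V: "V \<in> T" for U V
  proof -
    define u v where "u = C * tn U" and "v = C * tn V"
    note b = C(2,3)[OF U, folded u_def] C(2,3)[OF V, folded v_def] bF bR
    have m: "bnd (metric_density p U V) (u * v * R + u * v * F)"
      unfolding metric_density_def by (rule b bnd_rules)+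
    have 1: "bnd (gamma1 p U V) (\<bar>1/2\<bar> * ((u * v * R + u * v * F) + F * (u * v * R + u * v * F)))"
      unfolding gamma1_def by (rule b m bnd_rules)+
    have 2: "bnd (gamma2 p U V) (\<bar>-1/2\<bar> * ((u * v + v * u) * R))"
      unfolding gamma2_def by (rule b bnd_rules)+
    from tn_le_bnd[OF Christoffel(1)[OF p U V], unfolded Christoffel(2,3)[OF p U V], OF 1 2, folded K0_def]
    show ?thesis by (simp add: K_def u_def v_def algebra_simps)
  qed
  ultimately show ?thesis by blast
qed

lemma dGamma_bounded:
  assumes p: "p \<in> G s"
  shows "\<exists>K\<ge>0. \<forall>h\<in>T. \<forall>U\<in>T. \<forall>V\<in>T. tn (dGamma p h U V) \<le> K * tn h * tn U * tn V"
proof -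
  obtain C where C: "C > 0" "\<And>U. U \<in> T \<Longrightarrow> bnd (dfst U) (C * tn U)" "\<And>U. U \<in> T \<Longrightarrow> bnd (snd U) (C * tn U)"
    using tangent_bnd by blast
  obtain F R where FR: "F \<ge> 0" "R > 0" and bF: "bnd (dfst p) F" and bR: "bnd (\<lambda>x. 1 / dfst p x) R"
    by (rule G_bnd[OF p])
  define K0 where "K0 = 1 + 2 / alg_const"
  have "K0 \<ge> 0" using alg_const(1) by (simp add: K0_def)
  define K where "K = K0 * (C * C * C * (1/2 * ((R * R + 1) * (1 + F) + (R + F)) + R * R))"
  have "K \<ge> 0" using \<open>K0 \<ge> 0\<close> C(1) FR by (simp add: K_def)
  moreover have "tn (dGamma p h U V) \<le> K * tn h * tn U * tn V" if h: "h \<in> T" and U: "U \<in> T" and V: "V \<in> T" for h U V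
  proof -
    define \<kappa> u v where "\<kappa> = C * tn h" and "u = C * tn U" and "v = C * tn V"
    note b = C(2,3)[OF U, folded u_def] C(2,3)[OF V, folded v_def] C(2,3)[OF h, folded \<kappa>_def] bF bR
    have m: "bnd (metric_density p U V) (u * v * R + u * v * F)"
      unfolding metric_density_def by (rule b bnd_rules)+
    have d: "bnd (density_deriv p h U V) (u * v * \<kappa> * (R * R) + u * v * \<kappa>)"
      unfolding density_deriv_def by (rule b bnd_rules)+
    have 1: "bnd (gamma1_deriv p h U V) (\<bar>1/2\<bar> * ((u * v * \<kappa> * (R * R) + u * v * \<kappa>)
        + (\<kappa> * (u * v * R + u * v * F) + F * (u * v * \<kappa> * (R * R) + u * v * \<kappa>))))"
      unfolding gamma1_deriv_def by (rule b m d bnd_rules)+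
    have 2: "bnd (gamma2_deriv p h U V) (\<bar>1/2\<bar> * ((u * v + v * u) * \<kappa> * (R * R)))"
      unfolding gamma2_deriv_def by (rule b bnd_rules)+
    from tn_le_bnd[OF dGamma(1)[OF p h U V], unfolded dGamma(2,3)[OF p h U V], OF 1 2, folded K0_def]
    show ?thesis by (simp add: K_def u_def v_def \<kappa>_def algebra_simps)
  qed
  ultimately show ?thesis by blast
qed

text \<open>Absorption: \<open>1 / dfst q\<close> differs from \<open>1 / dfst p\<close> by a
  product containing itself and the small increment, so its norm \<open>m\<close> satisfies
  \<open>m \<le> R + m / 2\<close>. As \<open>1 / dfst q\<close> is known to lie in
  \<open>A\<close>, \<open>m\<close> is a genuine norm and can be absorbed.\<close>

lemma recip_bound:
  assumes p: "p \<in> G s" and q: "q \<in> G s" and R: "bnd (\<lambda>x. 1 / dfst p x) R"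
    and k: "bnd (dfst (q - p)) \<kappa>" and small: "R * \<kappa> \<le> 1/2"
  shows "bnd (\<lambda>x. 1 / dfst q x) (2 * R)"
proof -
  have eq: "(\<lambda>x. 1 / dfst q x) = (\<lambda>x. 1 / dfst p x - (1 / dfst p x) * dfst (q - p) x * (1 / dfst q x))"
  proof
    fix x
    show "1 / dfst q x = 1 / dfst p x - (1 / dfst p x) * dfst (q - p) x * (1 / dfst q x)"
      using GD'[OF p, of x] GD'[OF q, of x] by (simp add: G_diff_tangent(2)[OF p q] field_simps)
  qed
  define m where "m = M (\<lambda>x. 1 / dfst q x)"
  have b: "bnd (\<lambda>x. 1 / dfst q x) m"
    by (auto simp: bnd_def m_def A_recip[OF q])
  have "bnd (\<lambda>x. 1 / dfst p x - (1 / dfst p x) * dfst (q - p) x * (1 / dfst q x)) (R + R * \<kappa> * m)"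
    by (rule R k b bnd_rules)+
  then have "m \<le> R + R * \<kappa> * m"
    unfolding eq[symmetric] by (simp add: bnd_def m_def)
  moreover have "R * \<kappa> * m \<le> 1/2 * m"
    using small by (intro mult_right_mono) (auto simp: m_def)
  ultimately have "m \<le> 2 * R" by linarith
  then show ?thesis by (rule bnd_weaken[OF b])
qed

text \<open>An expansion of \<open>1 / dfst q\<close> around \<open>1 / dfst p\<close> with exact
  remainder leaves only terms containing two factors from the increment \<open>h\<close>. The
  constants depend on \<open>p\<close> alone, which makes the estimate uniform in \<open>U\<close>
  and \<open>V\<close>.\<close>

lemma Christoffel_remainder:
  assumes p: "p \<in> G s"
  shows "\<exists>K\<ge>0. \<exists>d>0. \<forall>q\<in>G s. tn (q - p) < d \<longrightarrow> (\<forall>U\<in>T. \<forall>V\<in>T.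
    tn (Christoffel q U V - Christoffel p U V - dGamma p (q - p) U V) \<le> K * (tn (q - p))\<^sup>2 * tn U * tn V)"
proof -
  obtain C where C: "C > 0" "\<And>U. U \<in> T \<Longrightarrow> bnd (dfst U) (C * tn U)" "\<And>U. U \<in> T \<Longrightarrow> bnd (snd U) (C * tn U)"
    using tangent_bnd by blast
  obtain F R where FR: "F \<ge> 0" "R > 0" and bF: "bnd (dfst p) F" and bR: "bnd (\<lambda>x. 1 / dfst p x) R"
    by (rule G_bnd[OF p])
  define K0 where "K0 = 1 + 2 / alg_const"
  have "K0 \<ge> 0" using alg_const(1) by (simp add: K0_def)
  define K where "K = K0 * (C * C * C * C * (1/2 * (2 * R^3 + (R * R + 1) + (F + C) * (2 * R^3)) + 2 * R^3))"
  have "K \<ge> 0" using \<open>K0 \<ge> 0\<close> C(1) FR by (simp add: K_def)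
  \<comment> \<open>The bound 1 gives \<open>\<kappa> \<le> C\<close> and so controls
    \<open>dfst q\<close> by \<open>F + C\<close>; the other bound gives
    \<open>R * \<kappa> \<le> 1/2\<close>, the smallness required by
    \<open>recip_bound\<close>.\<close>
  define d where "d = min 1 (1 / (2 * C * R))"
  have "d > 0" using C(1) FR by (simp add: d_def)
  have main: "tn (Christoffel q U V - Christoffel p U V - dGamma p (q - p) U V) \<le> K * (tn (q - p))\<^sup>2 * tn U * tn V"
    if q: "q \<in> G s" and small: "tn (q - p) < d" and U: "U \<in> T" and V: "V \<in> T" for q U V
  proof -
    define h where "h = q - p"
    have h: "h \<in> T" unfolding h_def by (rule G_diff_tangent(1)[OF p q])
    define \<kappa> u v where "\<kappa> = C * tn h" and "u = C * tn U" and "v = C * tn V"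
    have \<kappa>: "\<kappa> \<ge> 0" "u \<ge> 0" "v \<ge> 0" using C(1) by (auto simp: \<kappa>_def u_def v_def)
    have "tn h \<le> 1" using small by (simp add: h_def d_def)
    then have "\<kappa> \<le> C" using C(1) by (simp add: \<kappa>_def)
    have "tn h \<le> 1 / (2 * C * R)" using small by (simp add: h_def d_def)
    then have "R * \<kappa> \<le> 1/2" using C(1) FR by (simp add: \<kappa>_def field_simps)
    note b = C(2,3)[OF U, folded u_def] C(2,3)[OF V, folded v_def] C(2,3)[OF h, folded \<kappa>_def] bF bR
    have bRq: "bnd (\<lambda>x. 1 / dfst q x) (2 * R)"
      by (rule recip_bound[OF p q bR b(5)[unfolded h_def] \<open>R * \<kappa> \<le> 1/2\<close>])
    have fq: "dfst q x = dfst p x + dfst h x" for x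
      by (simp add: h_def G_diff_tangent(2)[OF p q])
    have "bnd (dfst q) (F + C)"
    proof -
      have "bnd (\<lambda>x. dfst p x + dfst h x) (F + \<kappa>)" by (rule b bnd_rules)+
      then have "bnd (dfst q) (F + \<kappa>)" by (simp add: fq[abs_def])
      then show ?thesis by (rule bnd_weaken) (use \<open>\<kappa> \<le> C\<close> in simp)
    qed
    note b = b bRq this
    define \<rho> where "\<rho> = (\<lambda>x. dfst U x * dfst V x * (dfst h x * dfst h x) * ((1 / dfst p x) * (1 / dfst p x)) * (1 / dfst q x))"
    have b\<rho>: "bnd \<rho> (u * v * (\<kappa> * \<kappa>) * (R * R) * (2 * R))"
      unfolding \<rho>_def by (rule b bnd_rules)+
    have bd: "bnd (density_deriv p h U V) (u * v * \<kappa> * (R * R) + u * v * \<kappa>)"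
      unfolding density_deriv_def by (rule b bnd_rules)+
    \<comment> \<open>The identity \<open>y = r - r * k * y\<close> inserted once into
      itself.\<close>
    have recip: "1 / dfst q x = 1 / dfst p x - dfst h x * ((1 / dfst p x) * (1 / dfst p x))
        + (dfst h x * dfst h x) * ((1 / dfst p x) * (1 / dfst p x)) * (1 / dfst q x)" for x
    proof -
      define y r k where "y = 1 / dfst q x" and "r = 1 / dfst p x" and "k = dfst h x"
      have y: "y = r - r * k * y"
      proof -
        have "y * (dfst p x + k) = 1" "r * dfst p x = 1"
          using GD'[OF p, of x] GD'[OF q, of x] by (simp_all add: y_def r_def k_def flip: fq)
        then show ?thesis by algebra
      qed
      have "r - k * (r * r) + k * k * (r * r) * y = r - r * k * (r - r * k * y)"
        by (simp add: algebra_simps)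
      also have "\<dots> = y" unfolding y[symmetric] ..
      finally show ?thesis by (simp only: y_def r_def k_def)
    qed
    have mq: "metric_density q U V x = metric_density p U V x + density_deriv p h U V x + \<rho> x" for x
    proof -
      have "metric_density q U V x = dfst U x * dfst V x * (1 / dfst q x) - snd U x * snd V x * (dfst p x + dfst h x)"
        by (simp add: metric_density_def fq)
      also have "\<dots> = metric_density p U V x + density_deriv p h U V x + \<rho> x"
        by (subst recip) (simp only: metric_density_def density_deriv_def \<rho>_def algebra_simps)
      finally show ?thesis .
    qed
    have mean: "mean (metric_density q U V)
        = mean (metric_density p U V) + mean (density_deriv p h U V) + mean \<rho>"
      using b\<rho> by (simp add: mq[abs_def] mean_add A_add A_metric_density A_density_deriv p h U V bnd_def)
    define W where "W = Christoffel q U V - Christoffel p U V - dGamma p h U V"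
    have W: "W \<in> T"
      unfolding W_def by (intro tangent_diff Christoffel dGamma p q h U V)
    \<comment> \<open>In the product of \<open>dfst q\<close> with the mean of the new density, the
      cross term of \<open>dfst h\<close> with the mean of \<open>density_deriv\<close> is not part
      of the linearisation; it is quadratic, as both factors contain \<open>h\<close>.\<close>
    have W1: "dfst W x = 1/2 * (\<rho> x - (dfst h x * mean (density_deriv p h U V) + dfst q x * mean \<rho>))" for x
    proof -
      have "dfst W x = gamma1 q U V x - gamma1 p U V x - gamma1_deriv p h U V x"
        by (simp add: W_def dfst_diff tangent_diff Christoffel dGamma p q h U V)
      also have "\<dots> = 1/2 * (\<rho> x - (dfst h x * mean (density_deriv p h U V) + dfst q x * mean \<rho>))"
        unfolding gamma1_def gamma1_deriv_def mean fq by (simp add: mq field_simps)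
      finally show ?thesis .
    qed
    have W2: "snd W x = (-1/2) * ((dfst U x * snd V x + dfst V x * snd U x) * (dfst h x * dfst h x)
        * ((1 / dfst p x) * (1 / dfst p x)) * (1 / dfst q x))" for x
    proof -
      have "snd W x = gamma2 q U V x - gamma2 p U V x - gamma2_deriv p h U V x"
        by (simp add: W_def Christoffel dGamma p q h U V)
      also have "\<dots> = (-1/2) * ((dfst U x * snd V x + dfst V x * snd U x) *
          (1 / dfst q x - 1 / dfst p x + dfst h x * ((1 / dfst p x) * (1 / dfst p x))))"
      proof -
        have "(-1/2) * (X * y) - (-1/2) * (X * r) - 1/2 * (X * k * (r * r)) = (-1/2) * (X * (y - r + k * (r * r)))"
          for X y r k :: real
          by (simp add: algebra_simps)
        then show ?thesis unfolding gamma2_def gamma2_deriv_def .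
      qed
      also have "1 / dfst q x - 1 / dfst p x + dfst h x * ((1 / dfst p x) * (1 / dfst p x))
          = (dfst h x * dfst h x) * ((1 / dfst p x) * (1 / dfst p x)) * (1 / dfst q x)"
        by (subst recip) simp
      finally show ?thesis
        by (simp only: mult.assoc)
    qed
    have 1: "bnd (dfst W) (\<bar>1/2\<bar> * (u * v * (\<kappa> * \<kappa>) * (R * R) * (2 * R)
        + (\<kappa> * (u * v * \<kappa> * (R * R) + u * v * \<kappa>) + (F + C) * (u * v * (\<kappa> * \<kappa>) * (R * R) * (2 * R)))))"
      unfolding W1[abs_def] by (rule b b\<rho> bd bnd_rules)+
    have 2: "bnd (snd W) (\<bar>-1/2\<bar> * ((u * v + v * u) * (\<kappa> * \<kappa>) * (R * R) * (2 * R)))"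
      unfolding W2[abs_def] by (rule b bnd_rules)+
    have "tn W \<le> K * (tn h)\<^sup>2 * tn U * tn V"
      using tn_le_bnd[OF W 1 2, folded K0_def]
      by (simp add: K_def u_def v_def \<kappa>_def algebra_simps power2_eq_square power3_eq_cube)
    then show ?thesis by (simp add: W_def h_def)
  qed
  show ?thesis
    using \<open>K \<ge> 0\<close> \<open>d > 0\<close> main by blast
qed

section \<open>Differentiation rules on the group\<close>

definition nbh :: "fun_pair \<Rightarrow> fun_pair filter" where
  "nbh p = (INF d\<in>{0<..}. principal {q \<in> G s. tn (q - p) < d})"

lemma eventually_nbh:
  "eventually P (nbh p) \<longleftrightarrow> (\<exists>d>0. \<forall>q\<in>G s. tn (q - p) < d \<longrightarrow> P q)"
proof -
  have "eventually P (nbh p) \<longleftrightarrow> (\<exists>d\<in>{0<..}. eventually P (principal {q \<in> G s. tn (q - p) < d}))"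
    unfolding nbh_def
  proof (rule eventually_INF_base)
    fix a b :: real assume "a \<in> {0<..}" "b \<in> {0<..}"
    then show "\<exists>x\<in>{0<..}. principal {q \<in> G s. tn (q - p) < x}
        \<le> inf (principal {q \<in> G s. tn (q - p) < a}) (principal {q \<in> G s. tn (q - p) < b})"
      by (intro bexI[of _ "min a b"]) auto
  qed auto
  then show ?thesis by (auto simp: eventually_principal)
qed

lemma eventually_nbh_G: "\<forall>\<^sub>F q in nbh p. q \<in> G s"
  unfolding eventually_nbh by (intro exI[of _ 1]) auto

lemma eventually_nbh_less: "e > 0 \<Longrightarrow> \<forall>\<^sub>F q in nbh p. tn (q - p) < e"
  unfolding eventually_nbh by (intro exI[of _ e]) auto

text \<open>Little-o of the distance to \<open>p\<close>. With a filter, several smallness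
  conditions are combined without choosing radii.\<close>

definition negligible_at :: "fun_pair \<Rightarrow> (fun_pair \<Rightarrow> fun_pair) \<Rightarrow> bool" where
  "negligible_at p R \<longleftrightarrow> (\<forall>e>0. \<forall>\<^sub>F q in nbh p. tn (R q) \<le> e * tn (q - p))"

lemma has_frechet_derivative_iff:
  "frechet F L p \<longleftrightarrow>
     tangent_bounded_linear s L \<and> negligible_at p (\<lambda>q. F q - F p - L (q - p))"
  by (simp add: has_frechet_derivative_def negligible_at_def eventually_nbh)

lemma negligible_at_bound:
  assumes R': "negligible_at p R'" and "\<forall>\<^sub>F q in nbh p. tn (R q) \<le> K * tn (R' q)" "K \<ge> 0"
  shows "negligible_at p R"
  unfolding negligible_at_def
proof (intro allI impI)
  fix e :: real assume "e > 0"
  then have "e / (K + 1) > 0" using assms(3) by simp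
  from R'[unfolded negligible_at_def, rule_format, OF this] assms(2)
  show "\<forall>\<^sub>F q in nbh p. tn (R q) \<le> e * tn (q - p)"
  proof eventually_elim
    case (elim q)
    have "tn (R q) \<le> (K + 1) * tn (R' q)"
      using elim(2) by (simp add: distrib_right add_increasing2)
    also have "\<dots> \<le> (K + 1) * (e / (K + 1) * tn (q - p))"
      using elim(1) assms(3) by (intro mult_left_mono) auto
    also have "\<dots> = e * tn (q - p)" using assms(3) by simp
    finally show ?case .
  qed
qed

lemma negligible_at_quadratic:
  assumes "\<forall>\<^sub>F q in nbh p. tn (R q) \<le> K * (tn (q - p))\<^sup>2" "K \<ge> 0"
  shows "negligible_at p R"
  unfolding negligible_at_def
proof (intro allI impI)
  fix e :: real assume "e > 0"
  then have "e / (K + 1) > 0" using assms(2) by simp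
  from eventually_nbh_less[OF this, of p] assms(1)
  show "\<forall>\<^sub>F q in nbh p. tn (R q) \<le> e * tn (q - p)"
  proof eventually_elim
    case (elim q)
    have "K * tn (q - p) \<le> (K + 1) * tn (q - p)" by (intro mult_right_mono) auto
    also have "\<dots> \<le> e" using elim(1) assms(2) by (simp add: field_simps)
    finally have "K * tn (q - p) * tn (q - p) \<le> e * tn (q - p)" by (intro mult_right_mono) auto
    then show ?case using elim(2) by (simp add: power2_eq_square mult.assoc)
  qed
qed

lemma negligible_at_add:
  assumes "negligible_at p R" "negligible_at p R'"
    and "\<And>q. q \<in> G s \<Longrightarrow> R q \<in> T" "\<And>q. q \<in> G s \<Longrightarrow> R' q \<in> T"
  shows "negligible_at p (\<lambda>q. R q + R' q)"
  unfolding negligible_at_def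
proof (intro allI impI)
  fix e :: real assume "e > 0"
  then have "e / 2 > 0" by simp
  from assms(1)[unfolded negligible_at_def, rule_format, OF this]
    assms(2)[unfolded negligible_at_def, rule_format, OF this] eventually_nbh_G[of p]
  show "\<forall>\<^sub>F q in nbh p. tn (R q + R' q) \<le> e * tn (q - p)"
  proof eventually_elim
    case (elim q)
    then show ?case
      using tn_triangle[OF assms(3,4)[OF elim(3)]] by linarith
  qed
qed

lemma negligible_at_cong:
  assumes "negligible_at p R" "\<And>q. q \<in> G s \<Longrightarrow> R q = R' q"
  shows "negligible_at p R'"
  unfolding negligible_at_def
proof (intro allI impI)
  fix e :: real assume "e > 0"
  from assms(1)[unfolded negligible_at_def, rule_format, OF this] eventually_nbh_G[of p]
  show "\<forall>\<^sub>F q in nbh p. tn (R' q) \<le> e * tn (q - p)"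
    by eventually_elim (simp add: assms(2))
qed

lemma tangent_bounded_linearI:
  assumes "\<And>h. h \<in> T \<Longrightarrow> L h \<in> T" "\<And>h k. h \<in> T \<Longrightarrow> k \<in> T \<Longrightarrow> L (h + k) = L h + L k"
    "\<And>c h. h \<in> T \<Longrightarrow> L (c *\<^sub>R h) = c *\<^sub>R L h" "\<And>h. h \<in> T \<Longrightarrow> tn (L h) \<le> C * tn h"
  shows "tangent_bounded_linear s L"
  using assms unfolding tangent_bounded_linear_def tangent_linear_def by blast

text \<open>The remainder estimate with tolerance 1 gives a Lipschitz bound at \<open>p\<close>, and
  this in turn bounds \<open>F\<close> within distance 1. Adding \<open>tn (F p)\<close> lets one
  constant serve for both.\<close>

lemma frechet_lipschitz:
  assumes p: "p \<in> G s" and F: "\<And>q. q \<in> G s \<Longrightarrow> F q \<in> T" and L: "frechet F L p"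
  obtains K where "K > 0" "\<forall>\<^sub>F q in nbh p. tn (F q - F p) \<le> K * tn (q - p)"
    "\<forall>\<^sub>F q in nbh p. tn (F q) \<le> K"
proof -
  obtain C where C: "C > 0" "\<forall>h\<in>T. tn (L h) \<le> C * tn h"
    using frechet_derivD(4)[OF L] by blast
  have "negligible_at p (\<lambda>q. F q - F p - L (q - p))"
    using L by (simp add: has_frechet_derivative_iff)
  from this[unfolded negligible_at_def, rule_format, OF zero_less_one]
  have "\<forall>\<^sub>F q in nbh p. tn (F q - F p - L (q - p)) \<le> 1 * tn (q - p)" .
  then have lip: "\<forall>\<^sub>F q in nbh p. tn (F q - F p) \<le> (C + 1) * tn (q - p)"
    using eventually_nbh_G[of p]
  proof eventually_elim
    case (elim q)
    have qp: "q - p \<in> T" by (rule G_diff_tangent(1)[OF p elim(2)])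
    have "tn (F q - F p) = tn ((F q - F p - L (q - p)) + L (q - p))" by simp
    also have "\<dots> \<le> tn (F q - F p - L (q - p)) + tn (L (q - p))"
      by (intro tn_triangle tangent_diff F elim p frechet_derivD(1)[OF L] qp)
    also have "\<dots> \<le> (C + 1) * tn (q - p)"
      using elim(1) C(2)[rule_format, OF qp] by (simp add: distrib_right)
    finally show ?case .
  qed
  define K where "K = (C + 1) + tn (F p)"
  have "C + 1 \<le> K" by (simp add: K_def)
  show ?thesis
  proof (rule that[of K])
    show "K > 0" using C(1) tn_nonneg[of "F p"] unfolding K_def by linarith
    show "\<forall>\<^sub>F q in nbh p. tn (F q - F p) \<le> K * tn (q - p)"
      using lip
    proof eventually_elim
      case (elim q)
      then show ?case using mult_right_mono[OF \<open>C + 1 \<le> K\<close> tn_nonneg[of "q - p"]] by linarith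
    qed
    show "\<forall>\<^sub>F q in nbh p. tn (F q) \<le> K"
      using lip eventually_nbh_less[of 1 p, OF zero_less_one] eventually_nbh_G[of p]
    proof eventually_elim
      case (elim q)
      have "tn (F q) = tn ((F q - F p) + F p)" by simp
      also have "\<dots> \<le> tn (F q - F p) + tn (F p)"
        by (intro tn_triangle tangent_diff F elim p)
      also have "tn (F q - F p) \<le> (C + 1) * 1"
        using elim(1) C(1) mult_left_mono[of "tn (q - p)" 1 "C + 1"] elim(2) by linarith
      finally show ?case by (simp add: K_def)
    qed
  qed
qed

lemma frechet_derivative_cong:
  assumes "p \<in> G s" "\<And>q. q \<in> G s \<Longrightarrow> F q = F' q" "frechet F L p"
  shows "frechet F' L p"
  using assms(3) unfolding has_frechet_derivative_iff
  by (auto intro: negligible_at_cong simp: assms(1,2))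

lemma frechet_derivative_diff:
  assumes p: "p \<in> G s" and F: "\<And>q. q \<in> G s \<Longrightarrow> F q \<in> T" "\<And>q. q \<in> G s \<Longrightarrow> F' q \<in> T"
    and L: "frechet F L p" and L': "frechet F' L' p"
  shows "frechet (\<lambda>q. F q - F' q) (\<lambda>h. L h - L' h) p"
  unfolding has_frechet_derivative_iff
proof
  obtain C where C: "C > 0" "\<forall>h\<in>T. tn (L h) \<le> C * tn h" using frechet_derivD(4)[OF L] by blast
  obtain C' where C': "C' > 0" "\<forall>h\<in>T. tn (L' h) \<le> C' * tn h" using frechet_derivD(4)[OF L'] by blast
  note l = frechet_derivD(1-3)[OF L] frechet_derivD(1-3)[OF L']
  show "tangent_bounded_linear s (\<lambda>h. L h - L' h)"
  proof (rule tangent_bounded_linearI[where C = "C + C'"])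
    fix h assume "h \<in> T"
    then show "tn (L h - L' h) \<le> (C + C') * tn h"
      using tn_diff[OF l(1,4), of h h] C(2) C'(2) by (fastforce simp: distrib_right)
  qed (simp_all add: l tangent_diff scaleR_diff_right)
  have N: "negligible_at p (\<lambda>q. F q - F p - L (q - p))" "negligible_at p (\<lambda>q. F' q - F' p - L' (q - p))"
    using L L' by (auto simp: has_frechet_derivative_iff)
  have mem: "F q - F p - L (q - p) \<in> T" "F' q - F' p - L' (q - p) \<in> T" if "q \<in> G s" for q
    using tangent_diff[OF tangent_diff[OF F(1)[OF that] F(1)[OF p]] l(1)[OF G_diff_tangent(1)[OF p that]]]
      tangent_diff[OF tangent_diff[OF F(2)[OF that] F(2)[OF p]] l(4)[OF G_diff_tangent(1)[OF p that]]]
    by auto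
  have "negligible_at p (\<lambda>q. (-1) *\<^sub>R (F' q - F' p - L' (q - p)))"
  proof (rule negligible_at_bound[OF N(2), where K = 1])
    show "\<forall>\<^sub>F q in nbh p. tn ((-1) *\<^sub>R (F' q - F' p - L' (q - p))) \<le> 1 * tn (F' q - F' p - L' (q - p))"
      using eventually_nbh_G[of p]
    proof eventually_elim
      case (elim q)
      show ?case using tn_scaleR[OF mem(2)[OF elim], of "-1"] by simp
    qed
  qed simp
  from negligible_at_add[OF N(1) this mem(1) tangent_scaleR[OF mem(2)]]
  show "negligible_at p (\<lambda>q. F q - F' q - (F p - F' p) - (L (q - p) - L' (q - p)))"
    by (rule negligible_at_cong) (auto simp: algebra_simps)
qed

text \<open>Product rule for an operator and a vector that both depend on \<open>q\<close>. It is
  applied to the derivative of \<open>Z\<close> and again to the operators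
  \<open>Christoffel q (Z q)\<close>, the two parts of a covariant derivative.\<close>

lemma frechet_derivative_apply:
  assumes p: "p \<in> G s" and D: "\<And>q. q \<in> G s \<Longrightarrow> tangent_bounded_linear s (D q)"
    and B: "tangent_bounded_bilinear s B"
    and D2: "operator_derivative p D B"
    and Y: "\<And>q. q \<in> G s \<Longrightarrow> Y q \<in> T" and L: "frechet Y L p"
  shows "frechet (\<lambda>q. D q (Y q)) (\<lambda>h. B h (Y p) + D p (L h)) p"
  unfolding has_frechet_derivative_iff
proof
  note Dl = tangent_bounded_linearD(1-3)[OF D] and Ll = frechet_derivD(1-3)[OF L]
  have Dd: "D q (h - k) = D q h - D q k" if "q \<in> G s" "h \<in> T" "k \<in> T" for q h k
    using Dl(2)[OF that(1,2) tangent_scaleR[OF that(3)], of "-1"] Dl(3)[OF that(1,3), of "-1"] by simp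
  obtain C where C: "C > 0" "\<forall>h\<in>T. tn (L h) \<le> C * tn h" using frechet_derivD(4)[OF L] by blast
  obtain C' where C': "C' > 0" "\<forall>h\<in>T. tn (D p h) \<le> C' * tn h" using tangent_bounded_linearD(4)[OF D[OF p]] by blast
  obtain K0 where K0: "\<forall>h\<in>T. \<forall>k\<in>T. tn (B h k) \<le> K0 * tn h * tn k"
    using B by (auto simp: tangent_bounded_bilinear_def)
  define K where "K = \<bar>K0\<bar>"
  have K: "K \<ge> 0" "tn (B h k) \<le> K * tn h * tn k" if "h \<in> T" "k \<in> T" for h k
  proof -
    have "K0 * (tn h * tn k) \<le> K * (tn h * tn k)" by (intro mult_right_mono) (auto simp: K_def)
    then show "tn (B h k) \<le> K * tn h * tn k" using K0 that by (force simp: mult.assoc)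
  qed (simp add: K_def)
  have BT: "B h k \<in> T" if "h \<in> T" "k \<in> T" for h k
    using B that by (auto simp: tangent_bounded_bilinear_def tangent_linear_def)
  have Bl: "B h k \<in> T" "B (h + h') k = B h k + B h' k" "B (c *\<^sub>R h) k = c *\<^sub>R B h k"
    "B h (k + k') = B h k + B h k'" "B h (c *\<^sub>R k) = c *\<^sub>R B h k"
    if "h \<in> T" "k \<in> T" "h' \<in> T" "k' \<in> T" for h k h' k' c
    using B that by (auto simp: tangent_bounded_bilinear_def tangent_linear_def)
  have Bd: "B h (k - k') = B h k - B h k'" if "h \<in> T" "k \<in> T" "k' \<in> T" for h k k'
    using Bl(4)[OF that(1,2,1) tangent_scaleR[OF that(3)], of "-1"] Bl(5)[OF that(1,3,1,3), of "-1"] by simp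
  show "tangent_bounded_linear s (\<lambda>h. B h (Y p) + D p (L h))"
  proof (rule tangent_bounded_linearI[where C = "K * tn (Y p) + C' * C"])
    fix h assume h: "h \<in> T"
    show "B h (Y p) + D p (L h) \<in> T" by (intro tangent_add BT Dl(1) Ll(1) Y p h)
    have "tn (B h (Y p) + D p (L h)) \<le> tn (B h (Y p)) + tn (D p (L h))"
      by (intro tn_triangle BT Dl(1) Ll(1) Y p h)
    also have "\<dots> \<le> K * tn h * tn (Y p) + C' * (C * tn h)"
      using C'(2)[rule_format, OF Ll(1)[OF h]] C(2)[rule_format, OF h] C'(1)
      by (intro add_mono K h Y p) (meson mult_left_mono order_trans less_imp_le)
    finally show "tn (B h (Y p) + D p (L h)) \<le> (K * tn (Y p) + C' * C) * tn h"
      by (simp add: algebra_simps)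
  next
    fix h k assume h: "h \<in> T" and k: "k \<in> T"
    show "B (h + k) (Y p) + D p (L (h + k)) = B h (Y p) + D p (L h) + (B k (Y p) + D p (L k))"
      using Bl(2)[OF h Y[OF p] k Y[OF p]] by (simp add: Dl Ll h k p)
  next
    fix c h assume h: "h \<in> T"
    show "B (c *\<^sub>R h) (Y p) + D p (L (c *\<^sub>R h)) = c *\<^sub>R (B h (Y p) + D p (L h))"
      using Bl(3)[OF h Y[OF p] h h] by (simp add: Dl Ll h p scaleR_add_right)
  qed
  obtain c where c: "c > 0" "\<forall>\<^sub>F q in nbh p. tn (Y q - Y p) \<le> c * tn (q - p)" "\<forall>\<^sub>F q in nbh p. tn (Y q) \<le> c"
    by (rule frechet_lipschitz[OF p Y L])
  have diff: "q - p \<in> T" if "q \<in> G s" for q using G_diff_tangent(1)[OF p that] .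
  \<comment> \<open>\<open>R1\<close> is the remainder of the operator applied to the bounded vector
    \<open>Y q\<close>; \<open>R2\<close> is quadratic since \<open>Y q - Y p\<close> is itself of
    first order; \<open>R3\<close> is the image of the remainder of \<open>Y\<close> under a fixed
    bounded operator.\<close>
  define R1 where "R1 = (\<lambda>q. D q (Y q) - D p (Y q) - B (q - p) (Y q))"
  define R2 where "R2 = (\<lambda>q. B (q - p) (Y q - Y p))"
  define R3 where "R3 = (\<lambda>q. D p (Y q - Y p - L (q - p)))"
  have RT: "R1 q \<in> T" "R2 q \<in> T" "R3 q \<in> T" if "q \<in> G s" for q
    unfolding R1_def R2_def R3_def
    using Y[OF that] Y[OF p] diff[OF that]
    by (simp_all add: tangent_diff BT Dl(1) Ll(1) p that)
  have N1: "negligible_at p R1"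
    unfolding negligible_at_def
  proof (intro allI impI)
    fix e :: real assume "e > 0"
    then have "e / c > 0" using c(1) by simp
    from D2[unfolded operator_derivative_def, rule_format, OF this]
    have "\<forall>\<^sub>F q in nbh p. \<forall>h\<in>T. tn (D q h - D p h - B (q - p) h) \<le> e / c * tn (q - p) * tn h"
      by (simp add: eventually_nbh)
    then show "\<forall>\<^sub>F q in nbh p. tn (R1 q) \<le> e * tn (q - p)"
      using c(3) eventually_nbh_G[of p]
    proof eventually_elim
      case (elim q)
      have "tn (R1 q) \<le> e / c * tn (q - p) * tn (Y q)"
        using elim(1) Y[OF elim(3)] by (simp add: R1_def)
      also have "\<dots> \<le> e / c * tn (q - p) * c"
        using elim(2) \<open>e > 0\<close> c(1) by (intro mult_left_mono) auto
      finally show ?case using c(1) by simp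
    qed
  qed
  have N2: "negligible_at p R2"
  proof (rule negligible_at_quadratic[where K = "K * c"])
    show "\<forall>\<^sub>F q in nbh p. tn (R2 q) \<le> K * c * (tn (q - p))\<^sup>2"
      using c(2) eventually_nbh_G[of p]
    proof eventually_elim
      case (elim q)
      have "tn (R2 q) \<le> K * tn (q - p) * tn (Y q - Y p)"
        unfolding R2_def by (intro K diff tangent_diff Y p elim)
      also have "\<dots> \<le> K * tn (q - p) * (c * tn (q - p))"
        using elim(1) by (intro mult_left_mono) (auto simp: K_def)
      finally show ?case by (simp add: power2_eq_square mult_ac)
    qed
  qed (use c(1) in \<open>simp add: K_def\<close>)
  have N3: "negligible_at p R3"
  proof (rule negligible_at_bound[where K = C'])
    show "negligible_at p (\<lambda>q. Y q - Y p - L (q - p))"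
      using L by (simp add: has_frechet_derivative_iff)
    show "\<forall>\<^sub>F q in nbh p. tn (R3 q) \<le> C' * tn (Y q - Y p - L (q - p))"
      using eventually_nbh_G[of p]
    proof eventually_elim
      case (elim q)
      have "Y q - Y p - L (q - p) \<in> T"
        by (intro tangent_diff Ll(1) Y p elim diff)
      then show ?case using C'(2) by (simp add: R3_def)
    qed
  qed (use C' in simp)
  have "negligible_at p (\<lambda>q. R1 q + R2 q + R3 q)"
    by (rule negligible_at_add[OF negligible_at_add[OF N1 N2 RT(1,2)] N3 tangent_add[OF RT(1,2)] RT(3)])
  then show "negligible_at p (\<lambda>q. D q (Y q) - D p (Y p) - (B (q - p) (Y p) + D p (L (q - p))))"
  proof (rule negligible_at_cong)
    fix q assume q: "q \<in> G s"
    have e1: "B (q - p) (Y q - Y p) = B (q - p) (Y q) - B (q - p) (Y p)"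
      by (intro Bd diff Y q p)
    have "D p (Y q - Y p - L (q - p)) = D p (Y q - Y p) - D p (L (q - p))"
      by (intro Dd p tangent_diff Y q Ll diff)
    then have e2: "D p (Y q - Y p - L (q - p)) = D p (Y q) - D p (Y p) - D p (L (q - p))"
      using Dd[OF p Y[OF q] Y[OF p]] by simp
    show "R1 q + R2 q + R3 q = D q (Y q) - D p (Y p) - (B (q - p) (Y p) + D p (L (q - p)))"
      unfolding R1_def R2_def R3_def e1 e2 by simp
  qed
qed

text \<open>The operators \<open>\<Gamma>\<^sub>q(Z q, \<cdot>)\<close> are differentiable in \<open>q\<close>; applying them to \<open>Y q\<close> is covered by
  \<open>frechet_derivative_apply\<close>.\<close>

lemma operator_derivative_Christoffel:
  assumes p: "p \<in> G s" and Z: "\<And>q. q \<in> G s \<Longrightarrow> Z q \<in> T" and L: "frechet Z L p"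
  shows "operator_derivative p (\<lambda>q. Christoffel q (Z q)) (\<lambda>h k. dGamma p h (Z p) k + Christoffel p (L h) k)"
  unfolding operator_derivative_def
proof (intro allI impI)
  fix e :: real assume "e > 0"
  obtain K where K: "K \<ge> 0" "\<forall>U\<in>T. \<forall>V\<in>T. tn (Christoffel p U V) \<le> K * tn U * tn V"
    using Christoffel_bounded[OF p] by blast
  obtain K' where K': "K' \<ge> 0" "\<forall>h\<in>T. \<forall>U\<in>T. \<forall>V\<in>T. tn (dGamma p h U V) \<le> K' * tn h * tn U * tn V"
    using dGamma_bounded[OF p] by blast
  obtain K'' where K'': "K'' \<ge> 0" "\<forall>\<^sub>F q in nbh p. \<forall>U\<in>T. \<forall>V\<in>T.
      tn (Christoffel q U V - Christoffel p U V - dGamma p (q - p) U V) \<le> K'' * (tn (q - p))\<^sup>2 * tn U * tn V"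
    using Christoffel_remainder[OF p] unfolding eventually_nbh by blast
  obtain c where c: "c > 0" "\<forall>\<^sub>F q in nbh p. tn (Z q - Z p) \<le> c * tn (q - p)" "\<forall>\<^sub>F q in nbh p. tn (Z q) \<le> c"
    by (rule frechet_lipschitz[OF p Z L])
  \<comment> \<open>\<open>a\<close> collects the coefficients of the quadratic errors, made small
    by the radius \<open>e1\<close>; \<open>b\<close> belongs to the remainder of \<open>Z\<close>,
    made small by the tolerance \<open>e2\<close>. Each group receives half of
    \<open>e\<close>.\<close>
  define a where "a = K'' * c + K' * c + 1"
  define b where "b = K + 1"
  define e1 e2 where "e1 = e / (2 * a)" and "e2 = e / (2 * b)"
  have pos: "K'' * c + K' * c \<ge> 0" "a > 0" "b > 0" using K K' K'' c(1) by (simp_all add: a_def b_def add_nonneg_pos)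
  then have e12: "e1 > 0" "e2 > 0" using \<open>e > 0\<close> K(1) by (simp_all add: e1_def e2_def)
  have "\<forall>\<^sub>F q in nbh p. tn (Z q - Z p - L (q - p)) \<le> e2 * tn (q - p)"
    using L e12 by (simp add: has_frechet_derivative_iff negligible_at_def)
  then have "\<forall>\<^sub>F q in nbh p. \<forall>k\<in>T. tn (Christoffel q (Z q) k - Christoffel p (Z p) k
      - (dGamma p (q - p) (Z p) k + Christoffel p (L (q - p)) k)) \<le> e * tn (q - p) * tn k"
    using K''(2) c(2,3) eventually_nbh_G[of p] eventually_nbh_less[OF e12(1), of p]
  proof eventually_elim
    case (elim q)
    define t where "t = tn (q - p)"
    have t: "t \<ge> 0" "t < e1" using elim(6) by (simp_all add: t_def)
    have h: "q - p \<in> T" by (rule G_diff_tangent(1)[OF p elim(5)])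
    note Zp = Z[OF p] and Zq = Z[OF elim(5)] and Lh = frechet_derivD(1)[OF L h]
    have dZ: "Z q - Z p \<in> T" "Z q - Z p - L (q - p) \<in> T"
      by (simp_all add: tangent_diff Zp Zq Lh)
    show ?case
    proof
      fix k assume k: "k \<in> T"
      \<comment> \<open>\<open>R1\<close> comes from moving the base point with \<open>Z q\<close>
        held fixed, \<open>R2\<close> from replacing \<open>Z q\<close> by \<open>Z p\<close> in the
        derivative term, \<open>R3\<close> from linearising \<open>Z\<close>. The first two are
        quadratic in \<open>t\<close>.\<close>
      define R1 where "R1 = Christoffel q (Z q) k - Christoffel p (Z q) k - dGamma p (q - p) (Z q) k"
      define R2 where "R2 = dGamma p (q - p) (Z q - Z p) k"
      define R3 where "R3 = Christoffel p (Z q - Z p - L (q - p)) k"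
      have RT: "R1 \<in> T" "R2 \<in> T" "R3 \<in> T"
        unfolding R1_def R2_def R3_def
        by (simp_all add: tangent_diff Christoffel(1) dGamma(1) p elim(5) h Zq dZ k)
      have "Christoffel q (Z q) k - Christoffel p (Z p) k
          - (dGamma p (q - p) (Z p) k + Christoffel p (L (q - p)) k) = R1 + R2 + R3"
        by (simp add: R1_def R2_def R3_def dGamma_diff[OF p h Zq Zp k]
            Christoffel_diff[OF p dZ(1) Lh k] Christoffel_diff[OF p Zq Zp k])
      moreover have "tn (R1 + R2 + R3) \<le> tn R1 + tn R2 + tn R3"
        using tn_triangle[OF tangent_add[OF RT(1,2)] RT(3)] tn_triangle[OF RT(1,2)] by linarith
      moreover have "tn R1 \<le> K'' * c * t * (t * tn k)"
      proof -
        have "tn R1 \<le> K'' * t\<^sup>2 * tn (Z q) * tn k"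
          using elim(2) Zq k by (simp add: R1_def t_def)
        also have "\<dots> \<le> K'' * t\<^sup>2 * c * tn k"
          using elim(4) K''(1) by (intro mult_right_mono mult_left_mono) auto
        finally show ?thesis by (simp add: power2_eq_square mult_ac)
      qed
      moreover have "tn R2 \<le> K' * c * t * (t * tn k)"
      proof -
        have "tn R2 \<le> K' * t * tn (Z q - Z p) * tn k"
          using K'(2) h dZ k by (simp add: R2_def t_def)
        also have "\<dots> \<le> K' * t * (c * t) * tn k"
          using elim(3) K'(1) t(1) by (intro mult_right_mono mult_left_mono) (auto simp: t_def)
        finally show ?thesis by (simp add: mult_ac)
      qed
      moreover have "tn R3 \<le> K * e2 * (t * tn k)"
      proof -
        have "tn R3 \<le> K * tn (Z q - Z p - L (q - p)) * tn k"
          using K(2) dZ k by (simp add: R3_def)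
        also have "\<dots> \<le> K * (e2 * t) * tn k"
          using elim(1) K(1) by (intro mult_right_mono mult_left_mono) (auto simp: t_def)
        finally show ?thesis by (simp add: mult_ac)
      qed
      moreover have "K'' * c * t * (t * tn k) + K' * c * t * (t * tn k) + K * e2 * (t * tn k) \<le> e * (t * tn k)"
      proof -
        have "(K'' * c + K' * c) * t \<le> a * e1"
          using pos t by (intro mult_mono) (auto simp: a_def)
        also have "\<dots> = e / 2" using pos by (simp add: e1_def)
        finally have "(K'' * c + K' * c) * t \<le> e / 2" .
        moreover have "K * e2 \<le> b * e2" using e12(2) by (intro mult_right_mono) (auto simp: b_def)
        moreover have "b * e2 = e / 2" using pos by (simp add: e2_def)
        ultimately have "(K'' * c + K' * c) * t + K * e2 \<le> e" by linarith
        from mult_right_mono[OF this, of "t * tn k"] t(1) show ?thesis by (simp add: algebra_simps)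
      qed
      ultimately show "tn (Christoffel q (Z q) k - Christoffel p (Z p) k
          - (dGamma p (q - p) (Z p) k + Christoffel p (L (q - p)) k)) \<le> e * tn (q - p) * tn k"
        unfolding t_def[symmetric] by (simp add: mult.assoc)
    qed
  qed
  then show "\<exists>d>0. \<forall>q\<in>G s. tn (q - p) < d \<longrightarrow> (\<forall>k\<in>T. tn (Christoffel q (Z q) k - Christoffel p (Z p) k
      - (dGamma p (q - p) (Z p) k + Christoffel p (L (q - p)) k)) \<le> e * tn (q - p) * tn k)"
    unfolding eventually_nbh .
qed

lemma Christoffel_bounded_linear:
  assumes "q \<in> G s" "U \<in> T"
  shows "tangent_bounded_linear s (Christoffel q U)"
proof -
  obtain K where K: "\<forall>U\<in>T. \<forall>V\<in>T. tn (Christoffel q U V) \<le> K * tn U * tn V"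
    using Christoffel_bounded[OF assms(1)] by blast
  show ?thesis
    by (rule tangent_bounded_linearI[where C = "K * tn U"])
       (use K assms in \<open>auto simp: Christoffel_commute[OF assms] Christoffel_add Christoffel_scaleR
          Christoffel(1) tangent_add tangent_scaleR\<close>)
qed

lemma frechet_derivative_Christoffel:
  assumes p: "p \<in> G s" and Z: "\<And>q. q \<in> G s \<Longrightarrow> Z q \<in> T" and Y: "\<And>q. q \<in> G s \<Longrightarrow> Y q \<in> T"
    and L: "frechet Z L p" and L': "frechet Y L' p"
  shows "frechet (\<lambda>q. Christoffel q (Z q) (Y q))
    (\<lambda>h. dGamma p h (Z p) (Y p) + Christoffel p (L h) (Y p) + Christoffel p (Z p) (L' h)) p"
proof (rule frechet_derivative_apply[OF p _ _ operator_derivative_Christoffel[OF p Z L] Y L'])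
  show "tangent_bounded_linear s (Christoffel q (Z q))" if "q \<in> G s" for q
    by (rule Christoffel_bounded_linear[OF that Z[OF that]])
  obtain C where C: "C > 0" "\<forall>h\<in>T. tn (L h) \<le> C * tn h" using frechet_derivD(4)[OF L] by blast
  obtain K where K: "K \<ge> 0" "\<forall>U\<in>T. \<forall>V\<in>T. tn (Christoffel p U V) \<le> K * tn U * tn V"
    using Christoffel_bounded[OF p] by blast
  obtain K' where K': "K' \<ge> 0" "\<forall>h\<in>T. \<forall>U\<in>T. \<forall>V\<in>T. tn (dGamma p h U V) \<le> K' * tn h * tn U * tn V"
    using dGamma_bounded[OF p] by blast
  note Zp = Z[OF p] and l = frechet_derivD(1-3)[OF L]
  show "tangent_bounded_bilinear s (\<lambda>h k. dGamma p h (Z p) k + Christoffel p (L h) k)"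
    unfolding tangent_bounded_bilinear_def tangent_linear_def
  proof (intro conjI ballI allI exI[of _ "K' * tn (Z p) + K * C"])
    fix h k assume h: "h \<in> T" and k: "k \<in> T"
    have "tn (dGamma p h (Z p) k + Christoffel p (L h) k) \<le> K' * tn h * tn (Z p) * tn k + K * tn (L h) * tn k"
      using K(2) K'(2) h k Zp l(1)[OF h]
      by (intro order_trans[OF tn_triangle] add_mono Christoffel(1) dGamma(1) p) auto
    also have "K * tn (L h) * tn k \<le> K * (C * tn h) * tn k"
      using C(2) h K(1) by (intro mult_right_mono mult_left_mono) auto
    finally show "tn (dGamma p h (Z p) k + Christoffel p (L h) k) \<le> (K' * tn (Z p) + K * C) * tn h * tn k"
      by (simp add: algebra_simps)
  qed (simp_all add: l p Zp tangent_add tangent_scaleR Christoffel(1) dGamma(1) scaleR_add_right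
      Christoffel_add Christoffel_scaleR dGamma_add_dir dGamma_scaleR_dir
      dGamma_commute[of p _ "Z p"] dGamma_add dGamma_scaleR
      Christoffel_commute[of p "L _"])
qed

section \<open>Curvature\<close>

lemma C2_vector_fieldE:
  assumes "C2_vector_field s X"
  obtains D B where "\<forall>q\<in>G s. X q \<in> T" "\<forall>q\<in>G s. frechet X (D q) q"
    "\<forall>q\<in>G s. tangent_bounded_bilinear s (B q)" "\<forall>q\<in>G s. operator_derivative q D (B q)"
  using assms unfolding C2_vector_field_def operator_derivative_def by blast

lemma covariant_deriv_eq:
  assumes "\<And>q. q \<in> G s \<Longrightarrow> Z q \<in> T" "q \<in> G s" "frechet Z D q" "Y q \<in> T"
  shows "covariant_deriv s Y Z q = D (Y q) - Christoffel q (Z q) (Y q)"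
  unfolding covariant_deriv_def by (simp add: frechet_deriv_eq[OF assms(2,1,3,4)])

lemma covariant_deriv_covariant_deriv:
  assumes p: "p \<in> G s" and Z: "\<And>q. q \<in> G s \<Longrightarrow> Z q \<in> T" and Y: "\<And>q. q \<in> G s \<Longrightarrow> Y q \<in> T"
    and D: "\<And>q. q \<in> G s \<Longrightarrow> frechet Z (D q) q"
    and B: "tangent_bounded_bilinear s B"
    and D2: "operator_derivative p D B"
    and L: "frechet Y L p" and X: "X p \<in> T"
  shows "covariant_deriv s X (covariant_deriv s Y Z) p =
     B (X p) (Y p) + D p (L (X p))
     - (dGamma p (X p) (Z p) (Y p) + Christoffel p (D p (X p)) (Y p) + Christoffel p (Z p) (L (X p)))
     - (Christoffel p (D p (Y p)) (X p) - Christoffel p (Christoffel p (Z p) (Y p)) (X p))"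
proof -
  \<comment> \<open>An expression for the inner covariant derivative on all of \<open>G s\<close>
    that is free of the choice in \<open>frechet_deriv\<close>, so that the differentiation rules
    apply to it.\<close>
  define W where "W = (\<lambda>q. D q (Y q) - Christoffel q (Z q) (Y q))"
  have mem: "D q (Y q) \<in> T" "Christoffel q (Z q) (Y q) \<in> T" if "q \<in> G s" for q
    using frechet_derivD(1)[OF D[OF that] Y[OF that]] Christoffel(1)[OF that Z[OF that] Y[OF that]] by auto
  have WT: "W q \<in> T" if "q \<in> G s" for q
    unfolding W_def by (intro tangent_diff mem that)
  have eq: "covariant_deriv s Y Z q = W q" if "q \<in> G s" for q
    unfolding W_def by (rule covariant_deriv_eq[where D = "D q"]) (use Z D Y that in auto)
  have "frechet W (\<lambda>h. (B h (Y p) + D p (L h))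
     - (dGamma p h (Z p) (Y p) + Christoffel p (D p h) (Y p) + Christoffel p (Z p) (L h))) p"
    unfolding W_def
    by (rule frechet_derivative_diff[OF p mem frechet_derivative_apply[OF p frechet_bounded_linear[OF D] B D2 Y L]
        frechet_derivative_Christoffel[OF p Z Y D[OF p] L]])
  note der = this
  have "frechet (covariant_deriv s Y Z) (\<lambda>h. (B h (Y p) + D p (L h))
     - (dGamma p h (Z p) (Y p) + Christoffel p (D p h) (Y p) + Christoffel p (Z p) (L h))) p"
    by (rule frechet_derivative_cong[where F = W, OF p _ der]) (simp add: eq)
  from covariant_deriv_eq[where Z = "covariant_deriv s Y Z" and Y = X and q = p, OF _ p this X] eq WT
  have "covariant_deriv s X (covariant_deriv s Y Z) p = B (X p) (Y p) + D p (L (X p))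
     - (dGamma p (X p) (Z p) (Y p) + Christoffel p (D p (X p)) (Y p) + Christoffel p (Z p) (L (X p)))
     - Christoffel p (W p) (X p)"
    using p by simp
  moreover have "Christoffel p (W p) (X p) = Christoffel p (D p (Y p)) (X p) - Christoffel p (Christoffel p (Z p) (Y p)) (X p)"
    unfolding W_def by (intro Christoffel_diff mem p X)
  ultimately show ?thesis by simp
qed

text \<open>The terms \<open>Christoffel p (D p (X p)) (Y p)\<close> and
  \<open>Christoffel p (D p (Y p)) (X p)\<close> occur in both iterated derivatives and cancel. The
  derivatives of \<open>X\<close> and \<open>Y\<close> assemble into the bracket, which the last
  term of the curvature removes.\<close>

lemma curvature_eq:
  assumes p: "p \<in> G s" and "C2_vector_field s X" "C2_vector_field s Y" "C2_vector_field s Z"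
  shows "curvature s X Y Z p =
    dGamma p (Y p) (Z p) (X p) - dGamma p (X p) (Z p) (Y p)
    + Christoffel p (Christoffel p (Z p) (Y p)) (X p) - Christoffel p (Christoffel p (Z p) (X p)) (Y p)"
proof -
  obtain DX BX where X': "\<forall>q\<in>G s. X q \<in> T" "\<forall>q\<in>G s. frechet X (DX q) q"
    by (rule C2_vector_fieldE[OF assms(2)])
  obtain DY BY where Y': "\<forall>q\<in>G s. Y q \<in> T" "\<forall>q\<in>G s. frechet Y (DY q) q"
    by (rule C2_vector_fieldE[OF assms(3)])
  obtain D B where Z': "\<forall>q\<in>G s. Z q \<in> T" "\<forall>q\<in>G s. frechet Z (D q) q"
    "\<forall>q\<in>G s. tangent_bounded_bilinear s (B q)" "\<forall>q\<in>G s. operator_derivative q D (B q)"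
    by (rule C2_vector_fieldE[OF assms(4)])
  note X = bspec[OF X'(1)] bspec[OF X'(2)] and Y = bspec[OF Y'(1)] bspec[OF Y'(2)]
    and Z = bspec[OF Z'(1)] bspec[OF Z'(2)] bspec[OF Z'(3)] bspec[OF Z'(4)]
  note Xp = X(1)[OF p] and Yp = Y(1)[OF p] and Zp = Z(1)[OF p]
  have sym: "B p (X p) (Y p) = B p (Y p) (X p)"
    by (rule second_derivative_symmetric[OF p Z(1,2) Z(3)[OF p] Z(4)[OF p] Xp Yp])
  have XY: "covariant_deriv s X (covariant_deriv s Y Z) p = B p (X p) (Y p) + D p (DY p (X p))
     - (dGamma p (X p) (Z p) (Y p) + Christoffel p (D p (X p)) (Y p) + Christoffel p (Z p) (DY p (X p)))
     - (Christoffel p (D p (Y p)) (X p) - Christoffel p (Christoffel p (Z p) (Y p)) (X p))"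
    by (rule covariant_deriv_covariant_deriv[where X = X, OF p Z(1) Y(1) Z(2) Z(3)[OF p] Z(4)[OF p] Y(2)[OF p] Xp])
  have YX: "covariant_deriv s Y (covariant_deriv s X Z) p = B p (Y p) (X p) + D p (DX p (Y p))
     - (dGamma p (Y p) (Z p) (X p) + Christoffel p (D p (Y p)) (X p) + Christoffel p (Z p) (DX p (Y p)))
     - (Christoffel p (D p (X p)) (Y p) - Christoffel p (Christoffel p (Z p) (X p)) (Y p))"
    by (rule covariant_deriv_covariant_deriv[where X = Y, OF p Z(1) X(1) Z(2) Z(3)[OF p] Z(4)[OF p] X(2)[OF p] Yp])
  have m: "DY p (X p) \<in> T" "DX p (Y p) \<in> T"
    using frechet_derivD(1)[OF Y(2)[OF p] Xp] frechet_derivD(1)[OF X(2)[OF p] Yp] by auto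
  have br: "Lie_bracket s X Y p = DY p (X p) - DX p (Y p)"
    unfolding Lie_bracket_def
    using frechet_deriv_eq[OF p Y(1) Y(2)[OF p] Xp] frechet_deriv_eq[OF p X(1) X(2)[OF p] Yp] by simp
  have "covariant_deriv s (Lie_bracket s X Y) Z p
      = D p (Lie_bracket s X Y p) - Christoffel p (Z p) (Lie_bracket s X Y p)"
    by (rule covariant_deriv_eq[OF Z(1) p Z(2)[OF p]]) (auto simp: br intro!: tangent_diff m)
  also have "D p (Lie_bracket s X Y p) = D p (DY p (X p)) - D p (DX p (Y p))"
    using frechet_derivD(2)[OF Z(2)[OF p] m(1) tangent_scaleR[OF m(2)], of "-1"]
      frechet_derivD(3)[OF Z(2)[OF p] m(2), of "-1"] by (simp add: br)
  also have "Christoffel p (Z p) (Lie_bracket s X Y p)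
      = Christoffel p (Z p) (DY p (X p)) - Christoffel p (Z p) (DX p (Y p))"
    unfolding br using Christoffel_diff[OF p m Zp]
    by (simp add: Christoffel_commute[OF p Zp] tangent_diff m)
  finally have Lie: "covariant_deriv s (Lie_bracket s X Y) Z p = D p (DY p (X p)) - D p (DX p (Y p))
      - (Christoffel p (Z p) (DY p (X p)) - Christoffel p (Z p) (DX p (Y p)))" .
  show ?thesis
    unfolding curvature_def XY YX Lie sym by (simp add: algebra_simps)
qed

text \<open>All local terms cancel; what survives comes from the mean inside \<open>gamma1\<close>,
  whose factor \<open>dfst p\<close> is undone by the reciprocal in the density. The right side has
  mean zero, and this is how the integrals disappear from the curvature.\<close>

lemma metric_density_scaled_diff:
  assumes p: "p \<in> G s" and u: "u \<in> T" and v: "v \<in> T" and w: "w \<in> T"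
  shows "metric_density p (Christoffel p w v) u x - metric_density p (Christoffel p w u) v x
      + density_deriv p v w u x - density_deriv p u w v x
    = (- (1/2) * mean (metric_density p w v)) * dfst u x + (1/2 * mean (metric_density p w u)) * dfst v x"
proof -
  \<comment> \<open>With \<open>r\<close> for the reciprocal of \<open>f\<close>, the claim is a
    polynomial identity modulo the single relation \<open>r * f = 1\<close>.\<close>
  have alg: "1/2 * ((w1 * v1 * r - w2 * v2 * f) - f * mv) * u1 * r - (-1/2) * ((w1 * v2 + v1 * w2) * r) * u2 * f
      - (1/2 * ((w1 * u1 * r - w2 * u2 * f) - f * mu) * v1 * r - (-1/2) * ((w1 * u2 + u1 * w2) * r) * v2 * f)
      + - (w1 * u1 * v1 * (r * r) + w2 * u2 * v1) - - (w1 * v1 * u1 * (r * r) + w2 * v2 * u1)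
      = (- (1/2) * mv) * u1 + (1/2 * mu) * v1"
    if "r * f = 1" for w1 w2 u1 u2 v1 v2 r f mu mv :: real
    using that by algebra
  have rf: "1 / dfst p x * dfst p x = 1" using GD'[OF p, of x] by simp
  have "metric_density p (Christoffel p w v) u x = gamma1 p w v x * dfst u x * (1 / dfst p x) - gamma2 p w v x * snd u x * dfst p x"
    "metric_density p (Christoffel p w u) v x = gamma1 p w u x * dfst v x * (1 / dfst p x) - gamma2 p w u x * snd v x * dfst p x"
    by (simp_all add: metric_density_def Christoffel p u v w)
  then show ?thesis
    using alg[OF rf] unfolding gamma1_def gamma2_def density_deriv_def
    by (simp only: metric_density_def[of p w v, THEN fun_cong] metric_density_def[of p w u, THEN fun_cong])
qed

text \<open>The curvature operator of a space of constant curvature 1. The second component is local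
  algebra; in the first, the four means multiplied by \<open>dfst p\<close> add up to zero by the
  mean of identity \<open>E\<close>.\<close>

lemma curvature_at_point:
  assumes p: "p \<in> G s" and u: "u \<in> T" and v: "v \<in> T" and w: "w \<in> T"
  shows "dGamma p v w u - dGamma p u w v
    + Christoffel p (Christoffel p w v) u - Christoffel p (Christoffel p w u) v
    = G_metric p w v *\<^sub>R u - G_metric p w u *\<^sub>R v" (is "?W = ?R")
proof (rule tangent_eqI)
  note Gwv = Christoffel(1)[OF p w v] and Gwu = Christoffel(1)[OF p w u]
  note mem = dGamma(1)[OF p v w u] dGamma(1)[OF p u w v]
    Christoffel(1)[OF p Gwv u] Christoffel(1)[OF p Gwu v]
  note mem2 = tangent_diff[OF mem(1,2)] tangent_add[OF tangent_diff[OF mem(1,2)] mem(3)]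
  show "?W \<in> T"
    by (rule tangent_diff[OF mem2(2) mem(4)])
  show "?R \<in> T"
    by (intro tangent_diff tangent_scaleR u v)
  define mv mu where "mv = mean (metric_density p w v)" and "mu = mean (metric_density p w u)"
  define d1 d2 where "d1 = density_deriv p v w u" and "d2 = density_deriv p u w v"
  define g1 g2 where "g1 = metric_density p (Christoffel p w v) u" and "g2 = metric_density p (Christoffel p w u) v"
  have E: "g1 x - g2 x + d1 x - d2 x = (- (1/2) * mv) * dfst u x + (1/2 * mu) * dfst v x" for x
    unfolding g1_def g2_def d1_def d2_def mv_def mu_def by (rule metric_density_scaled_diff[OF assms])
  have A: "g1 \<in> A" "g2 \<in> A" "d1 \<in> A" "d2 \<in> A"
    unfolding g1_def g2_def d1_def d2_def
    by (intro A_metric_density A_density_deriv p u v w Gwv Gwu)+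
  have "mean (\<lambda>x. g1 x - g2 x + d1 x - d2 x) = mean g1 - mean g2 + mean d1 - mean d2"
    by (simp only: mean_add mean_diff A_intros A)
  moreover have "mean (\<lambda>x. (- (1/2) * mv) * dfst u x + (1/2 * mu) * dfst v x) = 0"
    using tangentD(2)[OF u] tangentD(2)[OF v]
    by (simp only: mean_add mean_cmult A_intros mean_dfst[OF u] mean_dfst[OF v])
  ultimately have mean: "mean g1 - mean g2 + mean d1 - mean d2 = 0"
    unfolding E by simp
  fix x
  define f where "f = dfst p x"
  have "dfst ?W x
    = gamma1_deriv p v w u x - gamma1_deriv p u w v x + gamma1 p (Christoffel p w v) u x - gamma1 p (Christoffel p w u) v x"
    by (simp add: dfst_diff dfst_add mem mem2 dGamma(2) Christoffel(2)[OF p Gwv u] Christoffel(2)[OF p Gwu v] p u v w)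
  also have "\<dots> = 1/2 * (d1 x - (dfst v x * mu + f * mean d1)) - 1/2 * (d2 x - (dfst u x * mv + f * mean d2))
      + 1/2 * (g1 x - f * mean g1) - 1/2 * (g2 x - f * mean g2)"
    unfolding gamma1_deriv_def gamma1_def d1_def d2_def g1_def g2_def mv_def mu_def f_def ..
  also have "\<dots> = 1/2 * (g1 x - g2 x + d1 x - d2 x) - 1/2 * f * (mean g1 - mean g2 + mean d1 - mean d2)
      + 1/2 * (dfst u x * mv - dfst v x * mu)"
    by (simp add: algebra_simps add_divide_distrib diff_divide_distrib)
  \<comment> \<open>By \<open>E\<close> the local part contributes
    \<open>- 1/4 * mv * dfst u x + 1/4 * mu * dfst v x\<close>, which halves the explicit terms with
    coefficient 1/2 and leaves the 1/4 of the metric.\<close>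
  also have "\<dots> = 1/4 * mv * dfst u x - 1/4 * mu * dfst v x"
    unfolding mean E by (simp add: algebra_simps)
  also have "\<dots> = dfst ?R x"
    by (simp add: dfst_diff dfst_scaleR tangent_scaleR u v G_metric_conv_mean mv_def mu_def)
  finally show "dfst ?W x
    = dfst ?R x" .
  have alg: "1/2 * ((w1 * u2 + u1 * w2) * v1 * (r * r)) - 1/2 * ((w1 * v2 + v1 * w2) * u1 * (r * r))
      + (-1/2) * ((1/2 * ((w1 * v1 * r - w2 * v2 * f) - f * Mv) * u2 + u1 * ((-1/2) * ((w1 * v2 + v1 * w2) * r))) * r)
      - (-1/2) * ((1/2 * ((w1 * u1 * r - w2 * u2 * f) - f * Mu) * v2 + v1 * ((-1/2) * ((w1 * u2 + u1 * w2) * r))) * r)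
      = 1/4 * Mv * u2 - 1/4 * Mu * v2"
    if "r * f = 1" for w1 w2 u1 u2 v1 v2 r f Mu Mv :: real
    using that by algebra
  have rf: "1 / dfst p x * dfst p x = 1" using GD'[OF p, of x] by simp
  have "snd ?W x
    = gamma2_deriv p v w u x - gamma2_deriv p u w v x + gamma2 p (Christoffel p w v) u x - gamma2 p (Christoffel p w u) v x"
    by (simp add: dGamma(3) Christoffel(3)[OF p Gwv u] Christoffel(3)[OF p Gwu v] p u v w)
  also have "\<dots> = 1/4 * mv * snd u x - 1/4 * mu * snd v x"
    unfolding gamma2_deriv_def gamma2_def[of p "Christoffel p w v"] gamma2_def[of p "Christoffel p w u"]
      Christoffel(2,3)[OF p w v] Christoffel(2,3)[OF p w u] mv_def mu_def
    unfolding gamma1_def gamma2_def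
    using alg[OF rf]
    by (simp only: metric_density_def[of p w v, THEN fun_cong] metric_density_def[of p w u, THEN fun_cong])
  also have "\<dots> = snd ?R x"
    by (simp add: G_metric_conv_mean mv_def mu_def)
  finally show "snd ?W x
    = snd ?R x" .
qed

text \<open>In the global chart every tangent vector extends to a constant field. This makes the
  condition in \<open>curvature_tensor\<close> non-vacuous, so that at most one value can satisfy
  it.\<close>

lemma C2_constant_field:
  assumes "u \<in> T"
  shows "C2_vector_field s (\<lambda>q. u)"
proof -
  have lin: "tangent_linear s (\<lambda>h. 0)"
    by (simp add: tangent_linear_def tangent_0)
  have "tangent_bounded_linear s (\<lambda>h. 0)"
    unfolding tangent_bounded_linear_def using lin by (auto simp: tn_0 intro!: exI[of _ 0])
  moreover have "tangent_bounded_bilinear s (\<lambda>h k. 0)"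
    unfolding tangent_bounded_bilinear_def using lin by (auto simp: tn_0 intro!: exI[of _ 0])
  ultimately show ?thesis
    unfolding C2_vector_field_def has_frechet_derivative_def using assms
    by (intro conjI exI[of _ "\<lambda>p h. 0"] exI[of _ "\<lambda>p h k. 0"])
       (auto simp: tn_0 intro!: exI[of _ "1::real"])
qed

lemma curvature_tensor_eq:
  assumes p: "p \<in> G s" and u: "u \<in> T" and v: "v \<in> T" and w: "w \<in> T"
  shows "curvature_tensor s p u v w = G_metric p w v *\<^sub>R u - G_metric p w u *\<^sub>R v"
  unfolding curvature_tensor_def
proof (rule the_equality)
  show *: "\<forall>X Y Z. C2_vector_field s X \<and> C2_vector_field s Y \<and> C2_vector_field s Z \<and>
     X p = u \<and> Y p = v \<and> Z p = w \<longrightarrow> curvature s X Y Z p = G_metric p w v *\<^sub>R u - G_metric p w u *\<^sub>R v"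
  proof (intro allI impI, elim conjE)
    fix X Y Z assume "C2_vector_field s X" "C2_vector_field s Y" "C2_vector_field s Z" "X p = u" "Y p = v" "Z p = w"
    then show "curvature s X Y Z p = G_metric p w v *\<^sub>R u - G_metric p w u *\<^sub>R v"
      using curvature_eq[OF p, of X Y Z] curvature_at_point[OF assms] by simp
  qed
  fix r assume "\<forall>X Y Z. C2_vector_field s X \<and> C2_vector_field s Y \<and> C2_vector_field s Z \<and>
     X p = u \<and> Y p = v \<and> Z p = w \<longrightarrow> curvature s X Y Z p = r"
  note r = this[rule_format, of "\<lambda>q. u" "\<lambda>q. v" "\<lambda>q. w"]
    and * = *[rule_format, of "\<lambda>q. u" "\<lambda>q. v" "\<lambda>q. w"]
  show "r = G_metric p w v *\<^sub>R u - G_metric p w u *\<^sub>R v"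
    using r * C2_constant_field u v w by simp
qed

lemma G_metric_commute: "G_metric p U V = G_metric p V U"
  by (simp add: G_metric_conv_mean metric_density_commute[of p U V])

lemma G_metric_add: "p \<in> G s \<Longrightarrow> U \<in> T \<Longrightarrow> U' \<in> T \<Longrightarrow> V \<in> T \<Longrightarrow>
    G_metric p (U + U') V = G_metric p U V + G_metric p U' V"
  by (simp add: G_metric_conv_mean metric_density_add mean_add A_metric_density)

lemma G_metric_scaleR: "p \<in> G s \<Longrightarrow> U \<in> T \<Longrightarrow> V \<in> T \<Longrightarrow> G_metric p (c *\<^sub>R U) V = c * G_metric p U V"
  by (simp add: G_metric_conv_mean metric_density_scaleR mean_cmult A_metric_density)

text \<open>For \<open>w = v\<close> the pairing of the curvature vector with \<open>u\<close> is
  the Gram determinant of \<open>u\<close> and \<open>v\<close>, the denominator itself; the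
  nondegeneracy hypothesis permits the division in spite of the indefinite metric.\<close>

lemma sectional_curvature_eq_1:
  assumes p: "p \<in> G s" and u: "u \<in> T" and v: "v \<in> T"
    and "G_metric p u u * G_metric p v v - (G_metric p u v)\<^sup>2 \<noteq> 0"
  shows "sectional_curvature s p u v = 1"
proof -
  have "curvature_tensor s p u v v = G_metric p v v *\<^sub>R u + (- G_metric p v u) *\<^sub>R v"
    by (simp add: curvature_tensor_eq[OF p u v v])
  then have "G_metric p (curvature_tensor s p u v v) u
      = G_metric p u u * G_metric p v v - (G_metric p u v)\<^sup>2"
    using u v p
    by (simp only: G_metric_add G_metric_scaleR tangent_scaleR)
       (simp add: power2_eq_square G_metric_commute[of p v u])
  then show ?thesis
    using assms(4) by (simp add: sectional_curvature_def)
qed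

end

theorem corollary3p1:
  fixes s :: real
  assumes "s > 5/2"
  shows "\<forall>p\<in>G s. \<forall>u\<in>tangent s. \<forall>v\<in>tangent s.
           G_metric p u u * G_metric p v v - (G_metric p u v)\<^sup>2 \<noteq> 0 \<longrightarrow>
           sectional_curvature s p u v = 1"
  using circle_sobolev.sectional_curvature_eq_1[OF circle_sobolev.intro[OF assms]] by blast

end
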